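(* Let $d\ge 2$ and $\delta>0$. For every $R>0$, as $\lambda\to\infty$ the random functions $\hat s_\lambda$ converge in law to $\partial\Psi$, and the random functions $\hat r_\lambda$ converge in law to $\partial\Phi$, in the space $\mathcal{C}(B_{d-1}(\mathbf{0},R))$ of continuous functions on $B_{d-1}(\mathbf{0},R)$ endowed with the supremum norm.
   Context: $\mathbb{B}^d$ is the closed unit ball of $\mathbb{R}^d$ centered at the origin, $\mathbb{S}^{d-1}$ its boundary sphere, $B_{d-1}(\mathbf 0,R)$ the closed ball of radius $R$ in $\mathbb{R}^{d-1}$, $\mathbb{R}_+=[0,\infty)$. For $\lambda>0$, $\mathcal{P}_\lambda$ is the Poisson point process in $\mathbb{B}^d$ with intensity $\lambda(1-|x|)^{\delta}\,dx$, and $K_\lambda=\mathrm{conv}(\mathcal{P}_\lambda)$ is its convex hull. Put $\beta=\frac{1}{d+1+2\delta}$, $\gamma=2\beta$. Defect support function: $s_\lambda(u)=1-\sup\{\langle x,u\rangle: x\in\mathcal{P}_\lambda\}$, $u\in\mathbb{S}^{d-1}$. Defect radius-vector function: $r_\lambda(u)=1-\sup\{\varrho>0:\varrho u\in K_\lambda\}$. Standing convention: $K_\lambda$ is assumed to contain the origin in its interior; the complementary event has probability exponentially small in $\lambda$ and on it one sets, say, $s_\lambda\equiv r_\lambda\equiv 1$. Exponential map $\exp_{d-1}:\mathbb{R}^{d-1}\to\mathbb{S}^{d-1}$ at $u_0=(0,\dots,0,1)$: $\exp_{d-1}(v)=\cos(|v|)(0,\dots,0,1)+\sin(|v|)\left(\frac{v}{|v|},0\right)$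 for $v\ne \mathbf 0$, $\exp_{d-1}(\mathbf{0})=u_0$. Rescaled functions, $v\in\mathbb{R}^{d-1}$: $$\hat s_\lambda(v)=\lambda^\gamma s_\lambda(\exp_{d-1}(\lambda^{-\beta}v)),\qquad \hat r_\lambda(v)=\lambda^\gamma r_\lambda(\exp_{d-1}(\lambda^{-\beta}v)).$$ Limit objects: $\mathcal{P}$ is the Poisson point process in $\mathbb{R}^{d-1}\times\mathbb{R}_+$ with intensity $h^\delta\,dh\,dv$ at $(v,h)$. Paraboloid growth process: $\Psi=\bigcup_{x\in\mathcal{P}}(x\oplus\Pi^{\uparrow})$ with $\Pi^\uparrow=\{(v,h)\in\mathbb{R}^{d-1}\times\mathbb{R}_+: h\ge |v|^2/2\}$ and $\oplus$ Minkowski addition. Paraboloid hull process: for points $x_1=(v_1,h_1),x_2=(v_2,h_2)$ with $v_1\neq v_2$, the parabolic segment $\Pi^{[\cdot]}[x_1,x_2]$ is the arc joining $x_1$ to $x_2$ of the unique parabola with quadratic coefficient $-1/2$ (in arclength along the line through $v_1,v_2$) in $\mathrm{aff}[v_1,v_2]\times\mathbb{R}$ through $x_1,x_2$. A set $A\subseteq\mathbb{R}^{d-1}\times\mathbb{R}_+$ is up-convex if it contains $\Pi^{[\cdot]}[x_1,x_2]$ for all $x_1,x_2\in A$ and if $(v,h)\in A$, $h'\ge h$ imply $(v,h')\in A$. $\Phi$ is the smallest up-convex set containing $\mathcal{P}$. The boundaries $\partial\Psi$, $\partial\Phi$ are identified with the continuous functions $\partial\Psi(v)=\inf\{h:(v,h)\in\Psi\}$,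 $\partial\Phi(v)=\inf\{h:(v,h)\in\Phi\}$ on $\mathbb{R}^{d-1}$. *)

theory Defs
  imports "HOL-Probability.Probability"
begin

section \<open>Poisson point processes\<close>

text \<open>
  A point configuration is a set of points, so \<^term>\<open>card (P \<omega> \<inter> A)\<close> is the number of points in
  \<^term>\<open>A\<close>; multiplicities are not needed for the diffuse intensities below.  \<^term>\<open>E\<close> is the state
  space.  The intensity \<^term>\<open>\<mu>\<close> is meant to be finite on bounded sets, so that counting points in
  bounded Borel sets determines the law.  The Poisson weights are written out because
  \<^const>\<open>poisson_pmf\<close> requires a positive rate.
\<close>

definition poisson_point_process ::
  "'w measure \<Rightarrow> 'a::euclidean_space set \<Rightarrow> 'a measure \<Rightarrow> ('w \<Rightarrow> 'a set) \<Rightarrow> bool" where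
  "poisson_point_process M E \<mu> P \<longleftrightarrow>
     prob_space M \<and>
     (\<forall>\<omega>\<in>space M. P \<omega> \<subseteq> E \<and> (\<forall>A. bounded A \<longrightarrow> finite (P \<omega> \<inter> A))) \<and>
     (\<forall>A\<in>sets borel. bounded A \<longrightarrow>
        (\<lambda>\<omega>. card (P \<omega> \<inter> A)) \<in> measurable M (count_space UNIV) \<and>
        (\<forall>k. measure M {\<omega> \<in> space M. card (P \<omega> \<inter> A) = k} =
               measure \<mu> A ^ k / fact k * exp (- measure \<mu> A))) \<and>
     (\<forall>\<A>. finite \<A> \<and> \<A> \<subseteq> {A \<in> sets borel. bounded A} \<and> disjoint \<A> \<longrightarrow>
        prob_space.indep_vars M (\<lambda>_. count_space UNIV) (\<lambda>A \<omega>. card (P \<omega> \<inter> A)) \<A>)"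

definition ball_intensity :: "real \<Rightarrow> real \<Rightarrow> 'a::euclidean_space measure" where
  "ball_intensity \<delta> lam =
     density lborel (\<lambda>x. ennreal (lam * (1 - norm x) powr \<delta>) * indicator (cball 0 1) x)"

definition halfspace_intensity :: "real \<Rightarrow> ('v::euclidean_space \<times> real) measure" where
  "halfspace_intensity \<delta> =
     density lborel (\<lambda>(v, h). ennreal (h powr \<delta>) * indicator {0..} h)"


section \<open>Random polytopes in the ball\<close>

text \<open>
  The space \<open>\<real>\<^sup>d\<close> is \<^typ>\<open>'v \<times> real\<close> with its Euclidean structure, where \<^typ>\<open>'v\<close> stands for
  \<open>\<real>\<^sup>d\<^sup>-\<^sup>1\<close>; the pole \<open>(0,\<dots>,0,1)\<close> is \<^term>\<open>(0, 1)\<close>.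

  Both defect functions are set to 1 if the origin is not an interior point of the convex hull.
\<close>

definition support_defect :: "'a::euclidean_space set \<Rightarrow> 'a \<Rightarrow> real" where
  "support_defect X u =
     (if 0 \<in> interior (convex hull X) then 1 - Sup {x \<bullet> u | x. x \<in> X} else 1)"

definition radius_defect :: "'a::euclidean_space set \<Rightarrow> 'a \<Rightarrow> real" where
  "radius_defect X u =
     (if 0 \<in> interior (convex hull X)
      then 1 - Sup {\<rho>. \<rho> > 0 \<and> \<rho> *\<^sub>R u \<in> convex hull X} else 1)"

definition exp_map :: "'v::euclidean_space \<Rightarrow> 'v \<times> real" where
  "exp_map v =
     (if v = 0 then (0, 1) else cos (norm v) *\<^sub>R (0, 1) + sin (norm v) *\<^sub>R (v /\<^sub>R norm v, 0))"

definition beta_exp :: "nat \<Rightarrow> real \<Rightarrow> real" where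
  "beta_exp d \<delta> = 1 / (real d + 1 + 2 * \<delta>)"

definition gamma_exp :: "nat \<Rightarrow> real \<Rightarrow> real" where
  "gamma_exp d \<delta> = 2 * beta_exp d \<delta>"

definition rescale ::
  "nat \<Rightarrow> real \<Rightarrow> real \<Rightarrow> ('v::euclidean_space \<times> real \<Rightarrow> real) \<Rightarrow> 'v \<Rightarrow> real" where
  "rescale d \<delta> lam f v =
     lam powr gamma_exp d \<delta> * f (exp_map (lam powr (- beta_exp d \<delta>) *\<^sub>R v))"


section \<open>Paraboloid growth and hull processes\<close>

definition up_paraboloid :: "('v::euclidean_space \<times> real) set" where
  "up_paraboloid = {(v, h). h \<ge> 0 \<and> h \<ge> (norm v)\<^sup>2 / 2}"

definition paraboloid_growth :: "('v::euclidean_space \<times> real) set \<Rightarrow> ('v \<times> real) set" where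
  "paraboloid_growth X = (\<Union>x\<in>X. {x + y | y. y \<in> up_paraboloid})"

text \<open>
  For \<^term>\<open>v1 \<noteq> v2\<close>, \<^term>\<open>s\<close> is arclength from \<^term>\<open>v1\<close> towards \<^term>\<open>v2\<close>; the last two conditions
  say that the parabola \<open>s \<mapsto> - s\<^sup>2 / 2 + a s + b\<close> passes through both points, which determines
  \<^term>\<open>a\<close> and \<^term>\<open>b\<close>.
\<close>

definition parabolic_segment ::
  "'v::euclidean_space \<times> real \<Rightarrow> 'v \<times> real \<Rightarrow> ('v \<times> real) set" where
  "parabolic_segment = (\<lambda>(v1, h1) (v2, h2).
     {(v1 + s *\<^sub>R ((v2 - v1) /\<^sub>R norm (v2 - v1)), - s\<^sup>2 / 2 + a * s + b) | s a b.
        0 \<le> s \<and> s \<le> norm (v2 - v1) \<and>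
        b = h1 \<and> - (norm (v2 - v1))\<^sup>2 / 2 + a * norm (v2 - v1) + b = h2})"

definition up_convex :: "('v::euclidean_space \<times> real) set \<Rightarrow> bool" where
  "up_convex A \<longleftrightarrow>
     A \<subseteq> UNIV \<times> {0..} \<and>
     (\<forall>x1\<in>A. \<forall>x2\<in>A. fst x1 \<noteq> fst x2 \<longrightarrow> parabolic_segment x1 x2 \<subseteq> A) \<and>
     (\<forall>v h h'. (v, h) \<in> A \<and> h' \<ge> h \<longrightarrow> (v, h') \<in> A)"

definition paraboloid_hull :: "('v::euclidean_space \<times> real) set \<Rightarrow> ('v \<times> real) set" where
  "paraboloid_hull X = up_convex hull X"

lemma parabolic_segment_nonneg:
  assumes "fst x1 \<noteq> fst x2" "snd x1 \<ge> 0" "snd x2 \<ge> 0"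
  shows "parabolic_segment x1 x2 \<subseteq> UNIV \<times> {0..}"
proof -
  obtain v1 h1 v2 h2 where x: "x1 = (v1, h1)" "x2 = (v2, h2)"
    by (metis prod.exhaust)
  define L where "L = norm (v2 - v1)"
  have L: "L > 0" using assms x by (auto simp: L_def)
  have "- s\<^sup>2 / 2 + a * s + h1 \<ge> 0"
    if s: "0 \<le> s" "s \<le> L" and a: "- L\<^sup>2 / 2 + a * L + h1 = h2" for s a
  proof -
    have "L * (- s\<^sup>2 / 2 + a * s + h1) =
          (L - s) * h1 + s * (- L\<^sup>2 / 2 + a * L + h1) + L * s * (L - s) / 2"
      by (simp add: field_simps power2_eq_square)
    also have "\<dots> \<ge> 0"
      using s L assms x unfolding a by simp
    finally show ?thesis using L by (simp add: zero_le_mult_iff)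
  qed
  then show ?thesis
    unfolding parabolic_segment_def x by (auto simp: L_def)
qed

text \<open>The least up-convex superset exists, so the hull operator yields it.\<close>

lemma up_convex_paraboloid_hull:
  fixes X :: "('v::euclidean_space \<times> real) set"
  assumes "X \<subseteq> UNIV \<times> {0..}"
  shows "up_convex (paraboloid_hull X)"
proof -
  let ?\<A> = "{A. up_convex A \<and> X \<subseteq> A}"
  have "parabolic_segment x1 x2 \<subseteq> UNIV \<times> {0..}"
    if "x1 \<in> UNIV \<times> {0..}" "x2 \<in> UNIV \<times> {0..}" "fst x1 \<noteq> fst x2" for x1 x2 :: "'v \<times> real"
    using that by (intro parabolic_segment_nonneg) auto
  then have "up_convex (UNIV \<times> {0..} :: ('v \<times> real) set)"
    unfolding up_convex_def by simp
  then have "\<Inter>?\<A> \<subseteq> UNIV \<times> {0..}"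
    using assms by blast
  moreover have "parabolic_segment x1 x2 \<subseteq> \<Inter>?\<A>"
    if "x1 \<in> \<Inter>?\<A>" "x2 \<in> \<Inter>?\<A>" "fst x1 \<noteq> fst x2" for x1 x2
  proof (rule Inter_greatest)
    fix A assume A: "A \<in> ?\<A>"
    then have "x1 \<in> A" "x2 \<in> A" using that by auto
    with A that show "parabolic_segment x1 x2 \<subseteq> A" by (simp add: up_convex_def)
  qed
  moreover have "(v, h') \<in> \<Inter>?\<A>" if "(v, h) \<in> \<Inter>?\<A>" "h' \<ge> h" for v h h'
  proof (rule InterI)
    fix A assume A: "A \<in> ?\<A>"
    then have "(v, h) \<in> A" using that by auto
    with A that show "(v, h') \<in> A" unfolding up_convex_def by blast
  qed
  ultimately have "up_convex (\<Inter>?\<A>)"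
    unfolding up_convex_def[of "\<Inter>?\<A>"] by blast
  then show ?thesis
    by (simp add: paraboloid_hull_def hull_def)
qed

definition lower_boundary :: "('v \<times> real) set \<Rightarrow> 'v \<Rightarrow> real" where
  "lower_boundary A v = Inf {h. (v, h) \<in> A}"


section \<open>Convergence in law in a metric space\<close>

definition mborel :: "'b metric \<Rightarrow> 'b measure" where
  "mborel m = sigma (mspace m) {U. openin (mtopology_of m) U}"

text \<open>
  \<^term>\<open>X'\<close> is an everywhere defined random element of \<^term>\<open>m\<close> that agrees almost surely with
  \<^term>\<open>X\<close>.  This allows \<^term>\<open>X\<close> to leave the space on a null set, as the hull boundary does
  on degenerate configurations (for instance a single point, whose up-convex hull is a vertical ray).
\<close>

definition random_element_version ::
  "'b metric \<Rightarrow> 'w measure \<Rightarrow> ('w \<Rightarrow> 'b) \<Rightarrow> ('w \<Rightarrow> 'b) \<Rightarrow> bool" where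
  "random_element_version m M X X' \<longleftrightarrow>
     X' \<in> measurable M (mborel m) \<and> (AE \<omega> in M. X \<omega> = X' \<omega>)"

text \<open>
  Weak convergence of the laws of the random elements \<^term>\<open>X lam\<close> of \<^term>\<open>m\<close>, for
  \<^term>\<open>lam > 0\<close>, to the law of \<^term>\<open>Y\<close> as \<^term>\<open>lam\<close> tends to infinity.  The choice of versions
  does not affect the expectations.
\<close>

definition converges_in_law ::
  "'b metric \<Rightarrow> (real \<Rightarrow> 'w measure) \<Rightarrow> (real \<Rightarrow> 'w \<Rightarrow> 'b) \<Rightarrow> 'z measure \<Rightarrow> ('z \<Rightarrow> 'b) \<Rightarrow> bool" where
  "converges_in_law m M X N Y \<longleftrightarrow>
     (\<exists>X' Y'.
        (\<forall>lam>0. random_element_version m (M lam) (X lam) (X' lam)) \<and>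
        random_element_version m N Y Y' \<and>
        (\<forall>F. continuous_map (mtopology_of m) euclideanreal F \<and> bounded (F ` mspace m) \<longrightarrow>
           ((\<lambda>lam. \<integral>\<omega>. F (X' lam \<omega>) \<partial>M lam) \<longlongrightarrow> (\<integral>\<omega>. F (Y' \<omega>) \<partial>N)) at_top))"

text \<open>
  The space of continuous real functions on the compact set \<^term>\<open>B\<close> with the supremum metric.  Its
  elements are extensional, so a function on the whole space is viewed in it by \<^const>\<open>restrict\<close>.
\<close>

definition continuous_functions_on :: "'v::euclidean_space set \<Rightarrow> ('v \<Rightarrow> real) metric" where
  "continuous_functions_on B = cfunspace (top_of_set B) euclidean_metric"

end

theory Submission
  imports Defs
begin

text \<open>
  With \<open>e = lam powr - beta\<close>, the affine chart \<open>(w, g) \<mapsto> (e w, 1 - e\<^sup>2 g)\<close> at the pole turns the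
  rescaled intensity in the ball into one converging to \<open>(g - |w|\<^sup>2/2)\<^sub>+ powr \<delta>\<close>, which is the image
  of the limit intensity under the shear \<open>(w, h) \<mapsto> (w, h + |w|\<^sup>2/2)\<close>.  The rescaled defect support
  function is the minimum over the points of functions converging to
  \<open>v \<mapsto> g - \<langle>w, v\<rangle> + |v|\<^sup>2/2\<close>, and the boundary of the growth process is the minimum of the latter.
  Hence joint survival probabilities at finitely many \<open>v\<close> are void probabilities of a single bounded
  set, and their convergence follows by dominated convergence.  Since with high probability these
  minima are uniformly bounded and Lipschitz, this already gives convergence in law in the space of
  continuous functions.

  In the sheared coordinates parabolic segments are straight, so the hull boundary is
  \<open>\<Phi>(v) = sup\<^sub>a (\<Psi>(a) - |v - a|\<^sup>2/2)\<close> by duality, and the rescaled defect radius function is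
  the same functional of the rescaled defect support function up to a vanishing error.  When points
  occur in finitely many cells surrounding the window, the supremum may be restricted to a bounded
  set of \<open>a\<close>, on which it is a Lipschitz functional of \<open>\<Psi>\<close>.
\<close>

section \<open>Convergence in law in a metric space\<close>

text \<open>The exponents come from one balance: the chart has Jacobian
  \<open>e ^ DIM('v) * e\<^sup>2\<close> and the density contributes
  \<open>(e\<^sup>2) powr \<delta>\<close>, so masses of order one force
  \<open>e powr (d + 1 + 2 * \<delta>) = 1 / lam\<close>. Void probabilities see only minima over
  the points. The hull boundary and the radius function are not such minima, so their joint laws are
  not directly accessible; they are reached through a continuous map applied to the support and
  growth functions on a larger window. The obstacle there is locality, since far away points may
  shape the hull over the window. Hits in cells placed around the window bound the slopes of the
  relevant supporting hyperplanes, uniformly in lam, and this slope is the very parameter a of the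
  dual formula. The bounds on values and Lipschitz constants enter directly: a random function is
  compared with the interpolant of its rounded values on a finite net, and expectations of
  functionals of such interpolants are finite sums of box probabilities.\<close>

definition lipschitz_functional :: "'b metric \<Rightarrow> real \<Rightarrow> ('b \<Rightarrow> real) \<Rightarrow> bool" where
  "lipschitz_functional m C F \<longleftrightarrow> C \<ge> 0 \<and>
     (\<forall>x\<in>mspace m. \<forall>y\<in>mspace m. \<bar>F x - F y\<bar> \<le> C * mdist m x y)"

lemma lipschitz_functional_continuous:
  assumes "lipschitz_functional m C F"
  shows "continuous_map (mtopology_of m) euclideanreal F"
proof -
  have "Lipschitz_continuous_map m euclidean_metric F"
    using assms unfolding lipschitz_functional_def Lipschitz_continuous_map_def
    by (auto simp: dist_real_def)
  then show ?thesis
    using Lipschitz_imp_uniformly_continuous_map uniformly_continuous_imp_continuous_map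
    by (metis mtopology_of_euclidean)
qed

lemma space_mborel [simp]: "space (mborel m) = mspace m"
  unfolding mborel_def by (rule space_measure_of) (metis (no_types, lifting) CollectD PowI openin_subset subsetI topspace_mtopology_of)

lemma sets_mborel: "sets (mborel m) = sigma_sets (mspace m) {U. openin (mtopology_of m) U}"
  unfolding mborel_def by (rule sets_measure_of) (metis (no_types, lifting) CollectD PowI openin_subset subsetI topspace_mtopology_of)

lemma measurable_continuous_map_mborel:
  assumes "continuous_map (mtopology_of m) euclideanreal F"
  shows "F \<in> borel_measurable (mborel m)"
proof (rule borel_measurableI)
  fix S :: "real set" assume "open S"
  then have "openin (mtopology_of m) {x \<in> topspace (mtopology_of m). F x \<in> S}"
    using assms openin_continuous_map_preimage by fastforce
  moreover have "F -` S \<inter> space (mborel m) = {x \<in> topspace (mtopology_of m). F x \<in> S}"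
    by auto
  ultimately show "F -` S \<inter> space (mborel m) \<in> sets (mborel m)"
    unfolding sets_mborel by auto
qed

lemma integrable_bounded_functional:
  assumes "prob_space M" "X \<in> measurable M (mborel m)"
    "continuous_map (mtopology_of m) euclideanreal F"
    "\<And>x. x \<in> mspace m \<Longrightarrow> \<bar>F x\<bar> \<le> B"
  shows "integrable M (\<lambda>\<omega>. F (X \<omega>))"
proof -
  interpret prob_space M by fact
  show ?thesis
  proof (rule integrable_const_bound[where B = B])
    show "AE \<omega> in M. norm (F (X \<omega>)) \<le> B"
      using assms(4) measurable_space[OF assms(2)] by simp
    show "(\<lambda>\<omega>. F (X \<omega>)) \<in> borel_measurable M"
      using measurable_compose[OF assms(2) measurable_continuous_map_mborel[OF assms(3)]] .
  qed
qed

text \<open>The Pasch-Hausdorff envelope: for bounded F, the largest minorant with Lipschitz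
  constant \<open>real k\<close>.\<close>

definition inf_convolution :: "'b metric \<Rightarrow> ('b \<Rightarrow> real) \<Rightarrow> nat \<Rightarrow> 'b \<Rightarrow> real" where
  "inf_convolution m F k x = (INF y\<in>mspace m. F y + real k * mdist m x y)"

lemma inf_convolution:
  assumes B: "\<And>x. x \<in> mspace m \<Longrightarrow> \<bar>F x\<bar> \<le> B"
  shows inf_convolution_le: "x \<in> mspace m \<Longrightarrow> inf_convolution m F k x \<le> F x"
    and inf_convolution_abs: "x \<in> mspace m \<Longrightarrow> \<bar>inf_convolution m F k x\<bar> \<le> B"
    and inf_convolution_lipschitz: "lipschitz_functional m (real k) (inf_convolution m F k)"
    and inf_convolution_tendsto:
      "\<lbrakk>continuous_map (mtopology_of m) euclideanreal F; x \<in> mspace m\<rbrakk>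
        \<Longrightarrow> (\<lambda>k. inf_convolution m F k x) \<longlonglongrightarrow> F x"
proof -
  have bdd: "bdd_below ((\<lambda>y. F y + real k * mdist m x y) ` mspace m)" for k x
  proof (rule bdd_belowI2[where m = "-B"])
    fix y assume "y \<in> mspace m"
    from B[OF this] show "- B \<le> F y + real k * mdist m x y"
      by (smt (verit) mdist_nonneg mult_nonneg_nonneg of_nat_0_le_iff)
  qed
  have ge: "- B \<le> inf_convolution m F k x" if "x \<in> mspace m" for k x
    unfolding inf_convolution_def
  proof (rule cINF_greatest)
    show "mspace m \<noteq> {}" using that by auto
    fix y assume "y \<in> mspace m"
    from B[OF this] show "- B \<le> F y + real k * mdist m x y"
      by (smt (verit) mdist_nonneg mult_nonneg_nonneg of_nat_0_le_iff)
  qed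
  show le: "inf_convolution m F k x \<le> F x" if "x \<in> mspace m" for k x
  proof -
    have "mdist m x x = 0" using that by simp
    then show ?thesis
      unfolding inf_convolution_def by (intro cINF_lower2[OF bdd that]) simp
  qed
  show "\<bar>inf_convolution m F k x\<bar> \<le> B" if "x \<in> mspace m" for k x
    using ge[OF that, of k] le[OF that, of k] B[OF that] by linarith
  have lip: "inf_convolution m F k x \<le> inf_convolution m F k x' + real k * mdist m x x'"
    if x: "x \<in> mspace m" "x' \<in> mspace m" for k x x'
  proof -
    have "inf_convolution m F k x - real k * mdist m x x' \<le> inf_convolution m F k x'"
      unfolding inf_convolution_def[of m F k x']
    proof (rule cINF_greatest)
      show "mspace m \<noteq> {}" using x by auto
      fix y assume y: "y \<in> mspace m"
      have "inf_convolution m F k x \<le> F y + real k * mdist m x y"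
        unfolding inf_convolution_def by (rule cINF_lower[OF bdd y])
      moreover have "real k * mdist m x y \<le> real k * mdist m x x' + real k * mdist m x' y"
        using mdist_triangle[OF x(1,2) y] by (metis distrib_left mult_left_mono of_nat_0_le_iff)
      ultimately show "inf_convolution m F k x - real k * mdist m x x' \<le> F y + real k * mdist m x' y"
        by linarith
    qed
    then show ?thesis by linarith
  qed
  show "lipschitz_functional m (real k) (inf_convolution m F k)"
    unfolding lipschitz_functional_def
    using lip mdist_commute by (smt (verit) of_nat_0_le_iff)
  show "(\<lambda>k. inf_convolution m F k x) \<longlonglongrightarrow> F x"
    if F: "continuous_map (mtopology_of m) euclideanreal F" and x: "x \<in> mspace m"
  proof (rule LIMSEQ_I)
    fix e :: real assume e: "e > 0"
    interpret Metric_space "mspace m" "mdist m" by (rule Metric_space_mspace_mdist)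
    have "\<exists>r>0. \<forall>y. y \<in> mspace m \<and> mdist m x y < r \<longrightarrow> F y \<in> ball (F x) (e/2)"
      using F x e unfolding mtopology_of_def continuous_map_from_metric by (simp del: mem_ball)
    then obtain d where d: "d > 0" "\<And>y. y \<in> mspace m \<Longrightarrow> mdist m x y < d \<Longrightarrow> \<bar>F y - F x\<bar> < e/2"
      by (auto simp: dist_real_def abs_minus_commute)
    \<comment> \<open>Points at distance at least d cannot win the infimum: from k0 on, their
      penalty is at least \<open>2 * B\<close>, which outweighs the oscillation of F.\<close>
    obtain k0 :: nat where k0: "real k0 \<ge> 2 * B / d" using real_arch_simple by blast
    have "norm (inf_convolution m F k x - F x) < e" if "k \<ge> k0" for k
    proof -
      have "F x - e/2 \<le> inf_convolution m F k x"
        unfolding inf_convolution_def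
      proof (rule cINF_greatest)
        show "mspace m \<noteq> {}" using x by auto
        fix y assume y: "y \<in> mspace m"
        show "F x - e/2 \<le> F y + real k * mdist m x y"
        proof (cases "mdist m x y < d")
          case True
          have "0 \<le> real k * mdist m x y" by simp
          then show ?thesis using d(2)[OF y True] by linarith
        next
          case False
          have "2 * B \<le> real k0 * d" using k0 d by (simp add: field_simps)
          also have "\<dots> \<le> real k * mdist m x y"
            using False d that by (intro mult_mono) auto
          finally show ?thesis using B[OF x] B[OF y] e by linarith
        qed
      qed
      with le[OF x, of k] e show ?thesis by simp
    qed
    then show "\<exists>k0. \<forall>k\<ge>k0. norm (inf_convolution m F k x - F x) < e" by blast
  qed
qed

text \<open>Here the random elements are measurable themselves; versions enter only at the end, in
  \<open>converges_in_law_of_law_limit\<close>.\<close>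

definition law_limit ::
  "'b metric \<Rightarrow> (real \<Rightarrow> 'w measure) \<Rightarrow> (real \<Rightarrow> 'w \<Rightarrow> 'b) \<Rightarrow> 'z measure \<Rightarrow> ('z \<Rightarrow> 'b) \<Rightarrow> bool" where
  "law_limit m M X N Y \<longleftrightarrow>
     (\<forall>lam>0. prob_space (M lam) \<and> X lam \<in> measurable (M lam) (mborel m)) \<and>
     prob_space N \<and> Y \<in> measurable N (mborel m) \<and>
     (\<forall>F. continuous_map (mtopology_of m) euclideanreal F \<and> bounded (F ` mspace m) \<longrightarrow>
        ((\<lambda>lam. \<integral>\<omega>. F (X lam \<omega>) \<partial>M lam) \<longlongrightarrow> (\<integral>\<omega>. F (Y \<omega>) \<partial>N)) at_top)"

text \<open>Testing against bounded Lipschitz functionals suffices: the inf-convolutions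
  increase to the given functional, which yields the lower half of the limit; the upper half
  follows by passing to the negative.\<close>

lemma law_limitI_lipschitz:
  assumes M: "\<And>lam. lam > 0 \<Longrightarrow> prob_space (M lam)"
    and X: "\<And>lam. lam > 0 \<Longrightarrow> X lam \<in> measurable (M lam) (mborel m)"
    and N: "prob_space N" and Y: "Y \<in> measurable N (mborel m)"
    and lim: "\<And>F C B. \<lbrakk>lipschitz_functional m C F; \<And>x. x \<in> mspace m \<Longrightarrow> \<bar>F x\<bar> \<le> B\<rbrakk>
      \<Longrightarrow> ((\<lambda>lam. \<integral>\<omega>. F (X lam \<omega>) \<partial>M lam) \<longlongrightarrow> (\<integral>\<omega>. F (Y \<omega>) \<partial>N)) at_top"
  shows "law_limit m M X N Y"
proof -
  have lower: "\<forall>\<^sub>F lam in at_top. (\<integral>\<omega>. F (X lam \<omega>) \<partial>M lam) > (\<integral>\<omega>. F (Y \<omega>) \<partial>N) - e"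
    if F: "continuous_map (mtopology_of m) euclideanreal F"
      and B: "\<And>x. x \<in> mspace m \<Longrightarrow> \<bar>F x\<bar> \<le> B" and e: "e > 0" for F B e
  proof -
    interpret N: prob_space N by (rule N)
    let ?F = "inf_convolution m F"
    note cont = lipschitz_functional_continuous[OF inf_convolution_lipschitz[of m F B, OF B]]
    have "(\<lambda>k. \<integral>\<omega>. ?F k (Y \<omega>) \<partial>N) \<longlonglongrightarrow> (\<integral>\<omega>. F (Y \<omega>) \<partial>N)"
    proof (rule integral_dominated_convergence[where w = "\<lambda>_. B"])
      show "(\<lambda>\<omega>. F (Y \<omega>)) \<in> borel_measurable N"
        using measurable_compose[OF Y measurable_continuous_map_mborel[OF F]] .
      show "(\<lambda>\<omega>. ?F k (Y \<omega>)) \<in> borel_measurable N" for k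
        using measurable_compose[OF Y measurable_continuous_map_mborel[OF cont]] .
      show "AE \<omega> in N. (\<lambda>k. ?F k (Y \<omega>)) \<longlonglongrightarrow> F (Y \<omega>)"
        using inf_convolution_tendsto[of m F B, OF B F] measurable_space[OF Y] by simp
      show "AE \<omega> in N. norm (?F k (Y \<omega>)) \<le> B" for k
        using inf_convolution_abs[of m F B, OF B] measurable_space[OF Y] by simp
    qed simp
    then have "\<forall>\<^sub>F k in sequentially. (\<integral>\<omega>. ?F k (Y \<omega>) \<partial>N) > (\<integral>\<omega>. F (Y \<omega>) \<partial>N) - e"
      using e by (intro order_tendstoD(1)) auto
    then obtain k where k: "(\<integral>\<omega>. ?F k (Y \<omega>) \<partial>N) > (\<integral>\<omega>. F (Y \<omega>) \<partial>N) - e"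
      using eventually_happens'[OF sequentially_bot] by blast
    have "((\<lambda>lam. \<integral>\<omega>. ?F k (X lam \<omega>) \<partial>M lam) \<longlongrightarrow> (\<integral>\<omega>. ?F k (Y \<omega>) \<partial>N)) at_top"
      by (rule lim[OF inf_convolution_lipschitz[of m F B, OF B] inf_convolution_abs[of m F B, OF B]])
    from order_tendstoD(1)[OF this k]
    show ?thesis using eventually_gt_at_top[of 0]
    proof eventually_elim
      case (elim lam)
      have "(\<integral>\<omega>. ?F k (X lam \<omega>) \<partial>M lam) \<le> (\<integral>\<omega>. F (X lam \<omega>) \<partial>M lam)"
        using integrable_bounded_functional[OF M X cont inf_convolution_abs[of m F B, OF B]]
          integrable_bounded_functional[OF M X F B] elim(2)
          inf_convolution_le[of m F B, OF B] measurable_space[OF X]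
        by (intro integral_mono) auto
      with elim(1) show ?case by linarith
    qed
  qed
  have "((\<lambda>lam. \<integral>\<omega>. F (X lam \<omega>) \<partial>M lam) \<longlongrightarrow> (\<integral>\<omega>. F (Y \<omega>) \<partial>N)) at_top"
    if F: "continuous_map (mtopology_of m) euclideanreal F" "bounded (F ` mspace m)" for F
  proof (rule order_tendstoI)
    obtain B where B: "\<And>x. x \<in> mspace m \<Longrightarrow> \<bar>F x\<bar> \<le> B"
      using F(2) by (auto simp: bounded_iff)
    have F': "continuous_map (mtopology_of m) euclideanreal (\<lambda>x. - F x)"
      using F(1) by (rule continuous_map_minus)
    have B': "\<bar>- F x\<bar> \<le> B" if "x \<in> mspace m" for x using B[OF that] by simp
    let ?y = "\<integral>\<omega>. F (Y \<omega>) \<partial>N"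
    show "\<forall>\<^sub>F lam in at_top. a < (\<integral>\<omega>. F (X lam \<omega>) \<partial>M lam)" if "a < ?y" for a
      using lower[OF F(1) B, of "?y - a"] that by simp
    show "\<forall>\<^sub>F lam in at_top. (\<integral>\<omega>. F (X lam \<omega>) \<partial>M lam) < a" if "?y < a" for a
      using lower[OF F' B', of "a - ?y"] that by simp
  qed
  with assms show ?thesis unfolding law_limit_def by blast
qed

text \<open>The complement of A has mass at most \<epsilon>, and there the integrands differ by at
  most \<open>2 * B\<close>.\<close>

lemma (in prob_space) integral_approx:
  assumes [measurable]: "f \<in> borel_measurable M" "g \<in> borel_measurable M" and A: "A \<in> events"
    and f: "\<And>\<omega>. \<omega> \<in> space M \<Longrightarrow> \<bar>f \<omega>\<bar> \<le> B" and g: "\<And>\<omega>. \<omega> \<in> space M \<Longrightarrow> \<bar>g \<omega>\<bar> \<le> B"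
    and fg: "\<And>\<omega>. \<omega> \<in> A \<Longrightarrow> \<bar>f \<omega> - g \<omega>\<bar> \<le> c" and "c \<ge> 0" and p: "prob A \<ge> 1 - \<epsilon>"
  shows "\<bar>(\<integral>\<omega>. f \<omega> \<partial>M) - (\<integral>\<omega>. g \<omega> \<partial>M)\<bar> \<le> c + 2 * B * \<epsilon>"
proof -
  obtain \<omega>0 where "\<omega>0 \<in> space M" using not_empty by auto
  from f[OF this] have B: "B \<ge> 0" by linarith
  have int: "integrable M f" "integrable M g"
    using f g by (auto intro!: integrable_const_bound[where B = B])
  have [measurable]: "space M - A \<in> events" using A by auto
  have "\<bar>(\<integral>\<omega>. f \<omega> \<partial>M) - (\<integral>\<omega>. g \<omega> \<partial>M)\<bar> = \<bar>\<integral>\<omega>. f \<omega> - g \<omega> \<partial>M\<bar>"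
    using int by simp
  also have "\<dots> \<le> (\<integral>\<omega>. \<bar>f \<omega> - g \<omega>\<bar> \<partial>M)"
    by (rule integral_abs_bound)
  also have "\<dots> \<le> (\<integral>\<omega>. c + 2 * B * indicator (space M - A) \<omega> \<partial>M)"
  proof (rule integral_mono)
    show "integrable M (\<lambda>\<omega>. \<bar>f \<omega> - g \<omega>\<bar>)" using int by simp
    show "integrable M (\<lambda>\<omega>. c + 2 * B * indicator (space M - A) \<omega>)"
      by (auto intro!: integrable_real_indicator simp: emeasure_eq_measure)
    fix \<omega> assume w: "\<omega> \<in> space M"
    show "\<bar>f \<omega> - g \<omega>\<bar> \<le> c + 2 * B * indicator (space M - A) \<omega>"
      using f[OF w] g[OF w] fg[of \<omega>] \<open>c \<ge> 0\<close> w by (cases "\<omega> \<in> A") auto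
  qed
  also have "\<dots> = c + 2 * B * prob (space M - A)"
    by (subst Bochner_Integration.integral_add)
       (auto intro!: integrable_real_indicator simp: emeasure_eq_measure prob_space)
  also have "prob (space M - A) \<le> \<epsilon>" using p prob_compl[OF A] by simp
  finally show ?thesis using B by (simp add: mult_left_mono)
qed

text \<open>The comparison function and its limit may be chosen after the error e. Both
  approximation arguments, \<open>law_limit_approx\<close> and
  \<open>law_limit_random_functions\<close>, reduce to this.\<close>

lemma tendsto_of_approximations:
  fixes f :: "'i \<Rightarrow> real"
  assumes "\<And>e. e > 0 \<Longrightarrow> \<exists>g b. (g \<longlongrightarrow> b) Fl \<and> (\<forall>\<^sub>F i in Fl. \<bar>f i - g i\<bar> \<le> e) \<and> \<bar>a - b\<bar> \<le> e"
  shows "(f \<longlongrightarrow> a) Fl"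
proof (rule tendstoI)
  fix e :: real assume "e > 0"
  then obtain g b where g: "(g \<longlongrightarrow> b) Fl" "\<forall>\<^sub>F i in Fl. \<bar>f i - g i\<bar> \<le> e/4" "\<bar>a - b\<bar> \<le> e/4"
    using assms[of "e/4"] by auto
  have "\<forall>\<^sub>F i in Fl. dist (g i) b < e/4" using g(1) \<open>e > 0\<close> by (intro tendstoD) auto
  with g(2) show "\<forall>\<^sub>F i in Fl. dist (f i) a < e"
  proof eventually_elim
    case (elim i)
    then show ?case using g(3) \<open>e > 0\<close> unfolding dist_real_def by linarith
  qed
qed

text \<open>A one-space estimate, applied below to every \<open>M lam\<close> with lam large and to
  N.\<close>

lemma functional_integral_approx:
  assumes "prob_space M0" and F: "lipschitz_functional m C F" and B: "\<And>x. x \<in> mspace m \<Longrightarrow> \<bar>F x\<bar> \<le> B"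
    and \<Gamma>: "continuous_map (mtopology_of m') (mtopology_of m) \<Gamma>"
    and X0: "X0 \<in> measurable M0 (mborel m)" and X1: "X1 \<in> measurable M0 (mborel m')"
    and A0: "A0 \<in> sets M0" "measure M0 A0 \<ge> 1 - \<epsilon>"
      "\<forall>\<omega>\<in>A0. mdist m (X0 \<omega>) (\<Gamma> (X1 \<omega>)) \<le> \<epsilon>" and \<epsilon>: "\<epsilon> > 0" "\<epsilon> * (C + 2 * \<bar>B\<bar>) \<le> e"
  shows "\<bar>(\<integral>\<omega>. F (X0 \<omega>) \<partial>M0) - (\<integral>\<omega>. F (\<Gamma> (X1 \<omega>)) \<partial>M0)\<bar> \<le> e"
proof -
  have C: "C \<ge> 0" using F by (simp add: lipschitz_functional_def)
  note Fc = lipschitz_functional_continuous[OF F]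
  have \<Gamma>': "\<Gamma> x \<in> mspace m" if "x \<in> mspace m'" for x
    using \<Gamma> that by (auto simp: continuous_map_def)
  have FG: "continuous_map (mtopology_of m') euclideanreal (\<lambda>x. F (\<Gamma> x))"
    using continuous_map_compose[OF \<Gamma> Fc] by (simp add: o_def)
  interpret M0: prob_space M0 by fact
  have "\<bar>(\<integral>\<omega>. F (X0 \<omega>) \<partial>M0) - (\<integral>\<omega>. F (\<Gamma> (X1 \<omega>)) \<partial>M0)\<bar> \<le> C * \<epsilon> + 2 * \<bar>B\<bar> * \<epsilon>"
  proof (rule M0.integral_approx[OF _ _ A0(1)])
    show "(\<lambda>\<omega>. F (X0 \<omega>)) \<in> borel_measurable M0"
      using measurable_compose[OF X0 measurable_continuous_map_mborel[OF Fc]] .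
    show "(\<lambda>\<omega>. F (\<Gamma> (X1 \<omega>))) \<in> borel_measurable M0"
      using measurable_compose[OF X1 measurable_continuous_map_mborel[OF FG]] .
    fix \<omega>
    show "\<bar>F (X0 \<omega>)\<bar> \<le> \<bar>B\<bar>" if "\<omega> \<in> space M0"
      using B[of "X0 \<omega>"] measurable_space[OF X0 that] by simp
    show "\<bar>F (\<Gamma> (X1 \<omega>))\<bar> \<le> \<bar>B\<bar>" if "\<omega> \<in> space M0"
      using B[OF \<Gamma>', of "X1 \<omega>"] measurable_space[OF X1 that] by simp
    show "\<bar>F (X0 \<omega>) - F (\<Gamma> (X1 \<omega>))\<bar> \<le> C * \<epsilon>" if "\<omega> \<in> A0"
    proof -
      have w: "\<omega> \<in> space M0" using that sets.sets_into_space[OF A0(1)] by auto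
      have "\<bar>F (X0 \<omega>) - F (\<Gamma> (X1 \<omega>))\<bar> \<le> C * mdist m (X0 \<omega>) (\<Gamma> (X1 \<omega>))"
        using F measurable_space[OF X0 w] \<Gamma>' measurable_space[OF X1 w]
        unfolding lipschitz_functional_def by auto
      also have "\<dots> \<le> C * \<epsilon>" using A0(3) that C by (auto intro: mult_left_mono)
      finally show ?thesis .
    qed
  qed (use A0 C \<epsilon> in auto)
  also have "\<dots> \<le> e" using \<epsilon>(2) by (simp add: algebra_simps)
  finally show ?thesis .
  qed

text \<open>Continuous mapping and convergence together in one statement: X is close in probability
  to the image under \<Gamma> of a process with known limit law. The space m', the process and
  \<Gamma> may depend on \<epsilon>, so the window of the auxiliary process may grow as \<epsilon>
  shrinks.\<close>

lemma law_limit_approx: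
  assumes M: "\<And>lam. lam > 0 \<Longrightarrow> prob_space (M lam)"
    and X: "\<And>lam. lam > 0 \<Longrightarrow> X lam \<in> measurable (M lam) (mborel m)"
    and N: "prob_space N" and Y: "Y \<in> measurable N (mborel m)"
    and approx: "\<And>\<epsilon>. \<epsilon> > 0 \<Longrightarrow> \<exists>(m' :: 'c metric) X' Y' \<Gamma>. law_limit m' M X' N Y' \<and>
       continuous_map (mtopology_of m') (mtopology_of m) \<Gamma> \<and>
       (\<forall>\<^sub>F lam in at_top. \<exists>A\<in>sets (M lam). measure (M lam) A \<ge> 1 - \<epsilon> \<and>
          (\<forall>\<omega>\<in>A. mdist m (X lam \<omega>) (\<Gamma> (X' lam \<omega>)) \<le> \<epsilon>)) \<and>
       (\<exists>A\<in>sets N. measure N A \<ge> 1 - \<epsilon> \<and> (\<forall>\<omega>\<in>A. mdist m (Y \<omega>) (\<Gamma> (Y' \<omega>)) \<le> \<epsilon>))"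
  shows "law_limit m M X N Y"
proof (rule law_limitI_lipschitz[OF M X N Y])
  fix F C B assume F: "lipschitz_functional m C F" and B: "\<And>x. x \<in> mspace m \<Longrightarrow> \<bar>F x\<bar> \<le> B"
  have C: "C \<ge> 0" using F by (simp add: lipschitz_functional_def)
  note Fc = lipschitz_functional_continuous[OF F]
  show "((\<lambda>lam. \<integral>\<omega>. F (X lam \<omega>) \<partial>M lam) \<longlongrightarrow> (\<integral>\<omega>. F (Y \<omega>) \<partial>N)) at_top"
  proof (rule tendsto_of_approximations)
    fix e :: real assume "e > 0"
    \<comment> \<open>The error is \<open>C * \<epsilon>\<close> on the good event and
      \<open>2 * \<bar>B\<bar> * \<epsilon>\<close> off it; the added 1 keeps the denominator
      positive.\<close>
    define \<epsilon> where "\<epsilon> = e / (C + 2 * \<bar>B\<bar> + 1)"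
    have \<epsilon>: "\<epsilon> > 0" "\<epsilon> * (C + 2 * \<bar>B\<bar>) \<le> e"
    proof -
      have "C + 2 * \<bar>B\<bar> + 1 > 0" using C by linarith
      then show "\<epsilon> > 0" "\<epsilon> * (C + 2 * \<bar>B\<bar>) \<le> e" unfolding \<epsilon>_def using \<open>e > 0\<close>
        by (auto simp: field_simps)
    qed
    obtain m' :: "'c metric" and X' Y' \<Gamma> where lim: "law_limit m' M X' N Y'"
      and \<Gamma>: "continuous_map (mtopology_of m') (mtopology_of m) \<Gamma>"
      and A: "\<forall>\<^sub>F lam in at_top. \<exists>A\<in>sets (M lam). measure (M lam) A \<ge> 1 - \<epsilon> \<and>
          (\<forall>\<omega>\<in>A. mdist m (X lam \<omega>) (\<Gamma> (X' lam \<omega>)) \<le> \<epsilon>)"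
      and A': "\<exists>A\<in>sets N. measure N A \<ge> 1 - \<epsilon> \<and> (\<forall>\<omega>\<in>A. mdist m (Y \<omega>) (\<Gamma> (Y' \<omega>)) \<le> \<epsilon>)"
      using approx[OF \<epsilon>(1)] by blast
    have \<Gamma>': "\<Gamma> x \<in> mspace m" if "x \<in> mspace m'" for x
      using \<Gamma> that by (auto simp: continuous_map_def)
    have FG: "continuous_map (mtopology_of m') euclideanreal (\<lambda>x. F (\<Gamma> x))"
      using continuous_map_compose[OF \<Gamma> Fc] by (simp add: o_def)
    have key': "\<bar>(\<integral>\<omega>. F (Y \<omega>) \<partial>N) - (\<integral>\<omega>. F (\<Gamma> (Y' \<omega>)) \<partial>N)\<bar> \<le> e"
      using A' functional_integral_approx[OF N F B \<Gamma> Y _ _ _ _ \<epsilon>] lim by (auto simp: law_limit_def)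
    have "((\<lambda>lam. \<integral>\<omega>. F (\<Gamma> (X' lam \<omega>)) \<partial>M lam) \<longlongrightarrow> (\<integral>\<omega>. F (\<Gamma> (Y' \<omega>)) \<partial>N)) at_top"
    proof -
      have "bounded ((\<lambda>x. F (\<Gamma> x)) ` mspace m')"
        using B \<Gamma>' by (auto simp: bounded_iff)
      with FG lim show ?thesis unfolding law_limit_def by blast
    qed
    moreover have "\<forall>\<^sub>F lam in at_top.
        \<bar>(\<integral>\<omega>. F (X lam \<omega>) \<partial>M lam) - (\<integral>\<omega>. F (\<Gamma> (X' lam \<omega>)) \<partial>M lam)\<bar> \<le> e"
      using A eventually_gt_at_top[of 0]
    proof eventually_elim
      case (elim lam)
      then obtain A0 where "A0 \<in> sets (M lam)" "measure (M lam) A0 \<ge> 1 - \<epsilon>"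
          "\<forall>\<omega>\<in>A0. mdist m (X lam \<omega>) (\<Gamma> (X' lam \<omega>)) \<le> \<epsilon>" by auto
      then show ?case using functional_integral_approx[OF M F B \<Gamma> X _ _ _ _ \<epsilon>] lim elim
        by (simp add: law_limit_def)
    qed
    ultimately show "\<exists>g b. (g \<longlongrightarrow> b) at_top \<and>
       (\<forall>\<^sub>F lam in at_top. \<bar>(\<integral>\<omega>. F (X lam \<omega>) \<partial>M lam) - g lam\<bar> \<le> e) \<and>
       \<bar>(\<integral>\<omega>. F (Y \<omega>) \<partial>N) - b\<bar> \<le> e"
      using key' by blast
  qed
qed

section \<open>Random continuous functions\<close>

lemma mspace_continuous_functions_on:
  assumes "compact B"
  shows "f \<in> mspace (continuous_functions_on B) \<longleftrightarrow> f \<in> extensional B \<and> continuous_on B f"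
  using assms unfolding continuous_functions_on_def
  by (subst compactin_mspace_cfunspace) (auto simp: compactin_subtopology)

lemma mdist_continuous_functions_on_le:
  assumes "c \<ge> 0" "\<And>v. v \<in> B \<Longrightarrow> \<bar>f v - g v\<bar> \<le> c"
  shows "mdist (continuous_functions_on B) f g \<le> c"
  using assms unfolding continuous_functions_on_def
  by (intro mdist_cfunspace_le) (auto simp: dist_real_def)

lemma abs_le_mdist_continuous_functions_on:
  assumes "f \<in> mspace (continuous_functions_on B)" "g \<in> mspace (continuous_functions_on B)" "v \<in> B"
  shows "\<bar>f v - g v\<bar> \<le> mdist (continuous_functions_on B) f g"
  using mdist_cfunspace_imp_mdist_le[OF assms(1,2)[unfolded continuous_functions_on_def] order_refl, of v]
    assms(3) unfolding continuous_functions_on_def by (simp add: dist_real_def)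

section \<open>Interpolation from finite nets\<close>

definition bump :: "real \<Rightarrow> 'v::euclidean_space \<Rightarrow> 'v \<Rightarrow> real" where
  "bump r x v = max 0 (r - dist x v)"

text \<open>Tents normalised to a partition of unity: at v only net points closer than r carry
  weight, so the value is an average of nearby c.\<close>

definition interpolate ::
  "'v::euclidean_space set \<Rightarrow> real \<Rightarrow> 'v set \<Rightarrow> ('v \<Rightarrow> real) \<Rightarrow> 'v \<Rightarrow> real" where
  "interpolate B r S c = (\<lambda>v\<in>B. (\<Sum>x\<in>S. bump r x v * c x) / (\<Sum>x\<in>S. bump r x v))"

lemma sum_bump_pos:
  assumes "finite S" "B \<subseteq> (\<Union>x\<in>S. ball x r)" "v \<in> B"
  shows "(\<Sum>x\<in>S. bump r x v) > 0"
proof -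
  obtain x where x: "x \<in> S" "dist x v < r" using assms by auto
  then have "bump r x v > 0" by (simp add: bump_def)
  moreover have "\<And>y. bump r y v \<ge> 0" by (simp add: bump_def)
  ultimately show ?thesis using x(1) assms(1) by (meson sum_pos2)
qed

lemma interpolate_mspace:
  assumes "compact B" "finite S" "B \<subseteq> (\<Union>x\<in>S. ball x r)"
  shows "interpolate B r S c \<in> mspace (continuous_functions_on B)"
proof -
  have "continuous_on B (\<lambda>v. (\<Sum>x\<in>S. bump r x v * c x) / (\<Sum>x\<in>S. bump r x v))"
    using sum_bump_pos[OF assms(2,3)] unfolding bump_def
    by (intro continuous_intros) force
  then have "continuous_on B (interpolate B r S c)"
    unfolding interpolate_def by (simp cong: continuous_on_cong)
  then show ?thesis
    using assms(1) by (simp add: mspace_continuous_functions_on interpolate_def)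
qed

lemma interpolate_close:
  assumes "finite S" "B \<subseteq> (\<Union>x\<in>S. ball x r)" "v \<in> B"
    and c: "\<And>x. x \<in> S \<Longrightarrow> dist x v < r \<Longrightarrow> \<bar>c x - y\<bar> \<le> e"
  shows "\<bar>interpolate B r S c v - y\<bar> \<le> e"
proof -
  note pos = sum_bump_pos[OF assms(1-3)]
  have "interpolate B r S c v - y = (\<Sum>x\<in>S. bump r x v * (c x - y)) / (\<Sum>x\<in>S. bump r x v)"
    using pos assms(3) by (simp add: interpolate_def field_simps sum_subtractf sum_distrib_left sum_distrib_right)
  moreover have "\<bar>\<Sum>x\<in>S. bump r x v * (c x - y)\<bar> \<le> (\<Sum>x\<in>S. bump r x v * e)"
  proof (rule sum_abs[THEN order_trans], rule sum_mono)
    fix x assume x: "x \<in> S"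
    show "\<bar>bump r x v * (c x - y)\<bar> \<le> bump r x v * e"
    proof (cases "dist x v < r")
      case True
      then show ?thesis using c[OF x True] by (simp add: abs_mult bump_def mult_left_mono)
    qed (simp add: bump_def)
  qed
  moreover have "(\<Sum>x\<in>S. bump r x v * e) = e * (\<Sum>x\<in>S. bump r x v)"
    by (simp add: sum_distrib_left mult.commute)
  ultimately show ?thesis
    using pos by (simp add: divide_le_eq)
qed

text \<open>One e is lost by rounding down to the grid, the other by the oscillation of f over
  distance r.\<close>

lemma interpolate_floor_close:
  assumes "finite S" "S \<subseteq> B" "B \<subseteq> (\<Union>x\<in>S. ball x r)" "v \<in> B" "e > 0"
    and f: "\<And>x. x \<in> B \<Longrightarrow> dist x v < r \<Longrightarrow> \<bar>f x - f v\<bar> \<le> e"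
    and k: "\<And>x. x \<in> S \<Longrightarrow> k x = \<lfloor>f x / e\<rfloor>"
  shows "\<bar>interpolate B r S (\<lambda>x. e * of_int (k x)) v - f v\<bar> \<le> 2 * e"
proof (rule interpolate_close[OF assms(1,3,4)])
  fix x assume x: "x \<in> S" "dist x v < r"
  have "of_int (k x) \<le> f x / e" "f x / e < of_int (k x) + 1"
    unfolding k[OF x(1)] by linarith+
  then have "e * of_int (k x) \<le> f x" "f x < e * of_int (k x) + e"
    using \<open>e > 0\<close> by (simp_all add: field_simps)
  then show "\<bar>e * of_int (k x) - f v\<bar> \<le> 2 * e"
    using f[of x] x assms(2) by fastforce
qed

lemma finite_net:
  fixes B :: "'v::euclidean_space set"
  assumes "compact B" "r > 0"
  obtains S where "finite S" "S \<subseteq> B" "B \<subseteq> (\<Union>x\<in>S. ball x r)"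
proof -
  have "seq_compact B" using assms(1) by (rule compact_imp_seq_compact)
  from seq_compact_imp_totally_bounded[OF this] assms(2)
  show ?thesis using that by blast
qed

text \<open>The interpolants of rounded values on finite nets take countably many values and converge
  to the random function, so separability of the function space is not needed.\<close>

lemma measurable_random_function:
  fixes B :: "'v::euclidean_space set"
  assumes B: "compact B"
    and X: "\<And>\<omega>. \<omega> \<in> space M \<Longrightarrow> X \<omega> \<in> mspace (continuous_functions_on B)"
    and meas: "\<And>v. v \<in> B \<Longrightarrow> (\<lambda>\<omega>. X \<omega> v) \<in> borel_measurable M"
  shows "X \<in> measurable M (mborel (continuous_functions_on B))"
proof -
  let ?m = "continuous_functions_on B"
  interpret m: Metric_space "mspace ?m" "mdist ?m" by (rule Metric_space_mspace_mdist)
  define r where "r n = 1 / real (Suc n)" for n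
  have r: "r n > 0" for n by (simp add: r_def)
  obtain S where S: "\<And>n. finite (S n)" "\<And>n. S n \<subseteq> B" "\<And>n. B \<subseteq> (\<Union>x\<in>S n. ball x (r n))"
  proof -
    have "\<forall>n. \<exists>S. finite S \<and> S \<subseteq> B \<and> B \<subseteq> (\<Union>x\<in>S. ball x (r n))"
    proof
      fix n
      obtain S where "finite S" "S \<subseteq> B" "B \<subseteq> (\<Union>x\<in>S. ball x (r n))"
        by (rule finite_net[OF B r[of n]])
      then show "\<exists>S. finite S \<and> S \<subseteq> B \<and> B \<subseteq> (\<Union>x\<in>S. ball x (r n))" by blast
    qed
    from choice[OF this] show ?thesis using that by blast
  qed
  define K where "K n \<omega> = (\<lambda>x\<in>S n. \<lfloor>X \<omega> x / r n\<rfloor>)" for n \<omega>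
  define A where "A n \<omega> = interpolate B (r n) (S n) (\<lambda>x. r n * of_int (K n \<omega> x))" for n \<omega>
  have A_mspace: "A n \<omega> \<in> mspace ?m" for n \<omega>
    unfolding A_def by (rule interpolate_mspace[OF B S(1,3)])
  \<comment> \<open>Q is arbitrary, since \<open>K n\<close> takes only countably many values, each
    of them on a measurable event. This is why values are rounded.\<close>
  have K_meas: "{\<omega> \<in> space M. Q (K n \<omega>)} \<in> sets M" for Q n
  proof -
    let ?E = "\<lambda>k. {\<omega> \<in> space M. \<forall>x\<in>S n. \<lfloor>X \<omega> x / r n\<rfloor> = k x}"
    have "{\<omega> \<in> space M. Q (K n \<omega>)} = (\<Union>k\<in>{k \<in> S n \<rightarrow>\<^sub>E UNIV. Q k}. ?E k)"
    proof (intro equalityI subsetI)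
      fix \<omega> assume "\<omega> \<in> {\<omega> \<in> space M. Q (K n \<omega>)}"
      then show "\<omega> \<in> (\<Union>k\<in>{k \<in> S n \<rightarrow>\<^sub>E UNIV. Q k}. ?E k)"
        by (intro UN_I[of "K n \<omega>"]) (auto simp: K_def)
    next
      fix \<omega> assume "\<omega> \<in> (\<Union>k\<in>{k \<in> S n \<rightarrow>\<^sub>E UNIV. Q k}. ?E k)"
      then obtain k where k: "k \<in> S n \<rightarrow>\<^sub>E UNIV" "Q k" "\<omega> \<in> ?E k" by auto
      then have "K n \<omega> = k" unfolding K_def by (intro ext) (auto simp: restrict_def PiE_def extensional_def)
      then show "\<omega> \<in> {\<omega> \<in> space M. Q (K n \<omega>)}" using k by auto
    qed
    moreover have "?E k \<in> sets M" for k
    proof -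
      have "\<forall>x\<in>S n. {\<omega> \<in> space M. \<lfloor>X \<omega> x / r n\<rfloor> = k x} \<in> sets M"
      proof
        fix x assume "x \<in> S n"
        then have [measurable]: "(\<lambda>\<omega>. X \<omega> x) \<in> borel_measurable M" using S(2) meas by blast
        show "{\<omega> \<in> space M. \<lfloor>X \<omega> x / r n\<rfloor> = k x} \<in> sets M" by measurable
      qed
      then show ?thesis using S(1) by (intro sets.sets_Collect_finite_All) auto
    qed
    moreover have "countable {k \<in> S n \<rightarrow>\<^sub>E (UNIV::int set). Q k}"
      by (rule countable_subset[of _ "S n \<rightarrow>\<^sub>E (UNIV::int set)"]) (auto intro!: countable_PiE S)
    ultimately show ?thesis
      using sets.countable_UN'[of "{k \<in> S n \<rightarrow>\<^sub>E UNIV. Q k}" ?E M] by auto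
  qed
  have close: "\<forall>\<^sub>F n in sequentially. mdist ?m (A n \<omega>) (X \<omega>) < e" if w: "\<omega> \<in> space M" and e: "e > 0" for \<omega> e
  proof -
    have "uniformly_continuous_on B (X \<omega>)"
      using X[OF w] B by (simp add: mspace_continuous_functions_on compact_uniformly_continuous)
    then obtain d where d: "d > 0" "\<And>x v. x \<in> B \<Longrightarrow> v \<in> B \<Longrightarrow> dist x v < d \<Longrightarrow> \<bar>X \<omega> x - X \<omega> v\<bar> < e/3"
      using e unfolding uniformly_continuous_on_def dist_real_def
      by (metis zero_less_divide_iff zero_less_numeral)
    have "r \<longlonglongrightarrow> 0" unfolding r_def by (rule LIMSEQ_Suc[OF lim_1_over_n])
    then have "\<forall>\<^sub>F n in sequentially. r n < min d (e/8)"
      using d e by (intro order_tendstoD(2)) auto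
    then show ?thesis
    proof eventually_elim
      case (elim n)
      have "\<bar>A n \<omega> v - X \<omega> v\<bar> \<le> 3/4 * e" if v: "v \<in> B" for v
        unfolding A_def
      proof (rule interpolate_close[OF S(1,3) v])
        fix x assume x: "x \<in> S n" "dist x v < r n"
        have "of_int (K n \<omega> x) \<le> X \<omega> x / r n" "X \<omega> x / r n < of_int (K n \<omega> x) + 1"
          using x unfolding K_def by (simp_all add: floor_correct)
        then have "r n * of_int (K n \<omega> x) \<le> X \<omega> x" "X \<omega> x < r n * of_int (K n \<omega> x) + r n"
          using r[of n] by (simp_all add: field_simps)
        moreover have "\<bar>X \<omega> x - X \<omega> v\<bar> < e/3" using d(2)[of x v] x S(2) v elim by force
        ultimately show "\<bar>r n * of_int (K n \<omega> x) - X \<omega> v\<bar> \<le> 3/4 * e" using elim by linarith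
      qed
      then have "mdist ?m (A n \<omega>) (X \<omega>) \<le> 3/4 * e"
        using e by (intro mdist_continuous_functions_on_le) auto
      then show ?case using e by simp
    qed
  qed
  show ?thesis
  proof (rule measurableI)
    show "X \<omega> \<in> space (mborel ?m)" if "\<omega> \<in> space M" for \<omega> using X[OF that] by simp
    fix V assume "V \<in> sets (mborel ?m)"
    then have "V \<in> sigma_sets (mspace ?m) {U. openin (mtopology_of ?m) U}" by (simp add: sets_mborel)
    then show "X -` V \<inter> space M \<in> sets M"
    proof induction
      case (Basic U)
      then have U: "U \<subseteq> mspace ?m" "\<And>x. x \<in> U \<Longrightarrow> \<exists>r>0. m.mball x r \<subseteq> U"
        by (auto simp: mtopology_of_def m.openin_mtopology)
      \<comment> \<open>Membership in an open set passes to limits only with a margin: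
        \<open>X \<omega>\<close> lies in U iff the approximants eventually stay in one fixed
        \<open>V j\<close>.\<close>
      define V where "V j = {f \<in> mspace ?m. m.mball f (r j) \<subseteq> U}" for j
      have "X -` U \<inter> space M = {\<omega> \<in> space M. \<exists>j n0. \<forall>n\<ge>n0. A n \<omega> \<in> V j}"
      proof (intro equalityI subsetI)
        fix \<omega> assume "\<omega> \<in> X -` U \<inter> space M"
        then have w: "\<omega> \<in> space M" "X \<omega> \<in> U" by auto
        then obtain e where e: "e > 0" "m.mball (X \<omega>) e \<subseteq> U" using U(2) by blast
        obtain j where j: "r j < e/2" unfolding r_def
          using reals_Archimedean[of "e/2"] e by (auto simp: inverse_eq_divide)
        from close[OF w(1) half_gt_zero[OF e(1)]] obtain n0 where
          n0: "\<And>n. n \<ge> n0 \<Longrightarrow> mdist ?m (A n \<omega>) (X \<omega>) < e/2" unfolding eventually_sequentially by blast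
        have "A n \<omega> \<in> V j" if "n \<ge> n0" for n
        proof -
          have "m.mball (A n \<omega>) (r j) \<subseteq> m.mball (X \<omega>) e"
          proof
            fix f assume "f \<in> m.mball (A n \<omega>) (r j)"
            then have f: "f \<in> mspace ?m" "mdist ?m (A n \<omega>) f < r j" by auto
            have "mdist ?m (X \<omega>) f \<le> mdist ?m (X \<omega>) (A n \<omega>) + mdist ?m (A n \<omega>) f"
              using m.triangle X[OF w(1)] A_mspace f by blast
            then show "f \<in> m.mball (X \<omega>) e"
              using f n0[OF that] j X[OF w(1)] by (simp add: m.commute)
          qed
          then show ?thesis using e A_mspace by (auto simp: V_def)
        qed
        then show "\<omega> \<in> {\<omega> \<in> space M. \<exists>j n0. \<forall>n\<ge>n0. A n \<omega> \<in> V j}" using w by blast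
      next
        fix \<omega> assume "\<omega> \<in> {\<omega> \<in> space M. \<exists>j n0. \<forall>n\<ge>n0. A n \<omega> \<in> V j}"
        then obtain j n0 where w: "\<omega> \<in> space M" and j: "\<And>n. n \<ge> n0 \<Longrightarrow> A n \<omega> \<in> V j" by auto
        from close[OF w r[of j]] obtain n1 where
          n1: "\<And>n. n \<ge> n1 \<Longrightarrow> mdist ?m (A n \<omega>) (X \<omega>) < r j" unfolding eventually_sequentially by blast
        have "A (max n0 n1) \<omega> \<in> V j" by (rule j) simp
        moreover have "X \<omega> \<in> m.mball (A (max n0 n1) \<omega>) (r j)"
          using n1[of "max n0 n1"] A_mspace X[OF w] by simp
        ultimately show "\<omega> \<in> X -` U \<inter> space M" using w by (auto simp: V_def)
      qed
      also have "\<dots> = (\<Union>j. \<Union>n0. \<Inter>n\<in>{n0..}. {\<omega> \<in> space M. A n \<omega> \<in> V j})" by auto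
      also have "\<dots> \<in> sets M"
        using K_meas unfolding A_def
        by (intro sets.countable_UN' sets.countable_INT' image_subsetI K_meas) auto
      finally show ?case .
    next
      case (Compl U)
      have "X -` (mspace ?m - U) \<inter> space M = space M - (X -` U \<inter> space M)" using X by auto
      with Compl show ?case by auto
    next
      case (Union U)
      have eq: "X -` (\<Union>i. U i) \<inter> space M = (\<Union>i. X -` U i \<inter> space M)" by auto
      show ?case unfolding eq by (rule sets.countable_UN) (use Union in auto)
    qed simp
  qed
qed

section \<open>Box probabilities and finite dimensional convergence\<close>

lemma sets_joint_survival:
  assumes "finite T" "\<And>v t. (v, t) \<in> T \<Longrightarrow> (\<lambda>\<omega>. X \<omega> v) \<in> borel_measurable M"
  shows "{\<omega> \<in> space M. \<forall>(v, t)\<in>T. t \<le> (X \<omega> v :: real)} \<in> sets M"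
proof -
  have "\<forall>p\<in>T. {\<omega> \<in> space M. snd p \<le> X \<omega> (fst p)} \<in> sets M"
  proof
    fix p assume "p \<in> T"
    then have [measurable]: "(\<lambda>\<omega>. X \<omega> (fst p)) \<in> borel_measurable M"
      using assms(2)[of "fst p" "snd p"] by simp
    show "{\<omega> \<in> space M. snd p \<le> X \<omega> (fst p)} \<in> sets M" by measurable
  qed
  then show ?thesis
    using assms(1) by (auto simp: case_prod_beta intro!: sets.sets_Collect_finite_All)
qed

lemma sets_box:
  assumes I: "finite I" "I \<subseteq> B" and Z: "\<And>v. v \<in> B \<Longrightarrow> (\<lambda>\<omega>. Z \<omega> v) \<in> borel_measurable M"
    and T: "finite T" "T \<subseteq> B \<times> UNIV"
  shows "{\<omega> \<in> space M. (\<forall>v\<in>I. a v \<le> Z \<omega> v \<and> Z \<omega> v < (b v :: real)) \<and> (\<forall>(v, t)\<in>T. t \<le> Z \<omega> v)} \<in> sets M"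
proof -
  have "\<forall>v\<in>I. {\<omega> \<in> space M. a v \<le> Z \<omega> v \<and> Z \<omega> v < b v} \<in> sets M"
  proof
    fix v assume "v \<in> I"
    then have [measurable]: "(\<lambda>\<omega>. Z \<omega> v) \<in> borel_measurable M" using I Z by auto
    show "{\<omega> \<in> space M. a v \<le> Z \<omega> v \<and> Z \<omega> v < b v} \<in> sets M" by measurable
  qed
  then have "{\<omega> \<in> space M. \<forall>v\<in>I. a v \<le> Z \<omega> v \<and> Z \<omega> v < b v} \<in> sets M"
    using I by (intro sets.sets_Collect_finite_All) auto
  moreover have "{\<omega> \<in> space M. \<forall>(v, t)\<in>T. t \<le> Z \<omega> v} \<in> sets M"
    using T Z by (intro sets_joint_survival) auto
  ultimately have int: "{\<omega> \<in> space M. \<forall>v\<in>I. a v \<le> Z \<omega> v \<and> Z \<omega> v < b v} \<inter>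
      {\<omega> \<in> space M. \<forall>(v, t)\<in>T. t \<le> Z \<omega> v} \<in> sets M" by (rule sets.Int)
  have "{\<omega> \<in> space M. (\<forall>v\<in>I. a v \<le> Z \<omega> v \<and> Z \<omega> v < b v) \<and> (\<forall>(v, t)\<in>T. t \<le> Z \<omega> v)} =
      {\<omega> \<in> space M. \<forall>v\<in>I. a v \<le> Z \<omega> v \<and> Z \<omega> v < b v} \<inter> {\<omega> \<in> space M. \<forall>(v, t)\<in>T. t \<le> Z \<omega> v}"
    by auto
  then show ?thesis using int by simp
qed

text \<open>A two-sided constraint at x is the difference of two nested survival constraints, so one
  coordinate moves from the box I to the list T at the price of a subtraction.\<close>

lemma measure_box_insert:
  assumes "prob_space M" and I: "finite I" "I \<subseteq> B"
    and Z: "\<And>v. v \<in> B \<Longrightarrow> (\<lambda>\<omega>. Z \<omega> v) \<in> borel_measurable M"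
    and T: "finite T" "T \<subseteq> B \<times> UNIV" and "x \<in> B"
  shows "measure M {\<omega> \<in> space M. (\<forall>v\<in>insert x I. a v \<le> Z \<omega> v \<and> Z \<omega> v < (b v :: real)) \<and> (\<forall>(v, t)\<in>T. t \<le> Z \<omega> v)} =
    measure M {\<omega> \<in> space M. (\<forall>v\<in>I. a v \<le> Z \<omega> v \<and> Z \<omega> v < b v) \<and> (\<forall>(v, t)\<in>insert (x, a x) T. t \<le> Z \<omega> v)} -
    measure M {\<omega> \<in> space M. (\<forall>v\<in>I. a v \<le> Z \<omega> v \<and> Z \<omega> v < b v) \<and> (\<forall>(v, t)\<in>insert (x, b x) (insert (x, a x) T). t \<le> Z \<omega> v)}"
    (is "measure M ?A = measure M ?A1 - measure M ?A2")
proof -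
  interpret prob_space M by fact
  have sets: "?A1 \<in> sets M" "?A2 \<in> sets M"
    by (rule sets_box[OF I Z]; use T \<open>x \<in> B\<close> in auto)+
  have "?A = ?A1 - ?A2" by (auto simp: not_le)
  moreover have "?A2 \<subseteq> ?A1" by auto
  ultimately show ?thesis using finite_measure_Diff[OF sets] by simp
qed

text \<open>Inclusion-exclusion over the coordinates of the box, by induction with T as accumulator.
  Because survival probabilities converge at every level t, the corners of the box are
  unrestricted.\<close>

lemma box_probability_tendsto:
  fixes X :: "real \<Rightarrow> 'w \<Rightarrow> 'v \<Rightarrow> real" and Y :: "'z \<Rightarrow> 'v \<Rightarrow> real"
  assumes M: "\<And>lam. lam > 0 \<Longrightarrow> prob_space (M lam)" and N: "prob_space N"
    and X: "\<And>lam v. lam > 0 \<Longrightarrow> v \<in> B \<Longrightarrow> (\<lambda>\<omega>. X lam \<omega> v) \<in> borel_measurable (M lam)"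
    and Y: "\<And>v. v \<in> B \<Longrightarrow> (\<lambda>\<omega>. Y \<omega> v) \<in> borel_measurable N"
    and fidi: "\<And>T. finite T \<Longrightarrow> T \<subseteq> B \<times> UNIV \<Longrightarrow>
       ((\<lambda>lam. measure (M lam) {\<omega> \<in> space (M lam). \<forall>(v, t)\<in>T. t \<le> X lam \<omega> v}) \<longlongrightarrow>
         measure N {\<omega> \<in> space N. \<forall>(v, t)\<in>T. t \<le> Y \<omega> v}) at_top"
    and I: "finite I" "I \<subseteq> B" and T: "finite T" "T \<subseteq> B \<times> UNIV"
  shows "((\<lambda>lam. measure (M lam) {\<omega> \<in> space (M lam).
            (\<forall>v\<in>I. a v \<le> X lam \<omega> v \<and> X lam \<omega> v < b v) \<and> (\<forall>(v, t)\<in>T. t \<le> X lam \<omega> v)}) \<longlongrightarrow>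
          measure N {\<omega> \<in> space N.
            (\<forall>v\<in>I. a v \<le> Y \<omega> v \<and> Y \<omega> v < b v) \<and> (\<forall>(v, t)\<in>T. t \<le> Y \<omega> v)}) at_top"
  using I T
proof (induction I arbitrary: T rule: finite_induct)
  case empty
  then show ?case using fidi[of T] by simp
next
  case (insert x I)
  let ?T1 = "insert (x, a x) T" and ?T2 = "insert (x, b x) (insert (x, a x) T)"
  have T12: "finite ?T1" "?T1 \<subseteq> B \<times> UNIV" "finite ?T2" "?T2 \<subseteq> B \<times> UNIV" using insert by auto
  have I: "I \<subseteq> B" "x \<in> B" using insert by auto
  have "((\<lambda>lam. measure (M lam) {\<omega> \<in> space (M lam).
            (\<forall>v\<in>I. a v \<le> X lam \<omega> v \<and> X lam \<omega> v < b v) \<and> (\<forall>(v, t)\<in>?T1. t \<le> X lam \<omega> v)} -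
          measure (M lam) {\<omega> \<in> space (M lam).
            (\<forall>v\<in>I. a v \<le> X lam \<omega> v \<and> X lam \<omega> v < b v) \<and> (\<forall>(v, t)\<in>?T2. t \<le> X lam \<omega> v)}) \<longlongrightarrow>
          measure N {\<omega> \<in> space N.
            (\<forall>v\<in>insert x I. a v \<le> Y \<omega> v \<and> Y \<omega> v < b v) \<and> (\<forall>(v, t)\<in>T. t \<le> Y \<omega> v)}) at_top"
    by (subst measure_box_insert[OF N insert.hyps(1) I(1) Y insert.prems(2,3) I(2)])
      (assumption, intro tendsto_diff insert.IH T12 I)
  then show ?case
  proof (rule Lim_transform_eventually)
    show "\<forall>\<^sub>F lam in at_top. measure (M lam) {\<omega> \<in> space (M lam).
            (\<forall>v\<in>I. a v \<le> X lam \<omega> v \<and> X lam \<omega> v < b v) \<and> (\<forall>(v, t)\<in>?T1. t \<le> X lam \<omega> v)} -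
          measure (M lam) {\<omega> \<in> space (M lam).
            (\<forall>v\<in>I. a v \<le> X lam \<omega> v \<and> X lam \<omega> v < b v) \<and> (\<forall>(v, t)\<in>?T2. t \<le> X lam \<omega> v)} =
          measure (M lam) {\<omega> \<in> space (M lam).
            (\<forall>v\<in>insert x I. a v \<le> X lam \<omega> v \<and> X lam \<omega> v < b v) \<and> (\<forall>(v, t)\<in>T. t \<le> X lam \<omega> v)}"
      using eventually_gt_at_top[of 0]
    proof eventually_elim
      case (elim lam)
      show ?case
        by (rule measure_box_insert[OF M[OF elim] insert.hyps(1) I(1) X[OF elim] insert.prems(2,3) I(2), symmetric])
    qed
  qed
qed

text \<open>The sum is the integral of F at the interpolant of the rounded values of X, set to 0
  when these leave the grid \<open>{- m..m}\<close>. On A the bounds H and L keep X inside the grid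
  and within \<open>2 * e\<close> of the interpolant.\<close>

lemma functional_box_approx:
  fixes X :: "'w \<Rightarrow> 'v::euclidean_space \<Rightarrow> real"
  assumes "prob_space M" and B: "compact B"
    and X: "\<And>\<omega>. \<omega> \<in> space M \<Longrightarrow> X \<omega> \<in> mspace (continuous_functions_on B)"
    and meas: "\<And>v. v \<in> B \<Longrightarrow> (\<lambda>\<omega>. X \<omega> v) \<in> borel_measurable M"
    and F: "lipschitz_functional (continuous_functions_on B) C F"
    and b: "\<And>f. f \<in> mspace (continuous_functions_on B) \<Longrightarrow> \<bar>F f\<bar> \<le> b" "b \<ge> 0"
    and S: "finite S" "S \<subseteq> B" "B \<subseteq> (\<Union>x\<in>S. ball x r)"
    and e: "e > 0" "L * r \<le> e" and m: "H / e + 1 \<le> of_int m"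
    and A: "A \<in> sets M" "measure M A \<ge> 1 - \<epsilon>"
      "\<And>\<omega> v. \<omega> \<in> A \<Longrightarrow> v \<in> B \<Longrightarrow> \<bar>X \<omega> v\<bar> \<le> H" "\<And>\<omega>. \<omega> \<in> A \<Longrightarrow> L-lipschitz_on B (X \<omega>)"
  shows "\<bar>(\<integral>\<omega>. F (X \<omega>) \<partial>M) -
     (\<Sum>k\<in>S \<rightarrow>\<^sub>E {- m..m}. F (interpolate B r S (\<lambda>x. e * of_int (k x))) *
        measure M {\<omega> \<in> space M. \<forall>x\<in>S. e * of_int (k x) \<le> X \<omega> x \<and> X \<omega> x < e * (of_int (k x) + 1)})\<bar>
     \<le> C * (2 * e) + 2 * b * \<epsilon>"
proof -
  interpret prob_space M by fact
  have C: "C \<ge> 0" using F by (simp add: lipschitz_functional_def)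
  let ?m = "continuous_functions_on B"
  let ?J = "S \<rightarrow>\<^sub>E {- m..m}"
  let ?G = "\<lambda>k. interpolate B r S (\<lambda>x. e * of_int (k x))"
  let ?E = "\<lambda>k. {\<omega> \<in> space M. \<forall>x\<in>S. e * of_int (k x) \<le> X \<omega> x \<and> X \<omega> x < e * (of_int (k x) + 1)}"
  have J: "finite ?J" using S(1) by (intro finite_PiE) auto
  have G: "?G k \<in> mspace ?m" for k by (rule interpolate_mspace[OF B S(1,3)])
  have E_iff: "e * of_int k \<le> y \<and> y < e * (of_int k + 1) \<longleftrightarrow> k = \<lfloor>y / e\<rfloor>" for k :: int and y :: real
  proof -
    have "e * of_int k \<le> y \<and> y < e * (of_int k + 1) \<longleftrightarrow> of_int k \<le> y / e \<and> y / e < of_int k + 1"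
      using e(1) by (simp add: field_simps)
    also have "\<dots> \<longleftrightarrow> k = \<lfloor>y / e\<rfloor>" by linarith
    finally show ?thesis .
  qed
  have E: "?E k \<in> events" for k
    using sets_box[where T = "{}" and a = "\<lambda>x. e * of_int (k x)" and b = "\<lambda>x. e * (of_int (k x) + 1)",
        OF S(1,2) meas] by simp
  define K where "K \<omega> = (\<lambda>x\<in>S. \<lfloor>X \<omega> x / e\<rfloor>)" for \<omega>
  have K: "\<omega> \<in> ?E k \<longleftrightarrow> k = K \<omega>" if "k \<in> ?J" "\<omega> \<in> space M" for k \<omega>
    using that unfolding K_def E_iff by (auto simp: PiE_def extensional_def fun_eq_iff)
  define g where "g \<omega> = (\<Sum>k\<in>?J. F (?G k) * indicator (?E k) \<omega>)" for \<omega>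
  have g: "g \<omega> = (if K \<omega> \<in> ?J then F (?G (K \<omega>)) else 0)" if "\<omega> \<in> space M" for \<omega>
  proof -
    have "g \<omega> = (\<Sum>k\<in>?J. if k = K \<omega> then F (?G k) else 0)"
      unfolding g_def using K[OF _ that] by (intro sum.cong) (simp_all add: indicator_def)
    then show ?thesis using J by simp
  qed
  have gm: "g \<in> borel_measurable M" unfolding g_def using E by measurable
  have "(\<integral>\<omega>. g \<omega> \<partial>M) = (\<Sum>k\<in>?J. F (?G k) * measure M (?E k))"
    unfolding g_def using E
    by (subst Bochner_Integration.integral_sum)
      (auto intro!: integrable_real_indicator simp: emeasure_eq_measure)
  moreover have "\<bar>(\<integral>\<omega>. F (X \<omega>) \<partial>M) - (\<integral>\<omega>. g \<omega> \<partial>M)\<bar> \<le> C * (2 * e) + 2 * b * \<epsilon>"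
  proof (rule integral_approx[OF _ gm A(1) _ _ _ _ A(2)])
    show "(\<lambda>\<omega>. F (X \<omega>)) \<in> borel_measurable M"
      using measurable_compose[OF measurable_random_function[OF B X meas]
          measurable_continuous_map_mborel[OF lipschitz_functional_continuous[OF F]]] by simp
    show "\<bar>F (X \<omega>)\<bar> \<le> b" if "\<omega> \<in> space M" for \<omega> using b X that by auto
    show "\<bar>g \<omega>\<bar> \<le> b" if "\<omega> \<in> space M" for \<omega> using b G that by (simp add: g)
    show "0 \<le> C * (2 * e)" using C e by simp
    fix \<omega> assume w: "\<omega> \<in> A"
    then have w': "\<omega> \<in> space M" using sets.sets_into_space[OF A(1)] by auto
    have "K \<omega> \<in> ?J"
    proof -
      have "\<lfloor>X \<omega> x / e\<rfloor> \<in> {- m..m}" if "x \<in> S" for x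
      proof -
        have "\<bar>X \<omega> x\<bar> \<le> H" using A(3)[OF w] that S(2) by auto
        then have "X \<omega> x / e \<le> H / e" "- (H / e) \<le> X \<omega> x / e"
          using e(1) by (auto simp: field_simps)
        \<comment> \<open>The 1 in the lower bound on m pays for rounding down a negative
          quotient.\<close>
        then have "\<lfloor>X \<omega> x / e\<rfloor> \<le> m" "- m \<le> \<lfloor>X \<omega> x / e\<rfloor>" using m by linarith+
        then show ?thesis by simp
      qed
      then show ?thesis by (auto simp: K_def)
    qed
    moreover have "\<bar>F (X \<omega>) - F (?G (K \<omega>))\<bar> \<le> C * (2 * e)"
    proof -
      have "\<bar>X \<omega> v - ?G (K \<omega>) v\<bar> \<le> 2 * e" if v: "v \<in> B" for v
        unfolding abs_minus_commute[of "X \<omega> v"]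
      proof (rule interpolate_floor_close[OF S v e(1)])
        fix x assume x: "x \<in> B" "dist x v < r"
        have L: "L \<ge> 0" using A(4)[OF w] by (rule lipschitz_on_nonneg)
        have "\<bar>X \<omega> x - X \<omega> v\<bar> \<le> L * dist x v"
          using lipschitz_onD[OF A(4)[OF w] x(1) v] by (simp add: dist_real_def)
        also have "\<dots> \<le> L * r" using x L by (intro mult_left_mono) auto
        finally show "\<bar>X \<omega> x - X \<omega> v\<bar> \<le> e" using e(2) by linarith
      qed (simp add: K_def)
      then have "mdist ?m (X \<omega>) (?G (K \<omega>)) \<le> 2 * e"
        using e by (intro mdist_continuous_functions_on_le) auto
      moreover have "\<bar>F (X \<omega>) - F (?G (K \<omega>))\<bar> \<le> C * mdist ?m (X \<omega>) (?G (K \<omega>))"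
        using F X[OF w'] G unfolding lipschitz_functional_def by blast
      ultimately show ?thesis using C by (meson mult_left_mono order_trans)
    qed
    ultimately show "\<bar>F (X \<omega>) - g \<omega>\<bar> \<le> C * (2 * e)" using g[OF w'] by simp
  qed
  ultimately show ?thesis by simp
qed

text \<open>Finite dimensional convergence together with tightness. As L and H serve all large lam
  and the limit alike, net and grid can be fixed first, and then only finitely many box
  probabilities have to converge.\<close>

lemma law_limit_random_functions:
  fixes X :: "real \<Rightarrow> 'w \<Rightarrow> 'v::euclidean_space \<Rightarrow> real" and Y :: "'z \<Rightarrow> 'v \<Rightarrow> real"
  assumes M: "\<And>lam. lam > 0 \<Longrightarrow> prob_space (M lam)" and N: "prob_space N"
    and B: "compact B"
    and X: "\<And>lam \<omega>. lam > 0 \<Longrightarrow> \<omega> \<in> space (M lam) \<Longrightarrow> X lam \<omega> \<in> mspace (continuous_functions_on B)"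
    and Y: "\<And>\<omega>. \<omega> \<in> space N \<Longrightarrow> Y \<omega> \<in> mspace (continuous_functions_on B)"
    and Xm: "\<And>lam v. lam > 0 \<Longrightarrow> v \<in> B \<Longrightarrow> (\<lambda>\<omega>. X lam \<omega> v) \<in> borel_measurable (M lam)"
    and Ym: "\<And>v. v \<in> B \<Longrightarrow> (\<lambda>\<omega>. Y \<omega> v) \<in> borel_measurable N"
    and fidi: "\<And>T. finite T \<Longrightarrow> T \<subseteq> B \<times> UNIV \<Longrightarrow>
       ((\<lambda>lam. measure (M lam) {\<omega> \<in> space (M lam). \<forall>(v, t)\<in>T. t \<le> X lam \<omega> v}) \<longlongrightarrow>
         measure N {\<omega> \<in> space N. \<forall>(v, t)\<in>T. t \<le> Y \<omega> v}) at_top"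
    and tight: "\<And>\<epsilon>. \<epsilon> > 0 \<Longrightarrow> \<exists>L H.
       (\<forall>\<^sub>F lam in at_top. \<exists>A\<in>sets (M lam). measure (M lam) A \<ge> 1 - \<epsilon> \<and>
          (\<forall>\<omega>\<in>A. (\<forall>v\<in>B. \<bar>X lam \<omega> v\<bar> \<le> H) \<and> L-lipschitz_on B (X lam \<omega>))) \<and>
       (\<exists>A\<in>sets N. measure N A \<ge> 1 - \<epsilon> \<and>
          (\<forall>\<omega>\<in>A. (\<forall>v\<in>B. \<bar>Y \<omega> v\<bar> \<le> H) \<and> L-lipschitz_on B (Y \<omega>)))"
  shows "law_limit (continuous_functions_on B) M X N Y"
proof (rule law_limitI_lipschitz[OF M measurable_random_function[OF B X Xm] N
      measurable_random_function[OF B Y Ym]])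
  fix F C b' assume F: "lipschitz_functional (continuous_functions_on B) C F"
    and b': "\<And>f. f \<in> mspace (continuous_functions_on B) \<Longrightarrow> \<bar>F f\<bar> \<le> b'"
  have C: "C \<ge> 0" using F by (simp add: lipschitz_functional_def)
  define b where "b = \<bar>b'\<bar>"
  have b: "\<And>f. f \<in> mspace (continuous_functions_on B) \<Longrightarrow> \<bar>F f\<bar> \<le> b" "b \<ge> 0"
    using b' unfolding b_def by force+
  show "((\<lambda>lam. \<integral>\<omega>. F (X lam \<omega>) \<partial>M lam) \<longlongrightarrow> (\<integral>\<omega>. F (Y \<omega>) \<partial>N)) at_top"
  proof (rule tendsto_of_approximations)
    fix \<eta> :: real assume "\<eta> > 0"
    \<comment> \<open>The same e serves as mesh of the value grid, as bound on the oscillation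
      between net points and as exceptional probability; the errors add up to
      \<open>C * (2 * e) + 2 * b * e\<close>.\<close>
    define e where "e = \<eta> / (2 * C + 2 * b + 1)"
    have D: "2 * C + 2 * b + 1 > 0" using C b by linarith
    have e: "e > 0" "C * (2 * e) + 2 * b * e \<le> \<eta>"
    proof -
      show "e > 0" unfolding e_def using \<open>\<eta> > 0\<close> D by simp
      have "(2 * C + 2 * b + 1) * e = \<eta>" unfolding e_def using D by simp
      with \<open>e > 0\<close> show "C * (2 * e) + 2 * b * e \<le> \<eta>" by (simp add: algebra_simps)
    qed
    obtain L H where LH: "\<forall>\<^sub>F lam in at_top. \<exists>A\<in>sets (M lam). measure (M lam) A \<ge> 1 - e \<and>
          (\<forall>\<omega>\<in>A. (\<forall>v\<in>B. \<bar>X lam \<omega> v\<bar> \<le> H) \<and> L-lipschitz_on B (X lam \<omega>))"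
      "\<exists>A\<in>sets N. measure N A \<ge> 1 - e \<and>
          (\<forall>\<omega>\<in>A. (\<forall>v\<in>B. \<bar>Y \<omega> v\<bar> \<le> H) \<and> L-lipschitz_on B (Y \<omega>))"
      using tight[OF e(1)] by blast
    define r where "r = e / (\<bar>L\<bar> + 1)"
    have r: "r > 0" "L * r \<le> e"
    proof -
      show "r > 0" using e by (simp add: r_def add_nonneg_pos)
      have "L * r \<le> (\<bar>L\<bar> + 1) * r" using \<open>r > 0\<close> by (intro mult_right_mono) auto
      also have "\<dots> = e" unfolding r_def by (simp add: add_nonneg_pos)
      finally show "L * r \<le> e" .
    qed
    obtain S where S: "finite S" "S \<subseteq> B" "B \<subseteq> (\<Union>x\<in>S. ball x r)"
      by (rule finite_net[OF B r(1)])
    obtain m :: int where m: "H / e + 1 \<le> of_int m" using ex_le_of_int by blast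
    let ?sum = "\<lambda>p. \<Sum>k\<in>S \<rightarrow>\<^sub>E {- m..m}. F (interpolate B r S (\<lambda>x. e * of_int (k x))) * p (k :: 'v \<Rightarrow> int) :: real"
    let ?p = "\<lambda>lam k. measure (M lam) {\<omega> \<in> space (M lam).
        \<forall>x\<in>S. e * of_int (k x) \<le> X lam \<omega> x \<and> X lam \<omega> x < e * (of_int (k x) + 1)}"
    let ?q = "\<lambda>k. measure N {\<omega> \<in> space N.
        \<forall>x\<in>S. e * of_int (k x) \<le> Y \<omega> x \<and> Y \<omega> x < e * (of_int (k x) + 1)}"
    have "((\<lambda>lam. ?p lam k) \<longlongrightarrow> ?q k) at_top" for k
      using box_probability_tendsto[where M = M and X = X and N = N and Y = Y and B = B and T = "{}"
          and a = "\<lambda>x. e * of_int (k x)" and b = "\<lambda>x. e * (of_int (k x) + 1)", OF M N Xm Ym fidi S(1,2)]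
      by simp
    then have "((\<lambda>lam. ?sum (?p lam)) \<longlongrightarrow> ?sum ?q) at_top"
      by (intro tendsto_sum tendsto_mult tendsto_const)
    moreover have "\<forall>\<^sub>F lam in at_top. \<bar>(\<integral>\<omega>. F (X lam \<omega>) \<partial>M lam) - ?sum (?p lam)\<bar> \<le> \<eta>"
      using LH(1) eventually_gt_at_top[of 0]
    proof eventually_elim
      case (elim lam)
      then obtain A where A: "A \<in> sets (M lam)" "measure (M lam) A \<ge> 1 - e"
        "\<And>\<omega> v. \<omega> \<in> A \<Longrightarrow> v \<in> B \<Longrightarrow> \<bar>X lam \<omega> v\<bar> \<le> H" "\<And>\<omega>. \<omega> \<in> A \<Longrightarrow> L-lipschitz_on B (X lam \<omega>)"
        by blast
      show ?case
        by (rule order_trans[OF functional_box_approx[OF M B X Xm F b S e(1) r(2) m A] e(2)])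
          (use elim in auto)
    qed
    moreover have "\<bar>(\<integral>\<omega>. F (Y \<omega>) \<partial>N) - ?sum ?q\<bar> \<le> \<eta>"
    proof -
      obtain A where A: "A \<in> sets N" "measure N A \<ge> 1 - e"
        "\<And>\<omega> v. \<omega> \<in> A \<Longrightarrow> v \<in> B \<Longrightarrow> \<bar>Y \<omega> v\<bar> \<le> H" "\<And>\<omega>. \<omega> \<in> A \<Longrightarrow> L-lipschitz_on B (Y \<omega>)"
        using LH(2) by blast
      show ?thesis
        by (rule order_trans[OF functional_box_approx[OF N B Y Ym F b S e(1) r(2) m A] e(2)])
    qed
    ultimately show "\<exists>g a. (g \<longlongrightarrow> a) at_top \<and>
       (\<forall>\<^sub>F lam in at_top. \<bar>(\<integral>\<omega>. F (X lam \<omega>) \<partial>M lam) - g lam\<bar> \<le> \<eta>) \<and>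
       \<bar>(\<integral>\<omega>. F (Y \<omega>) \<partial>N) - a\<bar> \<le> \<eta>"
      by blast
  qed
qed

section \<open>Parabolic coordinates near the pole\<close>

text \<open>The function sinc with its continuous value at 0; it turns \<open>exp_map\<close> into
  one formula without the case v = 0.\<close>

definition sin_quotient :: "real \<Rightarrow> real" where
  "sin_quotient x = (if x = 0 then 1 else sin x / x)"

lemma sin_quotient_mult: "sin_quotient x * x = sin x"
  by (simp add: sin_quotient_def)

lemma abs_sin_quotient_le: "\<bar>sin_quotient x\<bar> \<le> 1"
  using abs_sin_x_le_abs_x[of x] by (auto simp: sin_quotient_def abs_divide)

lemma sin_quotient_tendsto: "(sin_quotient \<longlongrightarrow> 1) (at 0)"
proof -
  have "((\<lambda>x::real. sin x / x) \<longlongrightarrow> 1) (at 0)" by (rule sinc_at_0)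
  moreover have "\<forall>\<^sub>F x in at 0. sin x / x = sin_quotient (x::real)"
    by (auto simp: sin_quotient_def eventually_at_filter)
  ultimately show ?thesis using Lim_transform_eventually by blast
qed

lemma one_minus_cos_le: "1 - cos x \<le> x\<^sup>2 / (2::real)"
proof -
  have "cos x = 1 - 2 * (sin (x/2))\<^sup>2" using cos_double_sin[of "x/2"] by simp
  moreover have "(sin (x/2))\<^sup>2 \<le> (x/2)\<^sup>2"
    using abs_sin_x_le_abs_x[of "x/2"] abs_le_square_iff by blast
  ultimately show ?thesis by (simp add: power2_eq_square)
qed

lemma exp_map_eq: "exp_map v = (sin_quotient (norm v) *\<^sub>R v, cos (norm v))"
  by (simp add: exp_map_def sin_quotient_def field_simps)

lemma exp_map_0: "exp_map 0 = (0, 1)"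
  by (simp add: exp_map_def)

lemma inner_exp_map:
  "exp_map v \<bullet> exp_map a =
     sin_quotient (norm v) * sin_quotient (norm a) * (v \<bullet> a) + cos (norm v) * cos (norm a)"
  by (simp add: exp_map_eq)

lemma norm_exp_map [simp]: "norm (exp_map v) = 1"
proof -
  have "exp_map v \<bullet> exp_map v = (sin_quotient (norm v) * norm v)\<^sup>2 + (cos (norm v))\<^sup>2"
    unfolding inner_exp_map by (simp add: power2_eq_square dot_square_norm)
  then show ?thesis by (simp add: sin_quotient_mult norm_eq_1)
qed

lemma inner_exp_map_self [simp]: "exp_map v \<bullet> exp_map v = 1"
  using norm_exp_map[of v] unfolding norm_eq_1 .

lemma norm_fst_le': "norm (fst z) \<le> norm z" and norm_snd_le': "norm (snd z) \<le> norm z"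
  using norm_fst_le[of "fst z" "snd z"] norm_snd_le[of "snd z" "fst z"] by simp_all

lemma norm_exp_map_diff: "(norm (exp_map v - exp_map a))\<^sup>2 = 2 * (1 - exp_map v \<bullet> exp_map a)"
  by (simp add: power2_norm_eq_inner inner_diff_left inner_diff_right inner_commute)

text \<open>The exponential map of the sphere does not increase distances. As both sinc factors are
  at most 1 in modulus, Cauchy-Schwarz reduces the claim to parallel v and a, where it is the bound
  on 1 - cos at the difference of the norms.\<close>

lemma one_minus_inner_exp_map_le: "1 - exp_map v \<bullet> exp_map a \<le> (norm (v - a))\<^sup>2 / 2"
proof -
  let ?r = "norm v" and ?s = "norm a"
  let ?p = "sin_quotient ?r * sin_quotient ?s"
  have "\<bar>?p\<bar> \<le> 1"
    using mult_mono[OF abs_sin_quotient_le abs_sin_quotient_le, of ?r ?s] by (simp add: abs_mult mult.commute)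
  then have "0 \<le> 1 - ?p" by linarith
  then have "(1 - ?p) * (v \<bullet> a) \<le> (1 - ?p) * (?r * ?s)"
    by (intro mult_left_mono norm_cauchy_schwarz)
  also have "\<dots> = ?r * ?s - sin ?r * sin ?s"
    by (simp add: algebra_simps sin_quotient_mult[symmetric])
  also have "\<dots> \<le> (?r\<^sup>2 + ?s\<^sup>2) / 2 - 1 + cos ?r * cos ?s"
    using one_minus_cos_le[of "?r - ?s"] unfolding cos_diff power2_diff by (simp add: field_simps)
  finally have "(1 - ?p) * (v \<bullet> a) \<le> (?r\<^sup>2 + ?s\<^sup>2) / 2 - 1 + cos ?r * cos ?s" .
  moreover have "(norm (v - a))\<^sup>2 = ?r\<^sup>2 + ?s\<^sup>2 - 2 * (v \<bullet> a)"
    by (simp add: power2_norm_eq_inner inner_diff_left inner_diff_right inner_commute)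
  ultimately show ?thesis by (simp add: inner_exp_map field_simps)
qed

lemma norm_exp_map_diff_le: "norm (exp_map v - exp_map a) \<le> norm (v - a)"
  using one_minus_inner_exp_map_le[of v a]
  by (intro power2_le_imp_le[OF _ norm_ge_zero]) (simp add: norm_exp_map_diff)

text \<open>The depth of y below the tangent hyperplane of the sphere at the direction of v, in
  units of \<open>e\<^sup>2\<close>. Its minimum over a configuration is the rescaled defect support
  function.\<close>

definition cap_defect :: "real \<Rightarrow> 'v::euclidean_space \<Rightarrow> 'v \<times> real \<Rightarrow> real" where
  "cap_defect e v y = (1 - y \<bullet> exp_map (e *\<^sub>R v)) / e\<^sup>2"

lemma cap_defect_exp_map_le:
  assumes "e > 0"
  shows "cap_defect e v (exp_map (e *\<^sub>R a)) \<le> (norm (v - a))\<^sup>2 / 2"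
proof -
  have "1 - exp_map (e *\<^sub>R a) \<bullet> exp_map (e *\<^sub>R v) \<le> (norm (e *\<^sub>R a - e *\<^sub>R v))\<^sup>2 / 2"
    by (rule one_minus_inner_exp_map_le)
  also have "\<dots> = (norm (v - a))\<^sup>2 / 2 * e\<^sup>2"
    by (simp add: scaleR_diff_right[symmetric] norm_minus_commute power_mult_distrib)
  finally show ?thesis using assms by (simp add: cap_defect_def divide_le_eq)
qed

lemma cap_defect_nonneg:
  assumes "y \<in> cball 0 1"
  shows "cap_defect e v y \<ge> 0"
proof -
  have "y \<bullet> exp_map (e *\<^sub>R v) \<le> norm y * norm (exp_map (e *\<^sub>R v))" by (rule norm_cauchy_schwarz)
  with assms show ?thesis by (simp add: cap_defect_def)
qed

lemma sin_quotient_uniform: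
  assumes "k > 0" "H \<ge> 0"
  shows "\<forall>\<^sub>F e in at_right 0. \<forall>v::'v::euclidean_space. norm v \<le> H \<longrightarrow> \<bar>1 - sin_quotient (norm (e *\<^sub>R v))\<bar> \<le> k"
proof -
  have "\<forall>\<^sub>F x in at 0. dist (sin_quotient x) 1 < k"
    using sin_quotient_tendsto assms(1) by (rule tendstoD)
  then obtain d where d: "d > 0" "\<And>x. x \<noteq> 0 \<Longrightarrow> \<bar>x\<bar> < d \<Longrightarrow> \<bar>1 - sin_quotient x\<bar> \<le> k"
    by (auto simp: eventually_at dist_real_def abs_minus_commute less_imp_le)
  have "\<forall>\<^sub>F e in at_right (0::real). e < d / (H + 1)"
    using d assms by (intro eventually_at_right_less order_tendstoD(2)[OF tendsto_ident_at]) auto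
  then show ?thesis using eventually_at_right_less[of 0]
  proof eventually_elim
    case (elim e)
    have "\<bar>1 - sin_quotient (norm (e *\<^sub>R v))\<bar> \<le> k" if "norm v \<le> H" for v :: 'v
    proof (cases "norm (e *\<^sub>R v) = 0")
      case False
      have "norm (e *\<^sub>R v) \<le> e * (H + 1)" using that elim by (simp add: mult_left_mono)
      also have "\<dots> < d" using elim assms by (simp add: field_simps)
      finally show ?thesis using d(2)[OF False] by simp
    qed (use assms in \<open>simp add: sin_quotient_def\<close>)
    then show ?case by blast
  qed
qed

text \<open>A chord is at least as long as its horizontal component, which is e times a perturbation
  of \<open>v - a\<close> by sinc factors close to 1. Uniformity in v and a is what allows the bound
  to enter a supremum over a.\<close>

lemma cap_defect_exp_map_ge:
  assumes "\<eta> > 0" "H \<ge> 0"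
  shows "\<forall>\<^sub>F e in at_right 0. \<forall>v a::'v::euclidean_space. norm v \<le> H \<longrightarrow> norm a \<le> H \<longrightarrow>
      (norm (v - a))\<^sup>2 / 2 - \<eta> \<le> cap_defect e v (exp_map (e *\<^sub>R a))"
proof -
  \<comment> \<open>With sinc factors within k of 1 and \<open>norm (v - a)\<close> at most 2H, half
    the squared distance drops by at most \<open>4 * H\<^sup>2 * k\<close>.\<close>
  define k where "k = \<eta> / (4 * H\<^sup>2 + 1)"
  have k: "k > 0" "4 * H\<^sup>2 * k \<le> \<eta>"
  proof -
    have "4 * H\<^sup>2 + 1 > 0" by (simp add: add_nonneg_pos)
    then show "k > 0" "4 * H\<^sup>2 * k \<le> \<eta>" using assms by (simp_all add: k_def field_simps)
  qed
  from sin_quotient_uniform[where 'v = 'v, OF k(1) assms(2)] eventually_at_right_less[of 0]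
  show ?thesis
  proof eventually_elim
    case (elim e)
    have "(norm (v - a))\<^sup>2 / 2 - \<eta> \<le> cap_defect e v (exp_map (e *\<^sub>R a))"
      if v: "norm v \<le> H" and a: "norm a \<le> H" for v a :: 'v
    proof -
      let ?s = "\<lambda>v. sin_quotient (norm (e *\<^sub>R v))"
      define x where "x = norm (v - a)"
      define y where "y = norm (?s v *\<^sub>R v - ?s a *\<^sub>R a)"
      have small: "norm ((1 - ?s w) *\<^sub>R w) \<le> k * H" if "norm w \<le> H" for w :: 'v
      proof -
        have "\<bar>1 - ?s w\<bar> \<le> k" using elim(1) that by blast
        then show ?thesis unfolding norm_scaleR using that k(1) by (intro mult_mono) auto
      qed
      have "v - a = (?s v *\<^sub>R v - ?s a *\<^sub>R a) + ((1 - ?s v) *\<^sub>R v - (1 - ?s a) *\<^sub>R a)"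
        by (simp add: algebra_simps)
      then have "x \<le> y + norm ((1 - ?s v) *\<^sub>R v - (1 - ?s a) *\<^sub>R a)"
        unfolding x_def y_def by (metis norm_triangle_ineq)
      moreover have "norm ((1 - ?s v) *\<^sub>R v - (1 - ?s a) *\<^sub>R a) \<le> k * H + k * H"
        by (rule order_trans[OF norm_triangle_ineq4 add_mono[OF small[OF v] small[OF a]]])
      ultimately have xy: "x \<le> y + 2 * k * H" by linarith
      have xH: "0 \<le> x" "x \<le> 2 * H" "0 \<le> y" unfolding x_def y_def
        using norm_triangle_ineq4[of v a] v a by auto
      have "x\<^sup>2 - 4 * k * H * x \<le> y\<^sup>2"
      proof (cases "x \<le> 2 * k * H")
        case True
        have "x\<^sup>2 \<le> 2 * k * H * x" using mult_right_mono[OF True xH(1)] by (simp add: power2_eq_square)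
        moreover have "0 \<le> k * H * x" using k assms xH by simp
        ultimately have "x\<^sup>2 - 4 * k * H * x \<le> 0" by (simp add: algebra_simps)
        then show ?thesis using zero_le_power2[of y] by linarith
      next
        case False
        then have "(x - 2 * k * H)\<^sup>2 \<le> y\<^sup>2" using xy by (intro power_mono) auto
        then show ?thesis
          by (simp add: power2_diff algebra_simps) (smt (verit) zero_le_power2 power_mult_distrib)
      qed
      moreover have "k * H * x \<le> k * H * (2 * H)" using k assms xH by (intro mult_left_mono) auto
      ultimately have "x\<^sup>2 / 2 - 4 * H\<^sup>2 * k \<le> y\<^sup>2 / 2" by (simp add: power2_eq_square algebra_simps)
      then have 1: "x\<^sup>2 / 2 - \<eta> \<le> y\<^sup>2 / 2" using k(2) by linarith
      have "e\<^sup>2 * y\<^sup>2 = (norm (fst (exp_map (e *\<^sub>R v) - exp_map (e *\<^sub>R a))))\<^sup>2"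
      proof -
        have "fst (exp_map (e *\<^sub>R v) - exp_map (e *\<^sub>R a)) = e *\<^sub>R (?s v *\<^sub>R v - ?s a *\<^sub>R a)"
          by (simp add: exp_map_eq algebra_simps)
        then show ?thesis by (simp add: y_def power_mult_distrib)
      qed
      also have "\<dots> \<le> (norm (exp_map (e *\<^sub>R v) - exp_map (e *\<^sub>R a)))\<^sup>2"
        by (intro power_mono norm_fst_le') auto
      also have "\<dots> = 2 * (e\<^sup>2 * cap_defect e v (exp_map (e *\<^sub>R a)))"
        unfolding norm_exp_map_diff using elim(2) by (simp add: cap_defect_def inner_commute)
      finally have "e\<^sup>2 * (y\<^sup>2 / 2) \<le> e\<^sup>2 * cap_defect e v (exp_map (e *\<^sub>R a))" by simp
      then have "y\<^sup>2 / 2 \<le> cap_defect e v (exp_map (e *\<^sub>R a))"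
        using elim(2) by simp
      with 1 show ?thesis by (simp add: x_def)
    qed
    then show ?case by blast
  qed
qed

lemma cap_defect_exp_map_tendsto:
  "((\<lambda>e. cap_defect e v (exp_map (e *\<^sub>R a))) \<longlongrightarrow> (norm (v - a))\<^sup>2 / 2) (at_right 0)"
proof (rule tendstoI)
  fix \<eta> :: real assume "\<eta> > 0"
  define H where "H = max (norm v) (norm a)"
  have "H \<ge> 0" by (auto simp: H_def le_max_iff_disj)
  from cap_defect_exp_map_ge[where 'v = 'a, OF half_gt_zero[OF \<open>\<eta> > 0\<close>] this] eventually_at_right_less[of 0]
  show "\<forall>\<^sub>F e in at_right 0. dist (cap_defect e v (exp_map (e *\<^sub>R a))) ((norm (v - a))\<^sup>2 / 2) < \<eta>"
  proof eventually_elim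
    case (elim e)
    have "(norm (v - a))\<^sup>2 / 2 - \<eta> / 2 \<le> cap_defect e v (exp_map (e *\<^sub>R a))"
      using elim(1) unfolding H_def by auto
    with cap_defect_exp_map_le[OF elim(2), of v a] \<open>\<eta> > 0\<close> show ?case
      by (simp add: dist_real_def)
  qed
qed

text \<open>Parabolic scaling of caps: depth of order \<open>e\<^sup>2\<close> forces width of order
  e.\<close>

lemma cap_defect_norm_le:
  assumes "y \<in> cball 0 1" "e > 0" "cap_defect e v y \<le> H"
  shows "norm (y - exp_map (e *\<^sub>R v)) \<le> e * sqrt (2 * H)"
proof -
  have "(norm (y - exp_map (e *\<^sub>R v)))\<^sup>2 = (norm y)\<^sup>2 + 1 - 2 * (y \<bullet> exp_map (e *\<^sub>R v))"
    by (simp add: power2_norm_eq_inner inner_diff_left inner_diff_right inner_commute)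
  also have "\<dots> \<le> 2 * (1 - y \<bullet> exp_map (e *\<^sub>R v))"
    using assms(1) by (simp add: power_le_one)
  also have "\<dots> \<le> e\<^sup>2 * (2 * H)"
    using assms by (simp add: cap_defect_def divide_le_eq mult.commute)
  finally have "norm (y - exp_map (e *\<^sub>R v)) \<le> sqrt (e\<^sup>2 * (2 * H))"
    using real_le_rsqrt by blast
  then show ?thesis using assms(2) by (simp add: real_sqrt_mult)
qed

text \<open>The bound H keeps y within order e of the contact point, so the slope in v stays bounded
  as e tends to 0, unlike the crude rate \<open>1 / e\<close> of
  \<open>cap_defect_lipschitz\<close>.\<close>

lemma cap_defect_shift:
  assumes "y \<in> cball 0 1" "e > 0" "cap_defect e v y \<le> H"
  shows "cap_defect e a y \<le> cap_defect e v y + (sqrt (2 * H) + norm (v - a) / 2) * norm (v - a)"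
proof -
  let ?u = "exp_map (e *\<^sub>R v)" and ?u' = "exp_map (e *\<^sub>R a)"
  have d: "norm (?u - ?u') \<le> e * norm (v - a)"
    using norm_exp_map_diff_le[of "e *\<^sub>R v" "e *\<^sub>R a"] assms(2)
    by (simp add: scaleR_diff_right[symmetric])
  have "y \<bullet> (?u - ?u') = (y - ?u) \<bullet> (?u - ?u') + (1 - ?u \<bullet> ?u')"
    by (simp add: inner_diff_left inner_diff_right)
  also have "(y - ?u) \<bullet> (?u - ?u') \<le> norm (y - ?u) * norm (?u - ?u')" by (rule norm_cauchy_schwarz)
  also have "\<dots> \<le> (e * sqrt (2 * H)) * (e * norm (v - a))"
  proof (rule mult_mono)
    have "cap_defect e v y \<ge> 0" by (rule cap_defect_nonneg[OF assms(1)])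
    then show "0 \<le> e * sqrt (2 * H)" using assms by simp
  qed (use cap_defect_norm_le[OF assms] d in auto)
  also have "1 - ?u \<bullet> ?u' \<le> e\<^sup>2 * ((norm (v - a))\<^sup>2 / 2)"
    using one_minus_inner_exp_map_le[of "e *\<^sub>R v" "e *\<^sub>R a"]
    by (simp add: scaleR_diff_right[symmetric] power_mult_distrib)
  finally have "y \<bullet> (?u - ?u') \<le> e\<^sup>2 * ((sqrt (2 * H) + norm (v - a) / 2) * norm (v - a))"
    by (simp add: power2_eq_square algebra_simps)
  moreover have "cap_defect e a y - cap_defect e v y = y \<bullet> (?u - ?u') / e\<^sup>2"
    using assms(2) by (simp add: cap_defect_def inner_diff_right field_simps)
  ultimately have "cap_defect e a y - cap_defect e v y \<le> (sqrt (2 * H) + norm (v - a) / 2) * norm (v - a)"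
    using assms(2) by (simp add: divide_le_eq mult.commute)
  then show ?thesis by simp
qed

text \<open>Near the pole the ball is described by the parabolic coordinates \<open>(w, g)\<close>; since they are
  affine, they preserve convexity, and the limiting paraboloids turn into affine functions of
  \<open>(w, g)\<close>.\<close>

definition pole_chart :: "real \<Rightarrow> 'v::euclidean_space \<times> real \<Rightarrow> 'v \<times> real" where
  "pole_chart e = (\<lambda>(w, g). (e *\<^sub>R w, 1 - e\<^sup>2 * g))"

text \<open>The defect and the chart are both affine, so the dependence on e sits in three
  coefficients, each with an elementary limit.\<close>

lemma cap_defect_pole_chart:
  assumes "e > 0"
  shows "cap_defect e v (pole_chart e (w, g)) = cap_defect e v (exp_map 0)
     - sin_quotient (norm (e *\<^sub>R v)) * (w \<bullet> v) + g * cos (norm (e *\<^sub>R v))"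
  using assms by (simp add: cap_defect_def pole_chart_def exp_map_eq field_simps power2_eq_square)

lemma cap_defect_pole_chart_tendsto:
  "((\<lambda>e. cap_defect e v (pole_chart e x)) \<longlongrightarrow> snd x - fst x \<bullet> v + (norm v)\<^sup>2 / 2) (at_right 0)"
proof -
  obtain w g where x: "x = (w, g)" by fastforce
  have "((\<lambda>e. cap_defect e v (exp_map (0::'a))) \<longlongrightarrow> (norm v)\<^sup>2 / 2) (at_right 0)"
    using cap_defect_exp_map_tendsto[of v 0] by simp
  moreover have "((\<lambda>e. sin_quotient (norm (e *\<^sub>R v))) \<longlongrightarrow> 1) (at_right 0)"
  proof (rule tendstoI)
    fix k :: real assume "k > 0"
    from sin_quotient_uniform[where 'v = 'a, OF half_gt_zero[OF this] norm_ge_zero[of v]]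
    show "\<forall>\<^sub>F e in at_right 0. dist (sin_quotient (norm (e *\<^sub>R v))) 1 < k"
    proof eventually_elim
      case (elim e)
      then have "\<bar>1 - sin_quotient (norm (e *\<^sub>R v))\<bar> \<le> k / 2" by blast
      then show ?case using \<open>k > 0\<close> unfolding dist_real_def by linarith
    qed
  qed
  moreover have "((\<lambda>e. cos (norm (e *\<^sub>R v))) \<longlongrightarrow> cos (norm (0 *\<^sub>R v))) (at_right 0)"
    by (intro tendsto_intros)
  ultimately have "((\<lambda>e. cap_defect e v (exp_map (0::'a)) - sin_quotient (norm (e *\<^sub>R v)) * (w \<bullet> v)
      + g * cos (norm (e *\<^sub>R v))) \<longlongrightarrow> (norm v)\<^sup>2 / 2 - 1 * (w \<bullet> v) + g * cos (norm (0 *\<^sub>R v))) (at_right 0)"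
    by (intro tendsto_intros)
  moreover have "\<forall>\<^sub>F e in at_right 0. cap_defect e v (exp_map (0::'a)) - sin_quotient (norm (e *\<^sub>R v)) * (w \<bullet> v)
      + g * cos (norm (e *\<^sub>R v)) = cap_defect e v (pole_chart e x)"
    using eventually_at_right_less[of 0]
    by eventually_elim (simp only: x cap_defect_pole_chart)
  ultimately have "((\<lambda>e. cap_defect e v (pole_chart e x)) \<longlongrightarrow>
      (norm v)\<^sup>2 / 2 - 1 * (w \<bullet> v) + g * cos (norm (0 *\<^sub>R v))) (at_right 0)"
    by (rule Lim_transform_eventually)
  then show ?thesis by (simp add: x algebra_simps)
qed

lemma cap_defect_pole_chart_le:
  assumes "e > 0" "norm v \<le> R" "norm w \<le> L" "0 \<le> g" "g \<le> G" 
  shows "cap_defect e v (pole_chart e (w, g)) \<le> R\<^sup>2 / 2 + L * R + G"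
proof -
  have L: "L \<ge> 0" and R: "R \<ge> 0" using assms norm_ge_zero order_trans by blast+
  have "cap_defect e v (exp_map 0) \<le> (norm v)\<^sup>2 / 2"
    using cap_defect_exp_map_le[OF assms(1), of v 0] by simp
  also have "\<dots> \<le> R\<^sup>2 / 2" using assms(2) by (simp add: power_mono)
  finally have 1: "cap_defect e v (exp_map 0) \<le> R\<^sup>2 / 2" .
  have "\<bar>sin_quotient (norm (e *\<^sub>R v)) * (w \<bullet> v)\<bar> \<le> 1 * (norm w * norm v)"
    unfolding abs_mult by (intro mult_mono abs_sin_quotient_le Cauchy_Schwarz_ineq2) auto
  also have "\<dots> \<le> L * R" using assms L by (simp add: mult_mono)
  finally have 2: "\<bar>sin_quotient (norm (e *\<^sub>R v)) * (w \<bullet> v)\<bar> \<le> L * R" .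
  have "g * cos (norm (e *\<^sub>R v)) \<le> g * 1" using assms by (intro mult_left_mono) auto
  with 1 2 assms show ?thesis unfolding cap_defect_pole_chart[OF assms(1)] by linarith
qed

text \<open>The box is independent of e and yields the dominating function for
  \<open>cap_density_integral_tendsto\<close>. The lower bound on the cosine, which is the
  coefficient of g, turns a bound on the defect into one on g; hence the factor 2.\<close>

lemma pole_chart_localization:
  assumes "e > 0" "pole_chart e (w, g) \<in> cball 0 1" "cap_defect e v (pole_chart e (w, g)) \<le> H"
    "norm v \<le> R" "cos (norm (e *\<^sub>R v)) \<ge> 1 / 2"
  shows "norm w \<le> sqrt (2 * H) + R" "0 \<le> g" "g \<le> 2 * (H + (sqrt (2 * H) + R) * R)"
proof -
  let ?s = "sin_quotient (norm (e *\<^sub>R v))"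
  have R: "R \<ge> 0" using assms(4) norm_ge_zero order_trans by blast
  have "e * norm (w - ?s *\<^sub>R v) = norm (fst (pole_chart e (w, g) - exp_map (e *\<^sub>R v)))"
  proof -
    have "fst (pole_chart e (w, g) - exp_map (e *\<^sub>R v)) = e *\<^sub>R (w - ?s *\<^sub>R v)"
      by (simp add: pole_chart_def exp_map_eq algebra_simps)
    then show ?thesis using assms(1) by simp
  qed
  also have "\<dots> \<le> e * sqrt (2 * H)"
    by (rule order_trans[OF norm_fst_le' cap_defect_norm_le[OF assms(2,1,3)]])
  finally have "norm (w - ?s *\<^sub>R v) \<le> sqrt (2 * H)" using assms(1) by simp
  moreover have "norm (?s *\<^sub>R v) \<le> 1 * R"
    unfolding norm_scaleR using assms(4) by (intro mult_mono) (auto simp: abs_sin_quotient_le)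
  moreover have "norm w \<le> norm (w - ?s *\<^sub>R v) + norm (?s *\<^sub>R v)"
    using norm_triangle_ineq[of "w - ?s *\<^sub>R v" "?s *\<^sub>R v"] by simp
  ultimately show w: "norm w \<le> sqrt (2 * H) + R" by linarith
  have "\<bar>1 - e\<^sup>2 * g\<bar> \<le> 1"
    using assms(2) norm_snd_le'[of "pole_chart e (w, g)"] by (simp add: pole_chart_def)
  then have "0 \<le> e\<^sup>2 * g" by linarith
  then show g: "0 \<le> g" using assms(1) by (simp add: zero_le_mult_iff)
  have "\<bar>?s * (w \<bullet> v)\<bar> \<le> 1 * (norm w * norm v)"
    unfolding abs_mult by (intro mult_mono abs_sin_quotient_le Cauchy_Schwarz_ineq2) auto
  also have "\<dots> \<le> (sqrt (2 * H) + R) * R"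
    using assms(4) w order_trans[OF norm_ge_zero w] by (simp add: mult_mono)
  finally have "\<bar>?s * (w \<bullet> v)\<bar> \<le> (sqrt (2 * H) + R) * R" .
  moreover have "cap_defect e v (exp_map (0::'a)) \<ge> 0" by (rule cap_defect_nonneg) (simp del: exp_map_0)
  moreover have "g * cos (norm (e *\<^sub>R v)) \<ge> g * (1/2)" using assms(5) g by (intro mult_left_mono) auto
  ultimately show "g \<le> 2 * (H + (sqrt (2 * H) + R) * R)"
    using assms(3) unfolding cap_defect_pole_chart[OF assms(1)] by argo
qed

section \<open>Rescaled intensities\<close>

text \<open>The maximum with 0 encodes the restriction to the ball. No power of lam remains, since
  it cancels against the powers of e in \<open>measure_ball_intensity\<close>.\<close>

definition cap_density :: "real \<Rightarrow> real \<Rightarrow> 'v::euclidean_space \<times> real \<Rightarrow> real" where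
  "cap_density \<delta> e x = max 0 ((1 - norm (pole_chart e x)) / e\<^sup>2) powr \<delta>"

definition parabola_density :: "real \<Rightarrow> 'v::euclidean_space \<times> real \<Rightarrow> real" where
  "parabola_density \<delta> x = max 0 (snd x - (norm (fst x))\<^sup>2 / 2) powr \<delta>"

definition shear :: "'v::euclidean_space \<times> real \<Rightarrow> 'v \<times> real" where
  "shear = (\<lambda>(w, h). (w, h + (norm w)\<^sup>2 / 2))"

lemma pole_chart_measurable [measurable]: "pole_chart e \<in> borel \<rightarrow>\<^sub>M borel"
  unfolding pole_chart_def case_prod_beta
  by (intro borel_measurable_continuous_onI continuous_intros)

lemma shear_measurable [measurable]: "shear \<in> borel \<rightarrow>\<^sub>M borel"
  unfolding shear_def case_prod_beta
  by (intro borel_measurable_continuous_onI continuous_intros) auto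

lemma continuous_pole_chart: "continuous_on UNIV (pole_chart e)"
  unfolding pole_chart_def case_prod_beta by (intro continuous_intros)

lemma cap_density_measurable [measurable]: "cap_density \<delta> e \<in> borel_measurable borel"
proof -
  have [measurable]: "(\<lambda>x :: 'a \<times> real. norm (pole_chart e x)) \<in> borel_measurable borel"
    by (intro borel_measurable_continuous_onI continuous_intros continuous_pole_chart)
  show ?thesis unfolding cap_density_def[abs_def] by measurable
qed

lemma parabola_density_measurable [measurable]: "parabola_density \<delta> \<in> borel_measurable borel"
proof -
  have [measurable]: "(\<lambda>x :: 'a \<times> real. snd x - (norm (fst x))\<^sup>2 / 2) \<in> borel_measurable borel"
    by (intro borel_measurable_continuous_onI continuous_intros) auto
  show ?thesis unfolding parabola_density_def[abs_def] by measurable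
qed

lemma lborel_pole_chart:
  assumes "e > 0"
  shows "(lborel :: ('v::euclidean_space \<times> real) measure) =
    density (distr lborel borel (pole_chart e)) (\<lambda>_. ennreal (e ^ DIM('v) * e\<^sup>2))"
proof -
  \<comment> \<open>The chart is diagonal. Basis vectors are \<open>(i, 0)\<close> or
    \<open>(0, 1)\<close>, so \<open>snd j\<close> tells horizontal from vertical directions; the
    sign of the vertical factor disappears in the Jacobian.\<close>
  define c :: "'v \<times> real \<Rightarrow> real" where "c j = (if snd j = 0 then e else - e\<^sup>2)" for j
  have T: "(0, 1) + (\<Sum>j\<in>Basis. (c j * (x \<bullet> j)) *\<^sub>R j) = pole_chart e x" for x
  proof -
    have "(\<Sum>j\<in>Basis. (c j * (x \<bullet> j)) *\<^sub>R j) =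
        (\<Sum>i\<in>Basis. (e * (fst x \<bullet> i)) *\<^sub>R (i, 0)) + (0, - e\<^sup>2 * snd x)"
      unfolding sum_Basis_prod_eq by (simp add: c_def inner_prod_def)
    also have "(\<Sum>i\<in>Basis. (e * (fst x \<bullet> i)) *\<^sub>R (i, 0 :: real)) = (e *\<^sub>R fst x, 0)"
    proof (rule prod_eqI)
      have "fst (\<Sum>i\<in>Basis. (e * (fst x \<bullet> i)) *\<^sub>R (i, 0 :: real)) = (\<Sum>i\<in>Basis. e *\<^sub>R ((fst x \<bullet> i) *\<^sub>R i))"
        by (simp add: fst_sum)
      also have "\<dots> = e *\<^sub>R fst x"
        by (simp only: scaleR_sum_right[symmetric] euclidean_representation)
      finally show "fst (\<Sum>i\<in>Basis. (e * (fst x \<bullet> i)) *\<^sub>R (i, 0 :: real)) = fst (e *\<^sub>R fst x, 0 :: real)"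
        by simp
    qed (simp add: snd_sum)
    finally show ?thesis by (simp add: pole_chart_def case_prod_beta)
  qed
  have "(\<Prod>j\<in>Basis. \<bar>c j\<bar>) = e ^ DIM('v) * e\<^sup>2"
  proof -
    have "(\<Prod>j\<in>Basis. \<bar>c j\<bar>) = (\<Prod>j\<in>(\<lambda>u. (u, 0)) ` Basis. \<bar>c j\<bar>) * (\<Prod>j\<in>(\<lambda>u. (0, u)) ` Basis. \<bar>c j\<bar>)"
      unfolding Basis_prod_def by (intro prod.union_disjoint) auto
    also have "(\<Prod>j\<in>(\<lambda>u. (u :: 'v, 0 :: real)) ` Basis. \<bar>c j\<bar>) = (\<Prod>u\<in>(Basis :: 'v set). e)"
      using assms by (subst prod.reindex) (auto simp: inj_on_def c_def)
    also have "(\<Prod>j\<in>(\<lambda>u. (0 :: 'v, u :: real)) ` Basis. \<bar>c j\<bar>) = e\<^sup>2"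
      by (simp add: c_def)
    finally show ?thesis by simp
  qed
  moreover have "c j \<noteq> 0" for j using assms by (simp add: c_def)
  ultimately show ?thesis
    using lborel_affine_euclidean[of c "(0, 1)"] by (simp add: T prod_ennreal[symmetric] ennreal_mult)
qed

lemma integral_pole_chart:
  fixes f :: "'v::euclidean_space \<times> real \<Rightarrow> real"
  assumes "e > 0" and [measurable]: "f \<in> borel_measurable borel"
  shows "(\<integral>x. f x \<partial>lborel) = e ^ DIM('v) * e\<^sup>2 * (\<integral>x. f (pole_chart e x) \<partial>lborel)"
proof -
  have "(\<integral>x. f x \<partial>lborel) = (\<integral>x. e ^ DIM('v) * e\<^sup>2 * f x \<partial>distr lborel borel (pole_chart e))"
    by (subst lborel_pole_chart[OF assms(1)], subst integral_density) (use assms in auto)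
  also have "\<dots> = e ^ DIM('v) * e\<^sup>2 * (\<integral>x. f (pole_chart e x) \<partial>lborel)"
    by (subst integral_distr) auto
  finally show ?thesis .
qed

lemma pole_chart_in_cball_iff:
  "e > 0 \<Longrightarrow> pole_chart e x \<in> cball 0 1 \<longleftrightarrow> 0 \<le> (1 - norm (pole_chart e x)) / e\<^sup>2"
  by (simp add: zero_le_divide_iff)

section \<open>Masses of sets in chart and sheared coordinates\<close>

lemma measure_density_eq_integral:
  fixes g :: "'a \<Rightarrow> real"
  assumes "g \<in> borel_measurable M" "\<And>x. 0 \<le> g x" "A \<in> sets M"
  shows "measure (density M (\<lambda>x. ennreal (g x))) A = (\<integral>x. g x * indicator A x \<partial>M)"
proof -
  have "measure (density M (\<lambda>x. ennreal (g x))) A = (\<integral>x. indicator A x \<partial>density M (\<lambda>x. ennreal (g x)))"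
    using sets.sets_into_space[OF assms(3)] by (simp add: Int_absorb2)
  also have "\<dots> = (\<integral>x. g x *\<^sub>R indicator A x \<partial>M)"
    using assms by (intro integral_density) auto
  finally show ?thesis by simp
qed

lemma ball_density_measurable:
  "(\<lambda>x :: 'a::euclidean_space. lam * (1 - norm x) powr \<delta> * indicator (cball 0 1) x) \<in> borel_measurable borel"
  by (intro borel_measurable_times borel_measurable_indicator powr_real_measurable
      borel_measurable_continuous_onI continuous_intros) auto

lemma measure_ball_intensity_eq:
  fixes A :: "'a::euclidean_space set"
  assumes "lam > 0" "A \<in> sets borel"
  shows "measure (ball_intensity \<delta> lam) A =
    (\<integral>x. lam * (1 - norm x) powr \<delta> * indicator (cball 0 1) x * indicator A x \<partial>lborel)"
proof -
  have "ball_intensity \<delta> lam =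
      density lborel (\<lambda>x :: 'a. ennreal (lam * (1 - norm x) powr \<delta> * indicator (cball 0 1) x))"
    unfolding ball_intensity_def by (intro arg_cong2[where f = density]) (auto simp: indicator_def)
  moreover have "measure (density lborel (\<lambda>x :: 'a. ennreal (lam * (1 - norm x) powr \<delta> * indicator (cball 0 1) x))) A =
      (\<integral>x. lam * (1 - norm x) powr \<delta> * indicator (cball 0 1) x * indicator A x \<partial>lborel)"
    using ball_density_measurable assms
    by (intro measure_density_eq_integral) (simp_all add: indicator_def)
  ultimately show ?thesis by simp
qed

lemma measure_ball_intensity:
  fixes A :: "('v::euclidean_space \<times> real) set"
  assumes "lam > 0" "\<delta> > 0" and A: "A \<in> sets borel"
    and e: "e = lam powr - beta_exp (DIM('v) + 1) \<delta>"
  shows "measure (ball_intensity \<delta> lam) A =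
    (\<integral>x. indicator A (pole_chart e x) * cap_density \<delta> e x \<partial>lborel)"
proof -
  have e0: "e > 0" using assms(1) by (simp add: e)
  let ?g = "\<lambda>x :: 'v \<times> real. lam * (1 - norm x) powr \<delta> * indicator (cball 0 1) x"
  have "measure (ball_intensity \<delta> lam) A = (\<integral>x. ?g x * indicator A x \<partial>lborel)"
    by (rule measure_ball_intensity_eq[OF assms(1) A])
  also have "\<dots> = e ^ DIM('v) * e\<^sup>2 *
      (\<integral>x. ?g (pole_chart e x) * indicator A (pole_chart e x) \<partial>lborel)"
    by (rule integral_pole_chart[OF e0, of "\<lambda>x. ?g x * indicator A x"])
      (intro borel_measurable_times ball_density_measurable borel_measurable_indicator A)
  also have "\<dots> = (\<integral>x. e ^ DIM('v) * e\<^sup>2 * (?g (pole_chart e x) * indicator A (pole_chart e x)) \<partial>lborel)"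
    by simp
  also have "\<dots> = (\<integral>x. indicator A (pole_chart e x) * cap_density \<delta> e x \<partial>lborel)"
  proof (rule Bochner_Integration.integral_cong[OF refl])
    fix x :: "'v \<times> real"
    let ?n = "1 - norm (pole_chart e x)"
    have "e ^ DIM('v) * e\<^sup>2 * ?g (pole_chart e x) = cap_density \<delta> e x"
    proof (cases "pole_chart e x \<in> cball 0 1")
      case True
      have "?n powr \<delta> = (?n / e\<^sup>2) powr \<delta> * (e\<^sup>2) powr \<delta>"
        using True e0 by (simp add: powr_mult[symmetric])
      \<comment> \<open>The scaling balance: Jacobian, density and lam cancel exactly by the choice
        of \<open>beta_exp\<close>; \<open>real DIM('v) + 2\<close> is d + 1.\<close>
      moreover have "lam * e ^ DIM('v) * e\<^sup>2 * (e\<^sup>2) powr \<delta> = 1"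
      proof -
        have "e ^ DIM('v) = e powr real DIM('v)" "e\<^sup>2 = e powr 2"
          using e0 by (simp_all add: powr_realpow)
        moreover have "lam = e powr - (real DIM('v) + 2 + 2 * \<delta>)"
        proof -
          have "real DIM('v) + 2 + 2 * \<delta> > 0" using assms by (simp add: add_nonneg_pos)
          then have "beta_exp (DIM('v) + 1) \<delta> * (real DIM('v) + 2 + 2 * \<delta>) = 1"
            by (simp add: beta_exp_def add.commute)
          then show ?thesis using assms(1) by (simp only: e powr_powr minus_mult_minus) simp
        qed
        ultimately have "lam * e ^ DIM('v) * e\<^sup>2 * (e\<^sup>2) powr \<delta> =
            e powr - (real DIM('v) + 2 + 2 * \<delta>) * e powr real DIM('v) * e powr 2 * (e powr 2) powr \<delta>"
          by (simp only:)
        also have "\<dots> = 1"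
          unfolding powr_powr powr_add[symmetric] using e0 by simp
        finally show ?thesis .
      qed
      moreover have "max 0 (?n / e\<^sup>2) = ?n / e\<^sup>2"
        using True pole_chart_in_cball_iff[OF e0, of x] by simp
      ultimately show ?thesis using True
        by (simp add: cap_density_def algebra_simps)
    next
      case False
      then have "max 0 (?n / e\<^sup>2) = 0" using pole_chart_in_cball_iff[OF e0, of x] by simp
      with False show ?thesis by (simp add: cap_density_def)
    qed
    then show "e ^ DIM('v) * e\<^sup>2 * (?g (pole_chart e x) * indicator A (pole_chart e x)) =
        indicator A (pole_chart e x) * cap_density \<delta> e x"
      by (simp add: algebra_simps)
  qed
  finally show ?thesis .
qed

text \<open>On each vertical line the shear is a translation, so Fubini gives the
  invariance.\<close>

lemma lborel_distr_shear: "distr lborel borel shear = (lborel :: ('v::euclidean_space \<times> real) measure)"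
proof (rule measure_eqI)
  fix A :: "('v \<times> real) set" assume "A \<in> sets (distr lborel borel shear)"
  then have A [measurable]: "A \<in> sets borel" by simp
  have A': "A \<in> sets (lborel \<Otimes>\<^sub>M lborel)" using A unfolding lborel_prod by simp
  have "shear -` A \<in> sets borel" using measurable_sets[OF shear_measurable A] by simp
  then have S: "shear -` A \<in> sets (lborel \<Otimes>\<^sub>M lborel)" unfolding lborel_prod by simp
  have "emeasure (distr lborel borel shear) A = emeasure (lborel \<Otimes>\<^sub>M lborel) (shear -` A)"
    by (subst emeasure_distr) (simp_all add: lborel_prod)
  also have "\<dots> = (\<integral>\<^sup>+w. emeasure lborel (Pair w -` (shear -` A)) \<partial>lborel)"
    by (rule lborel.emeasure_pair_measure_alt[OF S])
  also have "\<dots> = (\<integral>\<^sup>+w. emeasure lborel (Pair w -` A) \<partial>lborel)"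
  proof (rule nn_integral_cong)
    fix w :: 'v
    have m: "Pair w -` A \<in> sets borel" using sets_Pair1[OF A', of w] by simp
    have "emeasure lborel (Pair w -` A) = emeasure (distr lborel borel ((+) ((norm w)\<^sup>2 / 2))) (Pair w -` A)"
      by (simp only: lborel_distr_plus)
    also have "\<dots> = emeasure lborel (((+) ((norm w)\<^sup>2 / 2)) -` (Pair w -` A) \<inter> space lborel)"
      using m by (intro emeasure_distr) auto
    also have "((+) ((norm w)\<^sup>2 / 2)) -` (Pair w -` A) \<inter> space lborel = Pair w -` (shear -` A)"
      by (auto simp: shear_def add.commute)
    finally show "emeasure lborel (Pair w -` (shear -` A)) = emeasure lborel (Pair w -` A)" by simp
  qed
  also have "\<dots> = emeasure lborel A"
    using lborel.emeasure_pair_measure_alt[OF A'] by (simp add: lborel_prod)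
  finally show "emeasure (distr lborel borel shear) A = emeasure lborel A" .
qed simp

lemma measure_halfspace_intensity:
  fixes A :: "('v::euclidean_space \<times> real) set"
  assumes "\<delta> > 0" and A: "A \<in> sets borel"
  shows "measure (halfspace_intensity \<delta>) (shear -` A) =
    (\<integral>x. indicator A x * parabola_density \<delta> x \<partial>lborel)"
proof -
  let ?g = "\<lambda>x :: 'v \<times> real. snd x powr \<delta> * indicator (UNIV \<times> {0..}) x"
  have "(UNIV :: 'v set) \<times> {0 :: real..} \<in> sets borel" by (intro borel_closed closed_Times) auto
  then have gm: "?g \<in> borel_measurable borel"
    by (intro borel_measurable_times borel_measurable_indicator powr_real_measurable
        borel_measurable_continuous_onI continuous_intros)
  have dens: "halfspace_intensity \<delta> = density lborel (\<lambda>x :: 'v \<times> real. ennreal (?g x))"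
    unfolding halfspace_intensity_def
    by (intro arg_cong2[where f = density]) (auto simp: indicator_def)
  have SA: "shear -` A \<in> sets borel" using measurable_sets[OF shear_measurable A] by simp
  have "measure (halfspace_intensity \<delta>) (shear -` A) = (\<integral>x. ?g x * indicator (shear -` A) x \<partial>lborel)"
    unfolding dens using gm SA
    by (intro measure_density_eq_integral) (simp_all add: indicator_def)
  also have "\<dots> = (\<integral>x. indicator A (shear x) * parabola_density \<delta> (shear x) \<partial>lborel)"
  proof (rule Bochner_Integration.integral_cong[OF refl])
    fix x :: "'v \<times> real"
    have "?g x = parabola_density \<delta> (shear x)"
      by (cases x) (auto simp: parabola_density_def shear_def indicator_def max_def)
    then show "?g x * indicator (shear -` A) x = indicator A (shear x) * parabola_density \<delta> (shear x)"
      by (simp add: indicator_def)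
  qed
  also have "\<dots> = (\<integral>x. indicator A x * parabola_density \<delta> x \<partial>distr lborel borel shear)"
    using A by (subst integral_distr) auto
  also have "\<dots> = (\<integral>x. indicator A x * parabola_density \<delta> x \<partial>lborel)"
    unfolding lborel_distr_shear ..
  finally show ?thesis .
qed

lemma cap_height_tendsto:
  "((\<lambda>e. (1 - norm (pole_chart e x)) / e\<^sup>2) \<longlongrightarrow> snd x - (norm (fst x))\<^sup>2 / 2) (at_right 0)"
proof -
  obtain w g where x: "x = (w, g)" by fastforce
  \<comment> \<open>Multiplying by the conjugate \<open>1 + norm (pole_chart e x)\<close> resolves
    the quotient of two vanishing quantities.\<close>
  have eq: "(1 - norm (pole_chart e x)) / e\<^sup>2 =
      (2 * g - (norm w)\<^sup>2 - e\<^sup>2 * g\<^sup>2) / (1 + norm (pole_chart e x))" if "e > 0" for e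
  proof -
    have "(norm (pole_chart e x))\<^sup>2 = e\<^sup>2 * (norm w)\<^sup>2 + (1 - e\<^sup>2 * g)\<^sup>2"
      by (simp add: x pole_chart_def norm_Pair power_mult_distrib)
    then have "(1 - norm (pole_chart e x)) * (1 + norm (pole_chart e x)) =
        e\<^sup>2 * (2 * g - (norm w)\<^sup>2 - e\<^sup>2 * g\<^sup>2)"
      by (simp add: algebra_simps power2_eq_square)
    moreover have "1 + norm (pole_chart e x) > 0" by (simp add: add_pos_nonneg)
    ultimately show ?thesis using that by (simp add: field_simps)
  qed
  have "((\<lambda>e. norm (pole_chart e x)) \<longlongrightarrow> norm (0 *\<^sub>R w, 1 - 0\<^sup>2 * g)) (at_right 0)"
    unfolding x pole_chart_def prod.case by (intro tendsto_intros)
  then have n: "((\<lambda>e. norm (pole_chart e x)) \<longlongrightarrow> 1) (at_right 0)" by (simp add: norm_Pair)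
  have "((\<lambda>e. (2 * g - (norm w)\<^sup>2 - e\<^sup>2 * g\<^sup>2) / (1 + norm (pole_chart e x))) \<longlongrightarrow>
      (2 * g - (norm w)\<^sup>2 - 0\<^sup>2 * g\<^sup>2) / (1 + 1)) (at_right 0)"
    by (intro tendsto_intros n) auto
  moreover have "\<forall>\<^sub>F e in at_right 0. (2 * g - (norm w)\<^sup>2 - e\<^sup>2 * g\<^sup>2) / (1 + norm (pole_chart e x)) =
      (1 - norm (pole_chart e x)) / e\<^sup>2"
    using eventually_at_right_less[of 0] by eventually_elim (simp add: eq)
  ultimately have "((\<lambda>e. (1 - norm (pole_chart e x)) / e\<^sup>2) \<longlongrightarrow>
      (2 * g - (norm w)\<^sup>2 - 0\<^sup>2 * g\<^sup>2) / (1 + 1)) (at_right 0)"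
    by (rule Lim_transform_eventually)
  then show ?thesis by (simp add: x diff_divide_distrib)
qed

lemma cap_density_tendsto:
  assumes "\<delta> > 0"
  shows "((\<lambda>e. cap_density \<delta> e x) \<longlongrightarrow> parabola_density \<delta> x) (at_right 0)"
  unfolding cap_density_def parabola_density_def using assms
  by (intro tendsto_powr' tendsto_max tendsto_const cap_height_tendsto) auto

lemma cap_height_le:
  assumes "e > 0"
  shows "(1 - norm (pole_chart e x)) / e\<^sup>2 \<le> snd x"
proof -
  have "1 - e\<^sup>2 * snd x \<le> norm (snd (pole_chart e x))"
    by (simp add: pole_chart_def case_prod_beta)
  also have "\<dots> \<le> norm (pole_chart e x)" by (rule norm_snd_le')
  finally show ?thesis using assms by (simp add: divide_le_eq mult.commute)
qed

text \<open>Dominated convergence. Strictly above the paraboloid the indicators converge by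
  \<open>conv\<close>; elsewhere the limit density vanishes and \<open>cap_density\<close> tends to
  0, whatever V does.\<close>

lemma cap_density_integral_tendsto:
  fixes V :: "real \<Rightarrow> ('v::euclidean_space \<times> real) set"
  assumes "\<delta> > 0" and e: "filterlim e (at_right 0) at_top" and e0: "\<And>lam. lam > 0 \<Longrightarrow> e lam > 0"
    and V [measurable]: "\<And>lam. V lam \<in> sets borel" and U [measurable]: "U \<in> sets borel"
    and conv: "AE x in lborel. snd x > (norm (fst x))\<^sup>2 / 2 \<longrightarrow>
      (\<forall>\<^sub>F lam in at_top. pole_chart (e lam) x \<in> V lam \<longleftrightarrow> x \<in> U)"
    and box: "\<forall>\<^sub>F lam in at_top. \<forall>x. pole_chart (e lam) x \<in> V lam \<longrightarrow> norm (fst x) \<le> L \<and> snd x \<le> G"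
  shows "((\<lambda>lam. \<integral>x. indicator (V lam) (pole_chart (e lam) x) * cap_density \<delta> (e lam) x \<partial>lborel) \<longlongrightarrow>
    (\<integral>x. indicator U x * parabola_density \<delta> x \<partial>lborel)) at_top"
proof (rule integral_dominated_convergence_at_top)
  let ?box = "cball 0 L \<times> {0..G} :: ('v \<times> real) set"
  \<comment> \<open>By \<open>cap_height_le\<close> the base of the power is at most
    \<open>snd x\<close>, hence at most G on the box.\<close>
  let ?w = "\<lambda>x. \<bar>G\<bar> powr \<delta> * indicator ?box x :: real"
  have "compact ?box" by (intro compact_Times) auto
  then have "emeasure lborel ?box < \<infinity>" using emeasure_compact_finite by blast
  moreover have "?box \<in> sets lborel" using \<open>compact ?box\<close> by (simp add: borel_compact)
  ultimately show "integrable lborel ?w"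
    by (intro integrable_mult_right integrable_real_indicator) auto
  show "(\<lambda>x. indicator U x * parabola_density \<delta> x) \<in> borel_measurable lborel" by measurable
  show "(\<lambda>x. indicator (V lam) (pole_chart (e lam) x) * cap_density \<delta> (e lam) x) \<in> borel_measurable lborel" for lam
    by measurable
  have dens: "((\<lambda>lam. cap_density \<delta> (e lam) x) \<longlongrightarrow> parabola_density \<delta> x) at_top" for x :: "'v \<times> real"
    using filterlim_compose[OF cap_density_tendsto[OF assms(1)] e] .
  show "AE x in lborel. ((\<lambda>lam. indicator (V lam) (pole_chart (e lam) x) * cap_density \<delta> (e lam) x) \<longlongrightarrow>
      indicator U x * parabola_density \<delta> x) at_top"
    using conv
  proof eventually_elim
    case (elim x)
    show ?case
    proof (cases "snd x > (norm (fst x))\<^sup>2 / 2")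
      case True
      with elim have ev: "\<forall>\<^sub>F lam in at_top. pole_chart (e lam) x \<in> V lam \<longleftrightarrow> x \<in> U" by simp
      have "((\<lambda>lam. indicator U x * cap_density \<delta> (e lam) x) \<longlongrightarrow> indicator U x * parabola_density \<delta> x) at_top"
        by (intro tendsto_mult tendsto_const dens)
      then show ?thesis
      proof (rule Lim_transform_eventually)
        show "\<forall>\<^sub>F lam in at_top. indicator U x * cap_density \<delta> (e lam) x =
            indicator (V lam) (pole_chart (e lam) x) * cap_density \<delta> (e lam) x"
          using ev by eventually_elim (simp add: indicator_def)
      qed
    next
      case False
      then have 0: "parabola_density \<delta> x = 0" by (simp add: parabola_density_def max_def)
      have "((\<lambda>lam. indicator (V lam) (pole_chart (e lam) x) * cap_density \<delta> (e lam) x) \<longlongrightarrow> 0) at_top"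
      proof (rule Lim_null_comparison[OF always_eventually])
        show "((\<lambda>lam. cap_density \<delta> (e lam) x) \<longlongrightarrow> 0) at_top" using dens[of x] by (simp add: 0)
        show "\<forall>lam. norm (indicator (V lam) (pole_chart (e lam) x) * cap_density \<delta> (e lam) x) \<le> cap_density \<delta> (e lam) x"
          by (auto simp: indicator_def cap_density_def)
      qed
      then show ?thesis by (simp add: 0)
    qed
  qed
  show "\<forall>\<^sub>F lam in at_top. AE x in lborel.
      norm (indicator (V lam) (pole_chart (e lam) x) * cap_density \<delta> (e lam) x) \<le> ?w x"
    using box eventually_gt_at_top[of 0]
  proof eventually_elim
    case (elim lam)
    have "norm (indicator (V lam) (pole_chart (e lam) x) * cap_density \<delta> (e lam) x) \<le> ?w x" for x
    proof (cases "pole_chart (e lam) x \<in> V lam \<and> 0 < (1 - norm (pole_chart (e lam) x)) / (e lam)\<^sup>2")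
      case True
      have h: "(1 - norm (pole_chart (e lam) x)) / (e lam)\<^sup>2 \<le> snd x"
        by (rule cap_height_le[OF e0[OF elim(2)]])
      have x: "norm (fst x) \<le> L" "snd x \<le> G" using True elim(1) by blast+
      have x0: "0 \<le> snd x" using True h by linarith
      have "cap_density \<delta> (e lam) x \<le> \<bar>G\<bar> powr \<delta>"
        unfolding cap_density_def using True h x x0 assms(1) by (intro powr_mono2) auto
      moreover have "x \<in> ?box" using x x0 by (cases x) auto
      ultimately show ?thesis using True by (simp add: cap_density_def)
    next
      case False
      then have "indicator (V lam) (pole_chart (e lam) x) * cap_density \<delta> (e lam) x = 0"
        by (auto simp: indicator_def cap_density_def max_def)
      then show ?thesis by (simp only: norm_zero) simp
    qed
    then show ?case by simp
  qed
qed

text \<open>The case k = 0 of the Poisson law; local finiteness turns cardinality 0 into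
  emptiness.\<close>

lemma poisson_void:
  assumes P: "poisson_point_process M E \<mu> P" and A: "A \<in> sets borel" "bounded A"
  shows sets_void: "{\<omega> \<in> space M. P \<omega> \<inter> A = {}} \<in> sets M"
    and measure_void: "measure M {\<omega> \<in> space M. P \<omega> \<inter> A = {}} = exp (- measure \<mu> A)"
proof -
  have fin: "finite (P \<omega> \<inter> A)" if "\<omega> \<in> space M" for \<omega>
    using P A that by (simp add: poisson_point_process_def)
  have eq: "{\<omega> \<in> space M. P \<omega> \<inter> A = {}} = {\<omega> \<in> space M. card (P \<omega> \<inter> A) = 0}"
    using fin by auto
  have "(\<lambda>\<omega>. card (P \<omega> \<inter> A)) \<in> measurable M (count_space UNIV)"
    using P A by (simp add: poisson_point_process_def)
  from measurable_sets[OF this, of "{0}"]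
  show "{\<omega> \<in> space M. P \<omega> \<inter> A = {}} \<in> sets M"
    unfolding eq by (simp add: vimage_def Int_def conj_commute)
  have "measure M {\<omega> \<in> space M. card (P \<omega> \<inter> A) = k} = measure \<mu> A ^ k / fact k * exp (- measure \<mu> A)" for k
    using P A by (simp add: poisson_point_process_def)
  from this[of 0] show "measure M {\<omega> \<in> space M. P \<omega> \<inter> A = {}} = exp (- measure \<mu> A)"
    unfolding eq by simp
qed

text \<open>Above height c the density is at least 1 over the whole base, so the mass grows linearly
  in G. Tall cells are therefore hit with probability close to 1.\<close>

lemma parabola_density_cylinder_unbounded:
  "\<exists>G. (\<integral>x. indicator (cball (a :: 'v::euclidean_space) 1 \<times> {0..G}) x * parabola_density \<delta> x \<partial>lborel) \<ge> K"
  if "\<delta> > 0"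
proof -
  define c where "c = (norm a + 1)\<^sup>2 / 2 + 1"
  have c: "c \<ge> 0" by (simp add: c_def)
  define \<alpha> where "\<alpha> = measure lborel (cball a 1)"
  have \<alpha>: "\<alpha> > 0" unfolding \<alpha>_def by (simp add: content_cball_pos)
  define G where "G = c + \<bar>K\<bar> / \<alpha>"
  have G: "G \<ge> c" using \<alpha> by (simp add: G_def)
  let ?B = "cball a 1 \<times> {c..G} :: ('v \<times> real) set"
  let ?f = "\<lambda>x. indicator (cball a 1 \<times> {0..G}) x * parabola_density \<delta> x"
  have "compact (cball a 1 \<times> {0..G})" by (intro compact_Times) auto
  then have C: "cball a 1 \<times> {0..G} \<in> sets lborel" "emeasure lborel (cball a 1 \<times> {0..G}) < \<infinity>"
    using emeasure_compact_finite by (auto simp: borel_compact)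
  have "compact ?B" by (intro compact_Times) auto
  then have B: "?B \<in> sets lborel" "emeasure lborel ?B < \<infinity>"
    using emeasure_compact_finite by (auto simp: borel_compact)
  have "K \<le> \<alpha> * (G - c)" using \<alpha> by (simp add: G_def)
  also have "\<dots> = measure lborel ?B"
  proof -
    have "emeasure (lborel \<Otimes>\<^sub>M lborel) ?B = emeasure lborel (cball a 1) * emeasure lborel {c..G}"
      by (intro lborel.emeasure_pair_measure_Times) auto
    then have "measure lborel ?B = measure lborel (cball a 1) * measure lborel {c..G}"
      by (simp add: lborel_prod measure_def enn2real_mult)
    then show ?thesis using G by (simp add: \<alpha>_def)
  qed
  also have "\<dots> = (\<integral>x. indicator ?B x \<partial>lborel)" by simp
  also have "\<dots> \<le> (\<integral>x. ?f x \<partial>lborel)"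
  proof (rule integral_mono)
    show "integrable lborel (indicator ?B :: _ \<Rightarrow> real)" using B by (intro integrable_real_indicator) auto
    show "integrable lborel ?f"
    proof (rule Bochner_Integration.integrable_bound)
      show "integrable lborel (\<lambda>x. G powr \<delta> * indicator (cball a 1 \<times> {0..G}) x :: real)"
        using C by (intro integrable_mult_right integrable_real_indicator) auto
      show "?f \<in> borel_measurable lborel" using C by measurable
      show "AE x in lborel. norm (?f x) \<le> norm (G powr \<delta> * indicator (cball a 1 \<times> {0..G}) x :: real)"
      proof (rule AE_I2)
        fix x :: "'v \<times> real"
        have "parabola_density \<delta> x \<le> G powr \<delta>" if "x \<in> cball a 1 \<times> {0..G}"
        proof -
          have "snd x \<le> G" "0 \<le> G" "0 \<le> (norm (fst x))\<^sup>2 / 2" using that by (auto simp: mem_Times_iff)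
          then have "max 0 (snd x - (norm (fst x))\<^sup>2 / 2) \<le> G" by linarith
          then show ?thesis unfolding parabola_density_def using \<open>\<delta> > 0\<close>
            by (intro powr_mono2) auto
        qed
        then show "norm (?f x) \<le> norm (G powr \<delta> * indicator (cball a 1 \<times> {0..G}) x :: real)"
          by (simp add: indicator_def parabola_density_def)
      qed
    qed
    fix x :: "'v \<times> real"
    have "1 \<le> ?f x" if x: "x \<in> ?B"
    proof -
      have "norm (fst x) \<le> norm a + 1"
        using x norm_triangle_sub[of "fst x" a] by (auto simp: mem_Times_iff dist_norm norm_minus_commute)
      then have "(norm (fst x))\<^sup>2 / 2 \<le> c - 1" unfolding c_def by (simp add: power_mono)
      then have "1 \<le> snd x - (norm (fst x))\<^sup>2 / 2" using x by (auto simp: mem_Times_iff)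
      then have "1 powr \<delta> \<le> parabola_density \<delta> x"
        unfolding parabola_density_def using \<open>\<delta> > 0\<close> by (intro powr_mono2) auto
      moreover have "x \<in> cball a 1 \<times> {0..G}" using x c by (auto simp: mem_Times_iff)
      ultimately show ?thesis by simp
    qed
    moreover have "0 \<le> ?f x" by (simp add: parabola_density_def)
    ultimately show "indicator ?B x \<le> ?f x" by (cases "x \<in> ?B") (auto simp: indicator_def)
  qed
  finally show ?thesis by blast
qed

section \<open>Support functions and growth processes\<close>

text \<open>One separation principle for all degenerate cases: flat sets lie in a hyperplane,
  boundary points of solid sets have a supporting one, and outside points can be separated.\<close>

lemma supporting_hyperplane_not_interior:
  fixes S :: "'a::euclidean_space set"
  assumes "convex S" "x \<notin> interior S"
  obtains a where "a \<noteq> 0" "\<And>y. y \<in> S \<Longrightarrow> a \<bullet> y \<le> a \<bullet> x"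
proof (cases "S = {}")
  case True
  obtain b :: 'a where "b \<in> Basis" using nonempty_Basis by blast
  then show ?thesis using that[of b] True nonzero_Basis by blast
next
  case False
  show ?thesis
  proof (cases "x \<in> S")
    case True
    show ?thesis
    proof (cases "interior S = {}")
      case True
      with empty_interior_subset_hyperplane[OF assms(1)] obtain a b
        where ab: "a \<noteq> 0" "S \<subseteq> {x. a \<bullet> x = b}" by metis
      have "a \<bullet> y \<le> a \<bullet> x" if "y \<in> S" for y 
        using subsetD[OF ab(2) that] subsetD[OF ab(2) \<open>x \<in> S\<close>] by simp
      then show ?thesis using that ab(1) by blast
    next
      case int: False
      have "x \<notin> rel_interior S" using assms(2) rel_interior_nonempty_interior[OF int] by simp
      from supporting_hyperplane_rel_boundary[OF assms(1) True this]
      obtain a where a: "a \<noteq> 0" "\<And>y. y \<in> S \<Longrightarrow> a \<bullet> x \<le> a \<bullet> y" by metis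
      show ?thesis using that[of "- a"] a by simp
    qed
  next
    case outside: False
    from separating_hyperplane_set_point_inaff[OF assms(1) False outside]
    obtain a b where ab: "a \<noteq> 0" "a \<bullet> x \<le> b" "\<And>y. y \<in> S \<Longrightarrow> a \<bullet> y \<ge> b" by metis
    have "(- a) \<bullet> y \<le> (- a) \<bullet> x" if "y \<in> S" for y using ab(2) ab(3)[OF that] by simp
    then show ?thesis using that[of "- a"] ab(1) by simp
  qed
qed

lemma convex_hull_inner_le:
  assumes "\<And>x. x \<in> X \<Longrightarrow> x \<bullet> u \<le> c" "y \<in> convex hull X"
  shows "y \<bullet> u \<le> c"
proof -
  have "convex hull X \<subseteq> {x. u \<bullet> x \<le> c}"
    using assms(1) by (intro hull_minimal convex_halfspace_le) (auto simp: inner_commute)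
  then show ?thesis using assms(2) by (auto simp: inner_commute)
qed

text \<open>Quantifying over a countable dense set of directions makes the event measurable.\<close>

lemma zero_interior_hull_iff:
  fixes X D :: "'a::euclidean_space set"
  assumes X: "X \<subseteq> cball 0 1"
    and D: "\<And>U. open U \<Longrightarrow> U \<noteq> {} \<Longrightarrow> \<exists>d\<in>D. d \<in> U"
  shows "0 \<in> interior (convex hull X) \<longleftrightarrow>
    (\<exists>k. \<forall>u\<in>D. \<exists>x\<in>X. x \<bullet> u \<ge> norm u / real (Suc k))"
proof
  assume "0 \<in> interior (convex hull X)"
  then obtain r where r: "r > 0" "ball 0 r \<subseteq> convex hull X" by (auto simp: mem_interior)
  obtain k where k: "1 / real (Suc k) < r / 2"
    using reals_Archimedean[of "r/2"] r by (auto simp: inverse_eq_divide)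
  have "\<exists>x\<in>X. x \<bullet> u \<ge> norm u / real (Suc k)" for u
  proof (cases "u = 0")
    case True
    have "0 \<in> ball (0::'a) r" using r(1) by simp
    then have "convex hull X \<noteq> {}" using r(2) by blast
    then have "X \<noteq> {}" by auto
    with True show ?thesis by auto
  next
    case False
    show ?thesis
    proof (rule ccontr)
      assume "\<not> ?thesis"
      then have le: "\<And>x. x \<in> X \<Longrightarrow> x \<bullet> u \<le> norm u / real (Suc k)" by (auto simp: not_le intro: less_imp_le)
      let ?y = "(r / (2 * norm u)) *\<^sub>R u"
      have "norm ?y = r / 2" using False r(1) by simp
      then have "?y \<in> ball 0 r" using r(1) by simp
      then have "?y \<in> convex hull X" using r(2) by blast
      from convex_hull_inner_le[OF le this] have "?y \<bullet> u \<le> norm u / real (Suc k)" .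
      moreover have "?y \<bullet> u = (r / 2) * norm u"
        using False by (simp add: dot_square_norm power2_eq_square)
      ultimately have "(r / 2) * norm u \<le> norm u / real (Suc k)" by (simp only:)
      also have "\<dots> = (1 / real (Suc k)) * norm u" by simp
      finally have "r / 2 \<le> 1 / real (Suc k)"
        by (rule mult_right_le_imp_le) (use False in simp)
      with k show False by simp
    qed
  qed
  then show "\<exists>k. \<forall>u\<in>D. \<exists>x\<in>X. x \<bullet> u \<ge> norm u / real (Suc k)" by blast
next
  assume "\<exists>k. \<forall>u\<in>D. \<exists>x\<in>X. x \<bullet> u \<ge> norm u / real (Suc k)"
  then obtain k where k: "\<And>u. u \<in> D \<Longrightarrow> \<exists>x\<in>X. x \<bullet> u \<ge> norm u / real (Suc k)" by blast
  show "0 \<in> interior (convex hull X)"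
  proof (rule ccontr)
    assume "0 \<notin> interior (convex hull X)"
    from supporting_hyperplane_not_interior[OF convex_convex_hull this]
    obtain a where a: "a \<noteq> 0" "\<And>y. y \<in> convex hull X \<Longrightarrow> a \<bullet> y \<le> 0" by (metis inner_zero_right)
    \<comment> \<open>Chosen so that a dense direction u within \<eta> of the normal a inherits the
      contradiction: the assumption at u gives \<open>norm u \<le> real (Suc k) * \<eta>\<close>,
      and then \<open>norm a < norm a\<close>.\<close>
    define \<eta> where "\<eta> = norm a / (2 * real (Suc k) + 1)"
    have \<eta>: "\<eta> > 0" using a(1) unfolding \<eta>_def by (intro divide_pos_pos) auto
    obtain u where u: "u \<in> D" "u \<in> ball a \<eta>" using D[of "ball a \<eta>"] \<eta> by auto
    then obtain x where x: "x \<in> X" "x \<bullet> u \<ge> norm u / real (Suc k)" using k by blast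
    have "x \<bullet> u = x \<bullet> a + x \<bullet> (u - a)" by (simp add: inner_diff_right)
    also have "x \<bullet> a \<le> 0" using a(2)[of x] hull_subset[of X convex] x(1) by (auto simp: inner_commute)
    also have "x \<bullet> (u - a) \<le> norm x * norm (u - a)" by (rule norm_cauchy_schwarz)
    also have "\<dots> \<le> 1 * \<eta>" using u(2) X x(1) by (intro mult_mono) (auto simp: dist_norm norm_minus_commute)
    finally have "norm u / real (Suc k) \<le> \<eta>" using x(2) by simp
    then have 1: "norm u \<le> real (Suc k) * \<eta>" by (simp add: field_simps)
    have "norm a \<le> norm u + norm (a - u)" using norm_triangle_sub by blast
    also have "norm (a - u) < \<eta>" using u(2) by (simp add: dist_norm)
    finally have "norm a < (real (Suc k) + 1) * \<eta>" using 1 by (simp add: algebra_simps)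
    also have "\<dots> \<le> (2 * real (Suc k) + 1) * \<eta>" using \<eta> by (intro mult_right_mono) auto
    also have "\<dots> = norm a" unfolding \<eta>_def by (simp add: add_nonneg_pos)
    finally show False by simp
  qed
qed

lemma large_coordinate:
  fixes p :: "'a::euclidean_space"
  obtains b where "b \<in> Basis" "\<bar>p \<bullet> b\<bar> \<ge> norm p / real DIM('a)"
proof -
  have "norm p \<le> (\<Sum>b\<in>Basis. \<bar>p \<bullet> b\<bar>)" by (rule norm_le_l1)
  moreover have "(\<Sum>b\<in>Basis. \<bar>p \<bullet> b\<bar>) < (\<Sum>b\<in>(Basis::'a set). norm p / real DIM('a))"
    if "\<And>b. b \<in> Basis \<Longrightarrow> \<bar>p \<bullet> b\<bar> < norm p / real DIM('a)"
    using that by (intro sum_strict_mono) auto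
  ultimately show ?thesis using that by (force simp: not_le)
qed

text \<open>Otherwise some normal a has all of X on its nonpositive side. One coordinate of a has
  modulus at least \<open>norm a / real DIM('a)\<close>, and the hit near half the matching signed
  basis vector lies strictly on the other side: the radius is half of the margin
  \<open>1 / (2 * real DIM('a))\<close>.\<close>

lemma zero_interior_hull_of_hits:
  fixes X :: "'a::euclidean_space set"
  assumes "\<And>b s. b \<in> Basis \<Longrightarrow> s \<in> {-1, 1} \<Longrightarrow> X \<inter> cball ((s / 2) *\<^sub>R b) (1 / (4 * real DIM('a))) \<noteq> {}"
  shows "0 \<in> interior (convex hull X)"
proof (rule ccontr)
  assume "0 \<notin> interior (convex hull X)"
  from supporting_hyperplane_not_interior[OF convex_convex_hull this]
  obtain a where a: "a \<noteq> 0" "\<And>y. y \<in> convex hull X \<Longrightarrow> a \<bullet> y \<le> 0" by (metis inner_zero_right)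
  have n: "real DIM('a) > 0" by simp
  obtain b where b: "b \<in> Basis" "\<bar>a \<bullet> b\<bar> \<ge> norm a / real DIM('a)"
    by (rule large_coordinate)
  define s :: real where "s = (if a \<bullet> b \<ge> 0 then 1 else - 1)"
  have s: "s \<in> {-1, 1}" "s * (a \<bullet> b) = \<bar>a \<bullet> b\<bar>" by (auto simp: s_def)
  obtain x where x: "x \<in> X" "x \<in> cball ((s / 2) *\<^sub>R b) (1 / (4 * real DIM('a)))"
    using assms[OF b(1) s(1)] by blast
  have "norm a / (2 * real DIM('a)) \<le> (s / 2) * (a \<bullet> b)" using b(2) s(2) by simp
  also have "\<dots> = a \<bullet> x + a \<bullet> ((s / 2) *\<^sub>R b - x)" by (simp add: inner_diff_right)
  also have "a \<bullet> x \<le> 0" using a(2)[of x] hull_subset[of X convex] x(1) by auto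
  also have "a \<bullet> ((s / 2) *\<^sub>R b - x) \<le> norm a * norm ((s / 2) *\<^sub>R b - x)" by (rule norm_cauchy_schwarz)
  also have "\<dots> \<le> norm a * (1 / (4 * real DIM('a)))"
    using x(2) by (intro mult_left_mono) (auto simp: dist_norm)
  finally have "norm a / (2 * real DIM('a)) \<le> norm a / (4 * real DIM('a))" by simp
  then show False using a(1) n by (simp add: field_simps)
qed

section \<open>Support functions of finite configurations\<close>

definition rescaled_support :: "real \<Rightarrow> ('v::euclidean_space \<times> real) set \<Rightarrow> 'v \<Rightarrow> real" where
  "rescaled_support e X v = support_defect X (exp_map (e *\<^sub>R v)) / e\<^sup>2"

lemma rescaled_support:
  fixes X :: "('v::euclidean_space \<times> real) set"
  assumes "finite X" "0 \<in> interior (convex hull X)" "e > 0"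
  shows rescaled_support_le: "x \<in> X \<Longrightarrow> rescaled_support e X v \<le> cap_defect e v x"
    and rescaled_support_attained: "\<exists>x\<in>X. rescaled_support e X v = cap_defect e v x"
proof -
  let ?u = "exp_map (e *\<^sub>R v)"
  let ?S = "(\<lambda>x. x \<bullet> ?u) ` X"
  have ne: "X \<noteq> {}" using assms(2) interior_subset by fastforce
  have eq: "rescaled_support e X v = (1 - Sup ?S) / e\<^sup>2"
    unfolding rescaled_support_def support_defect_def Setcompr_eq_image using assms(2) by simp
  have Max: "Sup ?S = Max ?S" using assms(1) ne by (intro cSup_eq_Max) auto
  show "rescaled_support e X v \<le> cap_defect e v x" if "x \<in> X" for x
  proof -
    have "x \<bullet> ?u \<le> Sup ?S" unfolding Max using assms(1) that by (intro Max_ge) auto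
    then show ?thesis unfolding eq cap_defect_def by (intro divide_right_mono) auto
  qed
  have "Max ?S \<in> ?S" using assms(1) ne by (intro Max_in) auto
  then obtain x where "x \<in> X" "Sup ?S = x \<bullet> ?u" unfolding Max by auto
  then show "\<exists>x\<in>X. rescaled_support e X v = cap_defect e v x"
    unfolding eq cap_defect_def by auto
qed

lemma rescaled_support_not_interior:
  "0 \<notin> interior (convex hull X) \<Longrightarrow> rescaled_support e X v = 1 / e\<^sup>2"
  by (simp add: rescaled_support_def support_defect_def)

lemma le_rescaled_support_iff:
  assumes "finite X" "0 \<in> interior (convex hull X)" "e > 0"
  shows "t \<le> rescaled_support e X v \<longleftrightarrow> (\<forall>x\<in>X. t \<le> cap_defect e v x)"
  using rescaled_support[OF assms] by (metis order_trans)

text \<open>Valid for every point of the ball, at the price of a constant that blows up with e; it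
  serves continuity at fixed e.\<close>

lemma cap_defect_lipschitz:
  assumes "y \<in> cball 0 1" "e > 0"
  shows "cap_defect e a y \<le> cap_defect e v y + norm (v - a) / e"
proof -
  have "cap_defect e a y - cap_defect e v y = y \<bullet> (exp_map (e *\<^sub>R v) - exp_map (e *\<^sub>R a)) / e\<^sup>2"
    using assms(2) by (simp add: cap_defect_def inner_diff_right field_simps)
  also have "y \<bullet> (exp_map (e *\<^sub>R v) - exp_map (e *\<^sub>R a)) \<le> norm y * norm (exp_map (e *\<^sub>R v) - exp_map (e *\<^sub>R a))"
    by (rule norm_cauchy_schwarz)
  also have "\<dots> \<le> 1 * norm (e *\<^sub>R v - e *\<^sub>R a)"
    using assms(1) by (intro mult_mono norm_exp_map_diff_le) auto
  also have "\<dots> = e * norm (v - a)" using assms(2) by (simp add: scaleR_diff_right[symmetric])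
  finally have "cap_defect e a y - cap_defect e v y \<le> e * norm (v - a) / e\<^sup>2"
    using assms(2) by (simp add: divide_right_mono)
  then show ?thesis using assms(2) by (simp add: power2_eq_square)
qed

lemma rescaled_support_shift:
  assumes X: "finite X" "X \<subseteq> cball 0 1" and e: "e > 0"
  shows "rescaled_support e X a \<le> rescaled_support e X v + norm (v - a) / e"
proof (cases "0 \<in> interior (convex hull X)")
  case True
  obtain x where x: "x \<in> X" "rescaled_support e X v = cap_defect e v x"
    using rescaled_support_attained[OF X(1) True e] by blast
  have "rescaled_support e X a \<le> cap_defect e a x" by (rule rescaled_support_le[OF X(1) True e x(1)])
  also have "\<dots> \<le> cap_defect e v x + norm (v - a) / e"
    using X x(1) e by (intro cap_defect_lipschitz) auto
  finally show ?thesis using x by simp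
qed (use e in \<open>simp add: rescaled_support_not_interior\<close>)

lemma lipschitz_on_of_shift:
  fixes f :: "'v::real_normed_vector \<Rightarrow> real"
  assumes "\<And>v a. v \<in> B \<Longrightarrow> a \<in> B \<Longrightarrow> f a \<le> f v + C * norm (v - a)" "C \<ge> 0"
  shows "C-lipschitz_on B f"
proof (rule lipschitz_onI[OF _ assms(2)])
  fix v a assume "v \<in> B" "a \<in> B"
  then show "dist (f v) (f a) \<le> C * dist v a"
    using assms(1)[of v a] assms(1)[of a v] by (simp add: dist_real_def dist_norm norm_minus_commute abs_le_iff)
qed

lemma continuous_rescaled_support:
  assumes "finite X" "X \<subseteq> cball 0 1" "e > 0"
  shows "continuous_on B (rescaled_support e X)"
proof (rule lipschitz_on_continuous_on[OF lipschitz_on_of_shift])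
  show "rescaled_support e X a \<le> rescaled_support e X v + (1 / e) * norm (v - a)" for v a
    using rescaled_support_shift[OF assms] by simp
qed (use assms in auto)

lemma rescaled_support_nonneg:
  assumes "finite X" "X \<subseteq> cball 0 1" "e > 0"
  shows "0 \<le> rescaled_support e X v"
proof (cases "0 \<in> interior (convex hull X)")
  case True
  then obtain x where "x \<in> X" "rescaled_support e X v = cap_defect e v x"
    using rescaled_support_attained assms by blast
  then show ?thesis using cap_defect_nonneg[OF subsetD[OF assms(2)], of x e v] by simp
qed (simp add: rescaled_support_not_interior)

text \<open>The vertices of a cross-polytope: every direction has a large inner product with one of
  them, which \<open>corner_direction\<close> makes precise.\<close>

definition corner_points :: "real \<Rightarrow> 'v::euclidean_space set" where
  "corner_points L = (\<lambda>b. L *\<^sub>R b) ` Basis \<union> (\<lambda>b. (- L) *\<^sub>R b) ` Basis"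

lemma corner_points: "finite (corner_points L)" "corner_points L \<noteq> {}"
  "a \<in> corner_points L \<Longrightarrow> norm a = \<bar>L\<bar>"
  using nonempty_Basis by (auto simp: corner_points_def)

text \<open>The cells are given in chart coordinates, so that the same L and G serve every e and the
  limit. Any single hit bounds the support function from above; all hits together bound slopes of
  supporting hyperplanes.\<close>

definition cap_corners :: "real \<Rightarrow> real \<Rightarrow> real \<Rightarrow> ('v::euclidean_space \<times> real) set \<Rightarrow> bool" where
  "cap_corners e L G X \<longleftrightarrow> (\<forall>a\<in>corner_points L. X \<inter> pole_chart e ` (cball a 1 \<times> {0..G}) \<noteq> {})"

definition parabola_corners :: "real \<Rightarrow> real \<Rightarrow> ('v::euclidean_space \<times> real) set \<Rightarrow> bool" where
  "parabola_corners L G X \<longleftrightarrow> (\<forall>a\<in>corner_points L. X \<inter> shear -` (cball a 1 \<times> {0..G}) \<noteq> {})"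

lemma rescaled_support_bound:
  assumes X: "finite X" "0 \<in> interior (convex hull X)" and e: "e > 0"
    and "cap_corners e L G X" "L \<ge> 0" "norm v \<le> R"
  shows "rescaled_support e X v \<le> R\<^sup>2 / 2 + (L + 1) * R + G"
proof -
  obtain a :: 'a where a: "a \<in> corner_points L" using corner_points(2) by blast
  then obtain w g where x: "pole_chart e (w, g) \<in> X" "w \<in> cball a 1" "0 \<le> g" "g \<le> G"
    using assms(4) by (force simp: cap_corners_def)
  have "norm w \<le> norm a + norm (w - a)" using norm_triangle_sub by blast
  also have "\<dots> \<le> L + 1" using corner_points(3)[OF a] assms(5) x(2) by (simp add: dist_norm norm_minus_commute)
  finally have w: "norm w \<le> L + 1" .
  have "rescaled_support e X v \<le> cap_defect e v (pole_chart e (w, g))"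
    by (rule rescaled_support_le[OF X e x(1)])
  also have "\<dots> \<le> R\<^sup>2 / 2 + (L + 1) * R + G"
    by (rule cap_defect_pole_chart_le[OF e assms(6) w x(3,4)])
  finally show ?thesis .
qed

text \<open>On the window \<open>norm (v - a) / 2 \<le> R\<close>, which turns the quadratic modulus
  into a Lipschitz constant. Stated for general f to cover the support and the growth function with
  the same constant.\<close>

lemma lipschitz_of_local_shift:
  fixes f :: "'v::real_normed_vector \<Rightarrow> real"
  assumes "\<And>v a. norm v \<le> R \<Longrightarrow> norm a \<le> R \<Longrightarrow>
      f a \<le> f v + (sqrt (2 * H) + norm (v - a) / 2) * norm (v - a)" and "H \<ge> 0" "R \<ge> 0"
  shows "(sqrt (2 * H) + R)-lipschitz_on (cball 0 R) f"
proof (rule lipschitz_on_of_shift)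
  fix v a :: 'v assume va: "v \<in> cball 0 R" "a \<in> cball 0 R"
  have "norm (v - a) \<le> 2 * R" using norm_triangle_ineq4[of v a] va by simp
  then have "(sqrt (2 * H) + norm (v - a) / 2) * norm (v - a) \<le> (sqrt (2 * H) + R) * norm (v - a)"
    by (intro mult_right_mono) auto
  then show "f a \<le> f v + (sqrt (2 * H) + R) * norm (v - a)"
    using assms(1)[of v a] va by simp
qed (use assms in auto)

text \<open>The point attaining the minimum at v has defect at most H there, so
  \<open>cap_defect_shift\<close> applies to it, and this point also bounds the minimum at
  a.\<close>

lemma rescaled_support_lipschitz:
  assumes X: "finite X" "0 \<in> interior (convex hull X)" "X \<subseteq> cball 0 1" and e: "e > 0"
    and corners: "cap_corners e L G X" "L \<ge> 0" and R: "R \<ge> 0"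
    and H: "H = R\<^sup>2 / 2 + (L + 1) * R + G"
  shows "(sqrt (2 * H) + R)-lipschitz_on (cball 0 R) (rescaled_support e X)"
proof (rule lipschitz_of_local_shift[OF _ _ R])
  show "H \<ge> 0"
    using rescaled_support_bound[OF X(1,2) e corners, of 0 R] rescaled_support_nonneg[OF X(1,3) e, of 0] R H
    by simp
  fix v a :: 'a assume v: "norm v \<le> R" and a: "norm a \<le> R"
  obtain x where x: "x \<in> X" "rescaled_support e X v = cap_defect e v x"
    using rescaled_support_attained[OF X(1,2) e] by blast
  have "cap_defect e v x \<le> H"
    using rescaled_support_bound[OF X(1,2) e corners v] x(2) H by simp
  then have "cap_defect e a x \<le> cap_defect e v x + (sqrt (2 * H) + norm (v - a) / 2) * norm (v - a)"
    using X(3) x(1) e by (intro cap_defect_shift) auto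
  then show "rescaled_support e X a \<le> rescaled_support e X v + (sqrt (2 * H) + norm (v - a) / 2) * norm (v - a)"
    using rescaled_support_le[OF X(1,2) e x(1), of a] x(2) by simp
qed

text \<open>The limit of \<open>cap_defect\<close> in the chart. It is affine in x, which is the
  gain from shearing.\<close>

definition parabola_defect :: "'v::euclidean_space \<Rightarrow> 'v \<times> real \<Rightarrow> real" where
  "parabola_defect v x = snd x - fst x \<bullet> v + (norm v)\<^sup>2 / 2"

lemma parabola_defect_shear: "parabola_defect v (shear (w, h)) = h + (norm (v - w))\<^sup>2 / 2"
  by (simp add: parabola_defect_def shear_def power2_norm_eq_inner inner_diff_left inner_diff_right
      inner_commute field_simps)

definition growth :: "('v::euclidean_space \<times> real) set \<Rightarrow> 'v \<Rightarrow> real" where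
  "growth X = lower_boundary (paraboloid_growth X)"

lemma growth_eq: "growth X v = Inf (\<Union>x\<in>X. {parabola_defect v (shear x)..})"
proof -
  have "{h. (v, h) \<in> paraboloid_growth X} = (\<Union>x\<in>X. {parabola_defect v (shear x)..})"
  proof (intro equalityI subsetI)
    fix h assume "h \<in> {h. (v, h) \<in> paraboloid_growth X}"
    then obtain w h0 where "(w, h0) \<in> X" "h - h0 \<ge> (norm (v - w))\<^sup>2 / 2"
      by (force simp: paraboloid_growth_def up_paraboloid_def)
    then have "h \<in> {parabola_defect v (shear (w, h0))..}" by (simp add: parabola_defect_shear)
    with \<open>(w, h0) \<in> X\<close> show "h \<in> (\<Union>x\<in>X. {parabola_defect v (shear x)..})" by blast
  next
    fix h assume "h \<in> (\<Union>x\<in>X. {parabola_defect v (shear x)..})"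
    then obtain w h0 where x: "(w, h0) \<in> X" "h \<ge> parabola_defect v (shear (w, h0))" by force
    then have "(v - w, h - h0) \<in> up_paraboloid"
      by (simp add: up_paraboloid_def parabola_defect_shear) (smt (verit) zero_le_power2 divide_nonneg_pos)
    moreover have "(v, h) = (w, h0) + (v - w, h - h0)" by simp
    ultimately show "h \<in> {h. (v, h) \<in> paraboloid_growth X}"
      using x(1) unfolding paraboloid_growth_def by blast
  qed
  then show ?thesis by (simp add: growth_def lower_boundary_def)
qed

text \<open>Within the half-space the sublevel sets of the defect are bounded, hence contain
  finitely many points, and the infimum over X is a minimum.\<close>

lemma growth:
  fixes X :: "('v::euclidean_space \<times> real) set"
  assumes X: "X \<subseteq> UNIV \<times> {0..}" "X \<noteq> {}" "\<And>A. bounded A \<Longrightarrow> finite (X \<inter> A)"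
  shows growth_le: "x \<in> X \<Longrightarrow> growth X v \<le> parabola_defect v (shear x)"
    and growth_attained: "\<exists>x\<in>X. growth X v = parabola_defect v (shear x)"
proof -
  let ?p = "\<lambda>x. parabola_defect v (shear x)"
  have p0: "?p x \<ge> 0" if "x \<in> X" for x
    using X(1) that by (cases x) (auto simp: parabola_defect_shear)
  obtain x0 where x0: "x0 \<in> X" using X(2) by blast
  define F where "F = {x \<in> X. ?p x \<le> ?p x0}"
  have "F = X \<inter> {x \<in> UNIV \<times> {0..}. ?p x \<le> ?p x0}" using X(1) by (auto simp: F_def)
  moreover have "bounded {x \<in> UNIV \<times> {0..}. ?p x \<le> ?p x0}"
  proof (rule bounded_subset)
    let ?m = "?p x0"
    show "bounded (cball v (sqrt (2 * ?m)) \<times> cball 0 ?m)" by (intro bounded_Times) auto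
    show "{x \<in> UNIV \<times> {0..}. ?p x \<le> ?p x0} \<subseteq> cball v (sqrt (2 * ?m)) \<times> cball 0 ?m"
    proof
      fix x assume "x \<in> {x \<in> UNIV \<times> {0..}. ?p x \<le> ?m}"
      then obtain w h where x: "x = (w, h)" "h \<ge> 0" "h + (norm (v - w))\<^sup>2 / 2 \<le> ?m"
        by (cases x) (auto simp: parabola_defect_shear)
      have "(norm (v - w))\<^sup>2 \<le> 2 * ?m" using x(2,3) by linarith
      then have "norm (v - w) \<le> sqrt (2 * ?m)" by (rule real_le_rsqrt)
      moreover have "h \<le> ?m" using x(3) zero_le_power2[of "norm (v - w)"] by linarith
      ultimately show "x \<in> cball v (sqrt (2 * ?m)) \<times> cball 0 ?m"
        using x by (simp add: dist_norm)
    qed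
  qed
  ultimately have F: "finite F" "F \<noteq> {}" using X(3) x0 by (auto simp: F_def)
  have "Min (?p ` F) \<in> ?p ` F" using F by (intro Min_in) auto
  then obtain x1 where x1: "x1 \<in> F" "?p x1 = Min (?p ` F)" by auto
  have min: "?p x1 \<le> ?p x" if "x \<in> X" for x
  proof (cases "x \<in> F")
    case True
    then show ?thesis unfolding x1(2) using F by (intro Min_le) auto
  next
    case False
    then have "?p x0 \<le> ?p x" using that by (auto simp: F_def)
    moreover have "?p x1 \<le> ?p x0" using x1(1) by (simp add: F_def)
    ultimately show ?thesis by linarith
  qed
  have x1X: "x1 \<in> X" using x1(1) by (simp add: F_def)
  have "growth X v = ?p x1"
    unfolding growth_eq
  proof (rule cInf_eq_minimum)
    show "?p x1 \<in> (\<Union>x\<in>X. {?p x..})" using x1X by auto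
    show "?p x1 \<le> h" if "h \<in> (\<Union>x\<in>X. {?p x..})" for h using that min by force
  qed
  then show "\<exists>x\<in>X. growth X v = ?p x" "x \<in> X \<Longrightarrow> growth X v \<le> ?p x" using x1X min by auto
qed

lemma le_growth_iff:
  assumes "X \<subseteq> UNIV \<times> {0..}" "X \<noteq> {}" "\<And>A. bounded A \<Longrightarrow> finite (X \<inter> A)"
  shows "t \<le> growth X v \<longleftrightarrow> (\<forall>x\<in>X. t \<le> parabola_defect v (shear x))"
  using growth[OF assms] by (metis order_trans)

lemma growth_nonneg:
  assumes "X \<subseteq> UNIV \<times> {0..}" "X \<noteq> {}" "\<And>A. bounded A \<Longrightarrow> finite (X \<inter> A)"
  shows "0 \<le> growth X v"
proof -
  have "\<forall>x\<in>X. 0 \<le> parabola_defect v (shear x)"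
  proof
    fix x assume "x \<in> X"
    moreover obtain w h where "x = (w, h)" by fastforce
    ultimately show "0 \<le> parabola_defect v (shear x)" using assms(1) by (auto simp: parabola_defect_shear)
  qed
  then show ?thesis using le_growth_iff[OF assms(1,2), of 0 v] assms(3) by blast
qed

lemma parabola_corners_nonempty: "parabola_corners L G X \<Longrightarrow> X \<noteq> {}"
  using corner_points(2) by (fastforce simp: parabola_corners_def)

lemma growth_bound:
  assumes X: "X \<subseteq> UNIV \<times> {0..}" "\<And>A. bounded A \<Longrightarrow> finite (X \<inter> A)"
    and corners: "parabola_corners L G X" "L \<ge> 0" and "norm v \<le> R"
  shows "growth X v \<le> R\<^sup>2 / 2 + (L + 1) * R + G"
proof -
  have ne: "X \<noteq> {}" by (rule parabola_corners_nonempty[OF corners(1)])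
  obtain a :: 'a where a: "a \<in> corner_points L" using corner_points(2) by blast
  then obtain x w g where x: "x \<in> X" "shear x = (w, g)" "w \<in> cball a 1" "0 \<le> g" "g \<le> G"
    using corners(1) by (force simp: parabola_corners_def)
  have "norm w \<le> norm a + norm (w - a)" using norm_triangle_sub by blast
  also have "\<dots> \<le> L + 1" using corner_points(3)[OF a] corners(2) x(3) by (simp add: dist_norm norm_minus_commute)
  finally have w: "norm w \<le> L + 1" .
  have R: "R \<ge> 0" using assms(5) norm_ge_zero order_trans by blast
  have "growth X v \<le> g - w \<bullet> v + (norm v)\<^sup>2 / 2"
    using growth_le[OF X(1) ne X(2) x(1), of v] by (simp add: x(2) parabola_defect_def)
  moreover have "- (w \<bullet> v) \<le> norm w * norm v" using Cauchy_Schwarz_ineq2[of w v] by linarith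
  moreover have "norm w * norm v \<le> (L + 1) * R" using w assms(5) R corners(2) by (intro mult_mono) auto
  moreover have "(norm v)\<^sup>2 / 2 \<le> R\<^sup>2 / 2" using assms(5) by (simp add: power_mono)
  ultimately show ?thesis using x(5) by linarith
qed

lemma parabola_defect_shift:
  assumes "h \<ge> 0" "parabola_defect v (shear (w, h)) \<le> H"
  shows "parabola_defect a (shear (w, h)) \<le>
    parabola_defect v (shear (w, h)) + (sqrt (2 * H) + norm (v - a) / 2) * norm (v - a)"
proof -
  have "(norm (v - w))\<^sup>2 \<le> 2 * H" using assms by (simp add: parabola_defect_shear)
  then have vw: "norm (v - w) \<le> sqrt (2 * H)" by (rule real_le_rsqrt)
  have "norm (a - w) \<le> norm (v - w) + norm (v - a)"
    using norm_triangle_ineq[of "v - w" "a - v"] by (simp add: norm_minus_commute)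
  then have "(norm (a - w))\<^sup>2 \<le> (norm (v - w) + norm (v - a))\<^sup>2" by (intro power_mono) auto
  also have "\<dots> = (norm (v - w))\<^sup>2 + 2 * (norm (v - w) * norm (v - a)) + norm (v - a) * norm (v - a)"
    by (simp add: power2_eq_square algebra_simps)
  also have "norm (v - w) * norm (v - a) \<le> sqrt (2 * H) * norm (v - a)"
    using vw by (intro mult_right_mono) auto
  finally show ?thesis by (simp add: parabola_defect_shear algebra_simps)
qed

lemma growth_lipschitz:
  fixes X :: "('v::euclidean_space \<times> real) set"
  assumes X: "X \<subseteq> UNIV \<times> {0..}" "\<And>A. bounded A \<Longrightarrow> finite (X \<inter> A)"
    and corners: "parabola_corners L G X" "L \<ge> 0" and R: "R \<ge> 0"
    and H: "H = R\<^sup>2 / 2 + (L + 1) * R + G"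
  shows "(sqrt (2 * H) + R)-lipschitz_on (cball 0 R) (growth X)"
proof -
  have ne: "X \<noteq> {}" by (rule parabola_corners_nonempty[OF corners(1)])
  show ?thesis
  proof (rule lipschitz_of_local_shift[OF _ _ R])
    show "H \<ge> 0"
      using growth_bound[OF X corners, of 0 R] growth_nonneg[OF X(1) ne X(2), of 0] R H by simp
    fix v a :: 'v assume v: "norm v \<le> R" and a: "norm a \<le> R"
    obtain w h where x: "(w, h) \<in> X" "growth X v = parabola_defect v (shear (w, h))"
      using growth_attained[OF X(1) ne X(2)] by force
    have "parabola_defect v (shear (w, h)) \<le> H"
      using growth_bound[OF X corners v] x(2) H by simp
    then have "parabola_defect a (shear (w, h)) \<le>
        parabola_defect v (shear (w, h)) + (sqrt (2 * H) + norm (v - a) / 2) * norm (v - a)"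
      using X(1) x(1) by (intro parabola_defect_shift) auto
    then show "growth X a \<le> growth X v + (sqrt (2 * H) + norm (v - a) / 2) * norm (v - a)"
      using growth_le[OF X(1) ne X(2) x(1), of a] x(2) by simp
  qed
qed

text \<open>Level sets are hyperplanes, hence null. Off them a strict comparison of the defect with
  t is eventually the same before and in the limit, as \<open>cap_density_integral_tendsto\<close>
  demands.\<close>

lemma AE_parabola_defect_neq: "AE x in lborel. parabola_defect v x \<noteq> t"
proof -
  let ?S = "{x. (- v, 1 :: real) \<bullet> x = t - (norm v)\<^sup>2 / 2}"
  have "negligible ?S" by (rule negligible_hyperplane) (simp add: zero_prod_def)
  moreover have "?S \<in> sets lborel" using closed_hyperplane[of "(- v, 1 :: real)"] by simp
  ultimately have "?S \<in> null_sets lborel"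
    by (simp add: negligible_iff_null_sets null_sets_completion_iff)
  then have "AE x in lborel. x \<notin> ?S" by (rule AE_not_in)
  then show ?thesis
    by eventually_elim (auto simp: parabola_defect_def inner_prod_def inner_commute)
qed

section \<open>Poisson polytopes\<close>

lemma bounded_shear_vimage:
  fixes U :: "('v::euclidean_space \<times> real) set"
  assumes "bounded U"
  shows "bounded (shear -` U)"
proof -
  obtain B where B: "\<And>x. x \<in> U \<Longrightarrow> norm x \<le> B" using assms by (auto simp: bounded_iff)
  have "shear -` U \<subseteq> cball 0 B \<times> cball 0 (B + B\<^sup>2 / 2)"
  proof
    fix x assume "x \<in> shear -` U"
    moreover obtain w h where x: "x = (w, h)" by fastforce
    ultimately have n: "norm (w, h + (norm w)\<^sup>2 / 2) \<le> B" using B by (simp add: shear_def)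
    have w: "norm w \<le> B" using norm_fst_le'[of "(w, h + (norm w)\<^sup>2 / 2)"] n by simp
    have "\<bar>h + (norm w)\<^sup>2 / 2\<bar> \<le> B" using norm_snd_le'[of "(w, h + (norm w)\<^sup>2 / 2)"] n by simp
    moreover have "(norm w)\<^sup>2 \<le> B\<^sup>2" using w by (intro power_mono) auto
    moreover have "0 \<le> (norm w)\<^sup>2" by simp
    ultimately have "\<bar>h\<bar> \<le> B + B\<^sup>2 / 2" unfolding abs_le_iff by linarith
    with w show "x \<in> cball 0 B \<times> cball 0 (B + B\<^sup>2 / 2)" by (simp add: x)
  qed
  then show ?thesis by (rule bounded_subset[rotated]) (intro bounded_Times bounded_cball)
qed

lemma (in prob_space) prob_avoid_all:
  assumes "finite I" "\<And>i. i \<in> I \<Longrightarrow> V i \<in> events" "\<And>i. i \<in> I \<Longrightarrow> prob (V i) \<le> \<eta>"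
  shows "prob (space M - (\<Union>i\<in>I. V i)) \<ge> 1 - real (card I) * \<eta>"
proof -
  have "prob (\<Union>i\<in>I. V i) \<le> (\<Sum>i\<in>I. prob (V i))"
    using assms by (intro finite_measure_subadditive_finite) auto
  also have "\<dots> \<le> (\<Sum>i\<in>I. \<eta>)" using assms(3) by (intro sum_mono)
  finally have "prob (\<Union>i\<in>I. V i) \<le> real (card I) * \<eta>" by simp
  moreover have "prob (space M - (\<Union>i\<in>I. V i)) = 1 - prob (\<Union>i\<in>I. V i)"
    using assms by (intro prob_compl sets.finite_UN) auto
  ultimately show ?thesis by simp
qed

lemma (in prob_space) prob_Int_ge:
  assumes "A \<in> events" "B \<in> events" "prob A \<ge> 1 - a" "prob B \<ge> 1 - b"
  shows "prob (A \<inter> B) \<ge> 1 - (a + b)"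
proof -
  have "prob (A \<union> B) = prob A + prob B - prob (A \<inter> B)"
    using finite_measure_Union'[OF assms(1,2)] finite_measure_Diff'[OF assms(2,1)] by (simp add: Int_commute)
  then show ?thesis using prob_le_1[of "A \<union> B"] assms by linarith
qed

text \<open>The ball stays within norm 3/4, where the density is at least
  \<open>lam * (1 / 4) powr \<delta>\<close>. Fixed interior balls are thus missed with
  exponentially small probability.\<close>

lemma ball_intensity_interior_ball:
  fixes c :: "'a::euclidean_space"
  assumes "lam > 0" "\<delta> > 0" "norm c \<le> 1 / 2" "0 < r" "r \<le> 1 / 4"
  shows "measure (ball_intensity \<delta> lam) (cball c r) \<ge> lam * ((1 / 4) powr \<delta> * measure lborel (cball c r))"
proof -
  let ?g = "\<lambda>x :: 'a. lam * (1 - norm x) powr \<delta> * indicator (cball 0 1) x"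
  have fin: "emeasure lborel (cball c r) < \<infinity>" using emeasure_compact_finite[OF compact_cball] .
  have "lam * ((1 / 4) powr \<delta> * measure lborel (cball c r)) =
      (\<integral>x. lam * (1 / 4) powr \<delta> * indicator (cball c r) x \<partial>lborel)" by simp
  also have "\<dots> \<le> (\<integral>x. ?g x * indicator (cball c r) x \<partial>lborel)"
  proof (rule integral_mono)
    show "integrable lborel (\<lambda>x. lam * (1 / 4) powr \<delta> * indicator (cball c r) x :: real)"
      using fin by (intro integrable_mult_right integrable_real_indicator) auto
    show "integrable lborel (\<lambda>x. ?g x * indicator (cball c r) x)"
    proof (rule Bochner_Integration.integrable_bound)
      show "integrable lborel (\<lambda>x. lam * indicator (cball c r) x :: real)"
        using fin by (intro integrable_mult_right integrable_real_indicator) auto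
      show "(\<lambda>x. ?g x * indicator (cball c r) x) \<in> borel_measurable lborel"
        using ball_density_measurable by (intro borel_measurable_times borel_measurable_indicator) auto
      have "(1 - norm x) powr \<delta> \<le> 1" if "norm x \<le> 1" for x :: 'a
        using that assms(2) powr_mono2[of \<delta> "1 - norm x" 1] by simp
      then show "AE x in lborel. norm (?g x * indicator (cball c r) x) \<le> norm (lam * indicator (cball c r) x :: real)"
        using assms(1) by (intro AE_I2) (auto simp: indicator_def abs_mult)
    qed
    fix x :: 'a
    show "lam * (1 / 4) powr \<delta> * indicator (cball c r) x \<le> ?g x * indicator (cball c r) x"
    proof (cases "x \<in> cball c r")
      case True
      have "norm x \<le> norm c + norm (x - c)" using norm_triangle_sub by blast
      also have "\<dots> \<le> 3 / 4" using True assms by (simp add: dist_norm norm_minus_commute)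
      finally have x: "norm x \<le> 3 / 4" .
      then have "(1 / 4) powr \<delta> \<le> (1 - norm x) powr \<delta>" using assms(2) by (intro powr_mono2) auto
      then show ?thesis using True x assms(1) by (simp add: mult_left_mono)
    qed simp
  qed
  also have "\<dots> = measure (ball_intensity \<delta> lam) (cball c r)"
    by (rule measure_ball_intensity_eq[OF assms(1), symmetric]) simp
  finally show ?thesis .
qed

lemma open_cap: "open {y. cap_defect e v y < t}"
  unfolding cap_defect_def divide_inverse by (intro open_Collect_less continuous_intros)

lemma open_parabola: "open {x. parabola_defect v x < t}"
  unfolding parabola_defect_def by (intro open_Collect_less continuous_intros) auto

lemma closed_parabola: "closed {x :: 'v::euclidean_space \<times> real. (norm (fst x))\<^sup>2 / 2 \<le> snd x}"
  by (intro closed_Collect_le continuous_intros) auto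

text \<open>Completing the square: above the paraboloid the defect is at least
  \<open>(norm (v - w))\<^sup>2 / 2\<close>, which confines w and then g. Void probabilities are
  available only for bounded sets.\<close>

lemma bounded_parabola_sublevel:
  "bounded {x :: 'v::euclidean_space \<times> real. (norm (fst x))\<^sup>2 / 2 \<le> snd x \<and> parabola_defect v x < t}"
proof (rule bounded_subset)
  define B where "B = norm v + sqrt (2 * t)"
  show "bounded (cball (0 :: 'v) B \<times> cball (0 :: real) (t + B * norm v))"
    by (intro bounded_Times bounded_cball)
  show "{x. (norm (fst x))\<^sup>2 / 2 \<le> snd x \<and> parabola_defect v x < t} \<subseteq> cball 0 B \<times> cball 0 (t + B * norm v)"
  proof
    fix x :: "'v \<times> real" assume x: "x \<in> {x. (norm (fst x))\<^sup>2 / 2 \<le> snd x \<and> parabola_defect v x < t}"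
    obtain w g where wg: "x = (w, g)" by fastforce
    have "g - w \<bullet> v + (norm v)\<^sup>2 / 2 < t" "(norm w)\<^sup>2 / 2 \<le> g"
      using x by (auto simp: wg parabola_defect_def)
    moreover have "(norm (v - w))\<^sup>2 = (norm v)\<^sup>2 - 2 * (w \<bullet> v) + (norm w)\<^sup>2"
      by (simp add: power2_norm_eq_inner inner_diff_left inner_diff_right inner_commute)
    ultimately have "(norm (v - w))\<^sup>2 \<le> 2 * t" by linarith
    then have "norm (v - w) \<le> sqrt (2 * t)" by (rule real_le_rsqrt)
    moreover have "norm w \<le> norm v + norm (v - w)"
      using norm_triangle_sub[of w v] by (simp add: norm_minus_commute)
    ultimately have w: "norm w \<le> B" by (simp add: B_def)
    have "0 \<le> (norm w)\<^sup>2 / 2" by simp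
    then have g: "0 \<le> g" using \<open>(norm w)\<^sup>2 / 2 \<le> g\<close> by linarith
    have "w \<bullet> v \<le> norm w * norm v" by (rule norm_cauchy_schwarz)
    also have "\<dots> \<le> B * norm v" using w by (intro mult_right_mono) auto
    finally have "g \<le> t + B * norm v"
      using \<open>g - w \<bullet> v + (norm v)\<^sup>2 / 2 < t\<close> zero_le_power2[of "norm v"] by linarith
    with w g show "x \<in> cball 0 B \<times> cball 0 (t + B * norm v)" by (simp add: wg)
  qed
qed

lemma lipschitz_on_restrict [simp]: "C-lipschitz_on B (restrict f B) \<longleftrightarrow> C-lipschitz_on B f"
  by (simp add: lipschitz_on_def)

section \<open>The two point processes and their void probabilities\<close>

locale poisson_polytopes =
  fixes d :: nat and \<delta> :: real
    and M :: "real \<Rightarrow> 'w measure" and P :: "real \<Rightarrow> 'w \<Rightarrow> ('v::euclidean_space \<times> real) set"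
    and N :: "'z measure" and Q :: "'z \<Rightarrow> ('v \<times> real) set"
  assumes d: "d = DIM('v) + 1" and \<delta>: "\<delta> > 0"
    and P: "\<And>lam. lam > 0 \<Longrightarrow>
           poisson_point_process (M lam) (cball 0 1) (ball_intensity \<delta> lam) (P lam)"
    and Q: "poisson_point_process N (UNIV \<times> {0..}) (halfspace_intensity \<delta>) Q"
begin

definition chart_scale :: "real \<Rightarrow> real" where
  "chart_scale lam = lam powr - beta_exp d \<delta>"

lemma beta_pos: "beta_exp d \<delta> > 0"
  using \<delta> by (simp add: beta_exp_def add_nonneg_pos)

lemma chart_scale_pos: "lam > 0 \<Longrightarrow> chart_scale lam > 0"
  by (simp add: chart_scale_def)

lemma chart_scale_tendsto: "filterlim chart_scale (at_right 0) at_top"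
proof (rule tendsto_imp_filterlim_at_right)
  show "(chart_scale \<longlongrightarrow> 0) at_top"
    unfolding chart_scale_def using beta_pos by (intro tendsto_neg_powr filterlim_ident) auto
  show "\<forall>\<^sub>F lam in at_top. 0 < chart_scale lam"
    by (rule eventually_mono[OF eventually_gt_at_top[of 0] chart_scale_pos])
qed

lemma eventually_chart_scale:
  assumes "\<forall>\<^sub>F e in at_right 0. A e"
  shows "\<forall>\<^sub>F lam in at_top. A (chart_scale lam)"
  using eventually_compose_filterlim[OF assms chart_scale_tendsto] .

lemma rescale_eq:
  assumes "lam > 0"
  shows "rescale d \<delta> lam f v = f (exp_map (chart_scale lam *\<^sub>R v)) / (chart_scale lam)\<^sup>2"
proof -
  have "(chart_scale lam)\<^sup>2 = lam powr - gamma_exp d \<delta>"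
    using assms by (simp add: chart_scale_def gamma_exp_def powr_powr powr_power)
  then have "lam powr gamma_exp d \<delta> = 1 / (chart_scale lam)\<^sup>2" using assms by (simp add: powr_minus_divide)
  then show ?thesis unfolding rescale_def chart_scale_def[symmetric] by simp
qed

lemma prob_M: "lam > 0 \<Longrightarrow> prob_space (M lam)" and prob_N: "prob_space N"
  using P Q by (auto simp: poisson_point_process_def)

lemma P_subset: "lam > 0 \<Longrightarrow> \<omega> \<in> space (M lam) \<Longrightarrow> P lam \<omega> \<subseteq> cball 0 1"
  using P by (auto simp: poisson_point_process_def)

lemma P_finite:
  assumes "lam > 0" "\<omega> \<in> space (M lam)"
  shows "finite (P lam \<omega>)"
proof -
  have "finite (P lam \<omega> \<inter> cball 0 1)" using P[OF assms(1)] assms(2) by (auto simp: poisson_point_process_def)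
  then show ?thesis using P_subset[OF assms] by (simp add: Int_absorb2)
qed

lemma Q_subset: "\<omega> \<in> space N \<Longrightarrow> Q \<omega> \<subseteq> UNIV \<times> {0..}"
  and Q_finite: "\<omega> \<in> space N \<Longrightarrow> bounded A \<Longrightarrow> finite (Q \<omega> \<inter> A)"
  using Q by (auto simp: poisson_point_process_def)

lemma sets_P_void:
  assumes "lam > 0" "A \<in> sets borel"
  shows "{\<omega> \<in> space (M lam). P lam \<omega> \<inter> A = {}} \<in> sets (M lam)"
proof -
  have "{\<omega> \<in> space (M lam). P lam \<omega> \<inter> (A \<inter> cball 0 1) = {}} \<in> sets (M lam)"
    using assms by (intro sets_void[OF P]) (auto intro: bounded_Int)
  moreover have "{\<omega> \<in> space (M lam). P lam \<omega> \<inter> (A \<inter> cball 0 1) = {}} = {\<omega> \<in> space (M lam). P lam \<omega> \<inter> A = {}}"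
    using P_subset[OF assms(1)] by blast
  ultimately show ?thesis by simp
qed

lemma sets_Q_void: "A \<in> sets borel \<Longrightarrow> bounded A \<Longrightarrow> {\<omega> \<in> space N. Q \<omega> \<inter> A = {}} \<in> sets N"
  by (rule sets_void[OF Q])

text \<open>Every comparison of P with Q passes through this limit: both sides are exponentials of
  minus an intensity, and the intensities converge.\<close>

lemma void_probability_tendsto:
  assumes V: "\<And>lam. V lam \<in> sets borel" "\<And>lam. V lam \<subseteq> cball 0 1" and U: "U \<in> sets borel" "bounded U"
    and conv: "AE x in lborel. snd x > (norm (fst x))\<^sup>2 / 2 \<longrightarrow>
      (\<forall>\<^sub>F lam in at_top. pole_chart (chart_scale lam) x \<in> V lam \<longleftrightarrow> x \<in> U)"
    and box: "\<forall>\<^sub>F lam in at_top. \<forall>x. pole_chart (chart_scale lam) x \<in> V lam \<longrightarrow> norm (fst x) \<le> L \<and> snd x \<le> G"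
  shows "((\<lambda>lam. measure (M lam) {\<omega> \<in> space (M lam). P lam \<omega> \<inter> V lam = {}}) \<longlongrightarrow>
    measure N {\<omega> \<in> space N. Q \<omega> \<inter> shear -` U = {}}) at_top"
proof -
  have "measure N {\<omega> \<in> space N. Q \<omega> \<inter> shear -` U = {}} =
      exp (- (\<integral>x. indicator U x * parabola_density \<delta> x \<partial>lborel))"
    using measure_void[OF Q _ bounded_shear_vimage[OF U(2)]] measurable_sets[OF shear_measurable U(1)]
    by (simp add: measure_halfspace_intensity[OF \<delta> U(1)])
  moreover have "((\<lambda>lam. exp (- (\<integral>x. indicator (V lam) (pole_chart (chart_scale lam) x) * cap_density \<delta> (chart_scale lam) x \<partial>lborel)))
      \<longlongrightarrow> exp (- (\<integral>x. indicator U x * parabola_density \<delta> x \<partial>lborel))) at_top"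
    by (intro tendsto_intros cap_density_integral_tendsto[OF \<delta> chart_scale_tendsto chart_scale_pos V(1) U(1) conv box])
  moreover have "\<forall>\<^sub>F lam in at_top. exp (- (\<integral>x. indicator (V lam) (pole_chart (chart_scale lam) x) * cap_density \<delta> (chart_scale lam) x \<partial>lborel))
      = measure (M lam) {\<omega> \<in> space (M lam). P lam \<omega> \<inter> V lam = {}}"
    using eventually_gt_at_top[of 0]
  proof eventually_elim
    case (elim lam)
    have "bounded (V lam)" using V(2) bounded_cball bounded_subset by blast
    note void = measure_void[OF P[OF elim] V(1) this]
    have "chart_scale lam = lam powr - beta_exp (DIM('v) + 1) \<delta>" unfolding d[symmetric] by (rule chart_scale_def)
    from measure_ball_intensity[OF elim \<delta> V(1)[of lam] this] show ?case using void by simp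
  qed
  ultimately show ?thesis using Lim_transform_eventually by fastforce
qed

section \<open>The event that the hull surrounds the origin\<close>

definition interior_event :: "real \<Rightarrow> 'w set" where
  "interior_event lam = {\<omega> \<in> space (M lam). 0 \<in> interior (convex hull P lam \<omega>)}"

lemma sets_interior_event:
  assumes "lam > 0"
  shows "interior_event lam \<in> sets (M lam)"
proof -
  obtain D :: "('v \<times> real) set" where D: "countable D" "\<And>U. open U \<Longrightarrow> U \<noteq> {} \<Longrightarrow> \<exists>d\<in>D. d \<in> U"
    using countable_dense_exists[where 'a = "'v \<times> real"] by blast
  have "interior_event lam = {\<omega> \<in> space (M lam). \<exists>k. \<forall>u\<in>D. \<exists>x\<in>P lam \<omega>. x \<bullet> u \<ge> norm u / real (Suc k)}"
    unfolding interior_event_def using zero_interior_hull_iff[OF P_subset[OF assms] D(2)] by auto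
  also have "\<dots> = (\<Union>k. space (M lam) - (\<Union>u\<in>D. {\<omega> \<in> space (M lam). P lam \<omega> \<inter> {x. x \<bullet> u \<ge> norm u / real (Suc k)} = {}}))"
    by blast
  also have "\<dots> \<in> sets (M lam)"
  proof -
    have "{x :: 'v \<times> real. x \<bullet> u \<ge> norm u / real (Suc k)} \<in> sets borel" for u k
      by (intro borel_closed closed_Collect_le continuous_intros)
    from sets_P_void[OF assms this] show ?thesis
      by (intro sets.countable_UN'' sets.Diff sets.top D(1)) auto
  qed
  finally show ?thesis .
qed

text \<open>Union bound over the finitely many balls of \<open>zero_interior_hull_of_hits\<close>,
  each of mass at least a positive multiple of lam.\<close>

lemma interior_event_tendsto:
  "((\<lambda>lam. measure (M lam) (space (M lam) - interior_event lam)) \<longlongrightarrow> 0) at_top"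
proof -
  let ?r = "1 / (4 * real DIM('v \<times> real))"
  let ?I = "(Basis :: ('v \<times> real) set) \<times> {-1, 1 :: real}"
  define c where "c p = (snd p / 2) *\<^sub>R fst p" for p :: "('v \<times> real) \<times> real"
  define \<kappa> where "\<kappa> p = (1 / 4) powr \<delta> * measure lborel (cball (c p) ?r)" for p
  have r: "0 < ?r" "?r \<le> 1 / 4" by (simp_all add: field_simps)
  have \<kappa>: "\<kappa> p > 0" for p unfolding \<kappa>_def using r(1) by (simp add: content_cball_pos)
  let ?V = "\<lambda>lam p. {\<omega> \<in> space (M lam). P lam \<omega> \<inter> cball (c p) ?r = {}}"
  show ?thesis
  proof (rule Lim_null_comparison)
    show "\<forall>\<^sub>F lam in at_top. norm (measure (M lam) (space (M lam) - interior_event lam)) \<le> (\<Sum>p\<in>?I. exp (- (lam * \<kappa> p)))"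
      using eventually_gt_at_top[of 0]
    proof eventually_elim
      case (elim lam)
      interpret prob_space "M lam" by (rule prob_M[OF elim])
      have sets: "?V lam p \<in> sets (M lam)" for p using elim by (intro sets_P_void) auto
      have "space (M lam) - interior_event lam \<subseteq> (\<Union>p\<in>?I. ?V lam p)"
      proof
        fix \<omega> assume w: "\<omega> \<in> space (M lam) - interior_event lam"
        show "\<omega> \<in> (\<Union>p\<in>?I. ?V lam p)"
        proof (rule ccontr)
          assume "\<omega> \<notin> (\<Union>p\<in>?I. ?V lam p)"
          then have "P lam \<omega> \<inter> cball ((s / 2) *\<^sub>R b) ?r \<noteq> {}" if "b \<in> Basis" "s \<in> {-1, 1}" for b s
            using w that by (force simp: c_def)
          then have "0 \<in> interior (convex hull P lam \<omega>)" by (rule zero_interior_hull_of_hits)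
          with w show False by (simp add: interior_event_def)
        qed
      qed
      then have "prob (space (M lam) - interior_event lam) \<le> prob (\<Union>p\<in>?I. ?V lam p)"
        using sets by (intro finite_measure_mono sets.finite_UN) auto
      also have "\<dots> \<le> (\<Sum>p\<in>?I. prob (?V lam p))"
        using sets by (intro finite_measure_subadditive_finite) auto
      also have "\<dots> \<le> (\<Sum>p\<in>?I. exp (- (lam * \<kappa> p)))"
      proof (rule sum_mono)
        fix p assume p: "p \<in> ?I"
        have "norm (c p) \<le> 1 / 2" using p by (auto simp: c_def)
        from ball_intensity_interior_ball[OF elim \<delta> this r]
        have "measure (ball_intensity \<delta> lam) (cball (c p) ?r) \<ge> lam * \<kappa> p" by (simp add: \<kappa>_def)
        then show "prob (?V lam p) \<le> exp (- (lam * \<kappa> p))"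
          by (subst measure_void[OF P[OF elim]]) auto
      qed
      finally show ?case by simp
    qed
    have "((\<lambda>lam. exp (- (lam * \<kappa> p))) \<longlongrightarrow> 0) at_top" for p
    proof -
      have "filterlim (\<lambda>lam. lam * \<kappa> p) at_top at_top"
        using \<kappa>[of p] by (intro filterlim_at_top_mult_tendsto_pos[OF tendsto_const] filterlim_ident) auto
      then show ?thesis
        by (intro filterlim_compose[OF exp_at_bot]) (simp add: filterlim_uminus_at_bot)
    qed
    then have "((\<lambda>lam. \<Sum>p\<in>?I. exp (- (lam * \<kappa> p))) \<longlongrightarrow> (\<Sum>p\<in>?I. 0)) at_top"
      by (intro tendsto_sum)
    then show "((\<lambda>lam. \<Sum>p\<in>?I. exp (- (lam * \<kappa> p))) \<longlongrightarrow> 0) at_top" by simp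
  qed
qed

section \<open>Hits in the surrounding cells\<close>

lemma pole_chart_image_cylinder:
  fixes a :: 'v
  shows "pole_chart e ` (cball a 1 \<times> {0..G}) \<in> sets borel"
proof -
  have "compact (pole_chart e ` (cball a 1 \<times> {0..G}))"
    by (intro compact_continuous_image continuous_on_subset[OF continuous_pole_chart] compact_Times) auto
  then show ?thesis by (rule borel_compact)
qed

lemma pole_chart_mem_image: "e > 0 \<Longrightarrow> pole_chart e x \<in> pole_chart e ` A \<longleftrightarrow> x \<in> A"
  by (auto simp: pole_chart_def split: prod.splits)

lemma cylinder_bounded_borel:
  fixes a :: 'v
  shows "cball a 1 \<times> {0..G :: real} \<in> sets borel" "bounded (cball a 1 \<times> {0..G :: real})"
proof -
  have "compact (cball a 1 \<times> {0..G :: real})" by (intro compact_Times) auto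
  then show "cball a 1 \<times> {0..G :: real} \<in> sets borel" "bounded (cball a 1 \<times> {0..G :: real})"
    by (auto intro: borel_compact compact_imp_bounded)
qed

lemma cylinder_void_tendsto:
  fixes a :: 'v
  shows "((\<lambda>lam. measure (M lam) {\<omega> \<in> space (M lam). P lam \<omega> \<inter> pole_chart (chart_scale lam) ` (cball a 1 \<times> {0..G}) = {}}) \<longlongrightarrow>
    measure N {\<omega> \<in> space N. Q \<omega> \<inter> shear -` (cball a 1 \<times> {0..G}) = {}}) at_top"
proof -
  let ?C = "cball a 1 \<times> {0..G}"
  \<comment> \<open>Cutting with the ball meets the hypotheses of
    \<open>void_probability_tendsto\<close> and leaves the event unchanged, as P stays in the
    ball.\<close>
  let ?V = "\<lambda>lam. pole_chart (chart_scale lam) ` ?C \<inter> cball 0 1"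
  have "((\<lambda>lam. measure (M lam) {\<omega> \<in> space (M lam). P lam \<omega> \<inter> ?V lam = {}}) \<longlongrightarrow>
    measure N {\<omega> \<in> space N. Q \<omega> \<inter> shear -` ?C = {}}) at_top"
  proof (rule void_probability_tendsto)
    show "?V lam \<in> sets borel" for lam using pole_chart_image_cylinder by auto
    show "AE x in lborel. snd x > (norm (fst x))\<^sup>2 / 2 \<longrightarrow>
      (\<forall>\<^sub>F lam in at_top. pole_chart (chart_scale lam) x \<in> ?V lam \<longleftrightarrow> x \<in> ?C)"
    proof (intro AE_I2 impI)
      fix x :: "'v \<times> real" assume x: "snd x > (norm (fst x))\<^sup>2 / 2"
      have "\<forall>\<^sub>F e in at_right 0. 0 < (1 - norm (pole_chart e x)) / e\<^sup>2"
        using x by (intro order_tendstoD(1)[OF cap_height_tendsto]) simp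
      from eventually_chart_scale[OF this] eventually_gt_at_top[of 0]
      show "\<forall>\<^sub>F lam in at_top. pole_chart (chart_scale lam) x \<in> ?V lam \<longleftrightarrow> x \<in> ?C"
      proof eventually_elim
        case (elim lam)
        then show ?case using pole_chart_in_cball_iff[OF chart_scale_pos[OF elim(2)], of x]
            pole_chart_mem_image[OF chart_scale_pos[OF elim(2)], of x] by auto
      qed
    qed
    show "\<forall>\<^sub>F lam in at_top. \<forall>x. pole_chart (chart_scale lam) x \<in> ?V lam \<longrightarrow> norm (fst x) \<le> norm a + 1 \<and> snd x \<le> G"
      using eventually_gt_at_top[of 0]
    proof eventually_elim
      case (elim lam)
      have "norm (fst x) \<le> norm a + 1 \<and> snd x \<le> G" if "pole_chart (chart_scale lam) x \<in> ?V lam" for x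
      proof -
        have "x \<in> ?C" using that pole_chart_mem_image[OF chart_scale_pos[OF elim]] by blast
        then have "dist a (fst x) \<le> 1" "snd x \<le> G" by (auto simp: mem_Times_iff)
        then show ?thesis using norm_triangle_sub[of "fst x" a] by (simp add: dist_norm norm_minus_commute)
      qed
      then show ?case by blast
    qed
  qed (use cylinder_bounded_borel in auto)
  then show ?thesis
  proof (rule Lim_transform_eventually)
    show "\<forall>\<^sub>F lam in at_top. measure (M lam) {\<omega> \<in> space (M lam). P lam \<omega> \<inter> ?V lam = {}} =
      measure (M lam) {\<omega> \<in> space (M lam). P lam \<omega> \<inter> pole_chart (chart_scale lam) ` ?C = {}}"
      using eventually_gt_at_top[of 0]
    proof eventually_elim
      case (elim lam)
      then have "{\<omega> \<in> space (M lam). P lam \<omega> \<inter> ?V lam = {}} = {\<omega> \<in> space (M lam). P lam \<omega> \<inter> pole_chart (chart_scale lam) ` ?C = {}}"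
        using P_subset[OF elim] by blast
      then show ?case by simp
    qed
  qed
qed

definition cap_corner_event :: "real \<Rightarrow> real \<Rightarrow> real \<Rightarrow> 'w set" where
  "cap_corner_event L G lam = {\<omega> \<in> space (M lam). cap_corners (chart_scale lam) L G (P lam \<omega>)}"

definition parabola_corner_event :: "real \<Rightarrow> real \<Rightarrow> 'z set" where
  "parabola_corner_event L G = {\<omega> \<in> space N. parabola_corners L G (Q \<omega>)}"

lemma cap_corner_event_eq: "cap_corner_event L G lam =
    space (M lam) - (\<Union>a\<in>corner_points L. {\<omega> \<in> space (M lam). P lam \<omega> \<inter> pole_chart (chart_scale lam) ` (cball a 1 \<times> {0..G}) = {}})"
  by (auto simp: cap_corner_event_def cap_corners_def)

lemma parabola_corner_event_eq: "parabola_corner_event L G =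
    space N - (\<Union>a\<in>corner_points L. {\<omega> \<in> space N. Q \<omega> \<inter> shear -` (cball a 1 \<times> {0..G}) = {}})"
  by (auto simp: parabola_corner_event_def parabola_corners_def)

lemma sets_Q_cylinder_void:
  fixes a :: 'v
  shows "{\<omega> \<in> space N. Q \<omega> \<inter> shear -` (cball a 1 \<times> {0..G}) = {}} \<in> sets N"
  using measurable_sets[OF shear_measurable cylinder_bounded_borel(1)]
  by (intro sets_Q_void bounded_shear_vimage cylinder_bounded_borel) auto

lemma sets_cap_corner_event: "lam > 0 \<Longrightarrow> cap_corner_event L G lam \<in> sets (M lam)"
  unfolding cap_corner_event_eq
  by (intro sets.Diff sets.top sets.finite_UN corner_points sets_P_void pole_chart_image_cylinder)

lemma sets_parabola_corner_event: "parabola_corner_event L G \<in> sets N"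
  unfolding parabola_corner_event_eq
  by (intro sets.Diff sets.top sets.finite_UN corner_points sets_Q_cylinder_void)

lemma parabola_corner_event_mono: "G \<le> G' \<Longrightarrow> parabola_corner_event L G \<subseteq> parabola_corner_event L G'"
  unfolding parabola_corner_event_def parabola_corners_def by fastforce

text \<open>G is read off from Q alone: each cell is missed with probability at most \<eta>, and by
  convergence P eventually misses its cell with probability below \<open>2 * \<eta>\<close>. The
  factor 2 in \<eta> is the room for this passage, so one G serves both processes.\<close>

lemma corner_events:
  assumes "\<epsilon> > 0"
  shows "\<exists>G. (\<forall>\<^sub>F lam in at_top. measure (M lam) (cap_corner_event L G lam) \<ge> 1 - \<epsilon>) \<and>
    measure N (parabola_corner_event L G) \<ge> 1 - \<epsilon>"
proof -
  interpret N: prob_space N by (rule prob_N)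
  let ?I = "corner_points L :: 'v set"
  let ?V = "\<lambda>G a. {\<omega> \<in> space N. Q \<omega> \<inter> shear -` (cball a 1 \<times> {0..G}) = {}}"
  define \<eta> where "\<eta> = \<epsilon> / (2 * real (card ?I))"
  have card: "real (card ?I) > 0" 
  proof -
    have "finite ?I" "?I \<noteq> {}" by (rule corner_points)+
    then show ?thesis by (simp add: card_gt_0_iff)
  qed
  have \<eta>: "\<eta> > 0" "real (card ?I) * (2 * \<eta>) = \<epsilon>" using assms card by (simp_all add: \<eta>_def)
  have "\<forall>a. \<exists>G. measure N (?V G a) \<le> \<eta>"
  proof
    fix a :: 'v
    obtain G where G: "(\<integral>x. indicator (cball a 1 \<times> {0..G}) x * parabola_density \<delta> x \<partial>lborel) \<ge> - ln \<eta>"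
      using parabola_density_cylinder_unbounded[OF \<delta>] by blast
    have "measure N (?V G a) = exp (- measure (halfspace_intensity \<delta>) (shear -` (cball a 1 \<times> {0..G})))"
      using measurable_sets[OF shear_measurable cylinder_bounded_borel(1)]
      by (intro measure_void[OF Q] bounded_shear_vimage cylinder_bounded_borel) auto
    also have "\<dots> \<le> exp (ln \<eta>)"
      using G measure_halfspace_intensity[OF \<delta> cylinder_bounded_borel(1)[of a G]] by simp
    finally show "\<exists>G. measure N (?V G a) \<le> \<eta>" using \<eta> by auto
  qed
  from choice[OF this] obtain Ga where Ga: "\<And>a. measure N (?V (Ga a) a) \<le> \<eta>" by blast
  define G where "G = Max (Ga ` ?I)"
  have V: "measure N (?V G a) \<le> \<eta>" if "a \<in> ?I" for a
  proof -
    have "Ga a \<le> G" unfolding G_def using that corner_points(1) by (intro Max_ge) auto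
    then have "?V G a \<subseteq> ?V (Ga a) a" by fastforce
    then have "measure N (?V G a) \<le> measure N (?V (Ga a) a)"
      by (intro N.finite_measure_mono sets_Q_cylinder_void)
    with Ga show ?thesis using order_trans by blast
  qed
  have "measure N (parabola_corner_event L G) \<ge> 1 - real (card ?I) * \<eta>"
    unfolding parabola_corner_event_eq
    by (rule N.prob_avoid_all[OF corner_points(1) sets_Q_cylinder_void V])
  moreover have "real (card ?I) * \<eta> \<le> \<epsilon>" using \<eta> assms card by (simp add: algebra_simps)
  moreover have "\<forall>\<^sub>F lam in at_top. \<forall>a\<in>?I.
      measure (M lam) {\<omega> \<in> space (M lam). P lam \<omega> \<inter> pole_chart (chart_scale lam) ` (cball a 1 \<times> {0..G}) = {}} < 2 * \<eta>"
  proof (intro eventually_ball_finite corner_points(1) ballI)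
    fix a assume "a \<in> ?I"
    with V \<eta> have "measure N (?V G a) < 2 * \<eta>" by fastforce
    then show "\<forall>\<^sub>F lam in at_top. measure (M lam) {\<omega> \<in> space (M lam).
        P lam \<omega> \<inter> pole_chart (chart_scale lam) ` (cball a 1 \<times> {0..G}) = {}} < 2 * \<eta>"
      by (rule order_tendstoD(2)[OF cylinder_void_tendsto])
  qed
  then have "\<forall>\<^sub>F lam in at_top. measure (M lam) (cap_corner_event L G lam) \<ge> 1 - \<epsilon>"
    using eventually_gt_at_top[of 0]
  proof eventually_elim
    case (elim lam)
    interpret prob_space "M lam" by (rule prob_M[OF elim(2)])
    show ?case unfolding cap_corner_event_eq \<eta>(2)[symmetric]
      using elim by (intro prob_avoid_all corner_points sets_P_void pole_chart_image_cylinder less_imp_le) auto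
  qed
  ultimately show ?thesis by (intro exI[of _ G]) auto
qed

definition good_event :: "real \<Rightarrow> real \<Rightarrow> real \<Rightarrow> 'w set" where
  "good_event L G lam = interior_event lam \<inter> cap_corner_event L G lam"

lemma good_events:
  assumes "\<epsilon> > 0"
  shows "\<exists>G. (\<forall>\<^sub>F lam in at_top. measure (M lam) (good_event L G lam) \<ge> 1 - \<epsilon>) \<and>
    measure N (parabola_corner_event L G) \<ge> 1 - \<epsilon>"
proof -
  obtain G where G: "\<forall>\<^sub>F lam in at_top. measure (M lam) (cap_corner_event L G lam) \<ge> 1 - \<epsilon> / 2"
    "measure N (parabola_corner_event L G) \<ge> 1 - \<epsilon> / 2"
    using corner_events[of "\<epsilon> / 2" L] assms by auto
  have "\<forall>\<^sub>F lam in at_top. measure (M lam) (space (M lam) - interior_event lam) < \<epsilon> / 2"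
    using assms by (intro order_tendstoD(2)[OF interior_event_tendsto]) auto
  with G(1) have "\<forall>\<^sub>F lam in at_top. measure (M lam) (good_event L G lam) \<ge> 1 - \<epsilon>"
    using eventually_gt_at_top[of 0]
  proof eventually_elim
    case (elim lam)
    interpret prob_space "M lam" by (rule prob_M[OF elim(3)])
    have "prob (interior_event lam) \<ge> 1 - \<epsilon> / 2"
      using elim(2) prob_compl[OF sets_interior_event[OF elim(3)]] by simp
    from prob_Int_ge[OF sets_interior_event[OF elim(3)] sets_cap_corner_event[OF elim(3)] this elim(1)]
    show ?case by (simp add: good_event_def)
  qed
  then show ?thesis using G(2) assms by (intro exI[of _ G]) auto
qed

lemma sets_good_event: "lam > 0 \<Longrightarrow> good_event L G lam \<in> sets (M lam)"
  unfolding good_event_def by (intro sets.Int sets_interior_event sets_cap_corner_event)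

text \<open>Outside this almost sure event the hull need not project onto the whole space; the limit
  functions are replaced by 0 there.\<close>

definition full_event :: "'z set" where
  "full_event = (\<Inter>L::nat. \<Union>G::nat. parabola_corner_event (real L) (real G))"

lemma sets_full_event: "full_event \<in> sets N"
  unfolding full_event_def by (intro sets.countable_INT' sets.countable_UN') (auto simp: sets_parabola_corner_event)

text \<open>For fixed L the corner events increase with G, and by \<open>corner_events\<close> their
  probabilities exceed every \<open>1 - \<epsilon>\<close>.\<close>

lemma AE_full_event: "AE \<omega> in N. \<omega> \<in> full_event"
proof -
  interpret prob_space N by (rule prob_N)
  have "AE \<omega> in N. \<omega> \<in> (\<Union>G::nat. parabola_corner_event (real L) (real G))" for L :: nat
  proof -
    let ?U = "\<Union>G::nat. parabola_corner_event (real L) (real G)"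
    have U: "?U \<in> sets N" by (intro sets.countable_UN') (auto simp: sets_parabola_corner_event)
    have "1 \<le> prob ?U"
    proof (rule field_le_epsilon)
      fix \<epsilon> :: real assume "\<epsilon> > 0"
      then obtain G where G: "measure N (parabola_corner_event (real L) G) \<ge> 1 - \<epsilon>"
        using corner_events[of \<epsilon> "real L"] by auto
      obtain G' :: nat where "G \<le> real G'" using real_arch_simple by blast
      then have "parabola_corner_event (real L) G \<subseteq> ?U"
        using parabola_corner_event_mono[of G "real G'" "real L"] by blast
      then have "measure N (parabola_corner_event (real L) G) \<le> prob ?U"
        using U by (intro finite_measure_mono)
      with G show "1 \<le> prob ?U + \<epsilon>" by simp
    qed
    then have "prob ?U = 1" using prob_le_1[of ?U] by linarith
    then show ?thesis using prob_eq_1[OF U] by simp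
  qed
  then have "AE \<omega> in N. \<forall>L::nat. \<omega> \<in> (\<Union>G::nat. parabola_corner_event (real L) (real G))"
    by (subst AE_all_countable) blast
  then show ?thesis by (simp add: full_event_def)
qed

lemma full_event_subset: "full_event \<subseteq> space N"
  using sets.sets_into_space[OF sets_full_event] .

lemma full_event_corners:
  assumes "\<omega> \<in> full_event"
  shows "\<exists>L'\<ge>L. \<exists>G. parabola_corners L' G (Q \<omega>)"
proof -
  obtain n :: nat where "L \<le> real n" using real_arch_simple by blast
  moreover obtain G :: nat where "\<omega> \<in> parabola_corner_event (real n) (real G)"
    using assms by (auto simp: full_event_def)
  ultimately show ?thesis unfolding parabola_corner_event_def by blast
qed

lemma full_event_nonempty: "\<omega> \<in> full_event \<Longrightarrow> Q \<omega> \<noteq> {}"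
  using full_event_corners[of \<omega> 0] parabola_corners_nonempty by blast

section \<open>The support and growth functions as random functions\<close>

definition support_process :: "real \<Rightarrow> 'w \<Rightarrow> 'v \<Rightarrow> real" where
  "support_process lam \<omega> = rescaled_support (chart_scale lam) (P lam \<omega>)"

definition growth_process :: "'z \<Rightarrow> 'v \<Rightarrow> real" where
  "growth_process \<omega> = (if \<omega> \<in> full_event then growth (Q \<omega>) else (\<lambda>_. 0))"

lemma le_support_process_iff:
  assumes lam: "lam > 0" and w: "\<omega> \<in> interior_event lam"
  shows "t \<le> support_process lam \<omega> v \<longleftrightarrow> P lam \<omega> \<inter> {y. cap_defect (chart_scale lam) v y < t} = {}"
proof -
  have w: "\<omega> \<in> space (M lam)" "0 \<in> interior (convex hull P lam \<omega>)"
    using w by (auto simp: interior_event_def)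
  show ?thesis
    unfolding support_process_def
      le_rescaled_support_iff[OF P_finite[OF lam w(1)] w(2) chart_scale_pos[OF lam]]
    by (auto simp: not_le[symmetric])
qed

lemma support_process_measurable:
  assumes lam: "lam > 0"
  shows "(\<lambda>\<omega>. support_process lam \<omega> v) \<in> borel_measurable (M lam)"
proof (rule borel_measurable_iff_ge[THEN iffD2], rule allI)
  fix t
  let ?e = "chart_scale lam"
  let ?W = "{\<omega> \<in> space (M lam). P lam \<omega> \<inter> {y. cap_defect ?e v y < t} = {}}"
  have 1: "t \<le> support_process lam \<omega> v \<longleftrightarrow> P lam \<omega> \<inter> {y. cap_defect ?e v y < t} = {}"
    if "\<omega> \<in> interior_event lam" for \<omega>
    by (rule le_support_process_iff[OF lam that])
  have 2: "support_process lam \<omega> v = 1 / ?e\<^sup>2" if "\<omega> \<in> space (M lam)" "\<omega> \<notin> interior_event lam" for \<omega>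
    using that by (simp add: support_process_def interior_event_def rescaled_support_not_interior)
  have sub: "interior_event lam \<subseteq> space (M lam)" by (auto simp: interior_event_def)
  \<comment> \<open>Off the interior event the process has the constant default value, so that part
    of the superlevel set is all or nothing.\<close>
  have "{\<omega> \<in> space (M lam). t \<le> support_process lam \<omega> v} =
      (interior_event lam \<inter> ?W) \<union> (if t \<le> 1 / ?e\<^sup>2 then space (M lam) - interior_event lam else {})"
  proof (rule set_eqI)
    fix \<omega>
    show "\<omega> \<in> {\<omega> \<in> space (M lam). t \<le> support_process lam \<omega> v} \<longleftrightarrow>
      \<omega> \<in> (interior_event lam \<inter> ?W) \<union> (if t \<le> 1 / ?e\<^sup>2 then space (M lam) - interior_event lam else {})"
      using 1[of \<omega>] 2[of \<omega>] sub by (cases "\<omega> \<in> interior_event lam") auto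
  qed
  also have "\<dots> \<in> sets (M lam)"
    using sets_P_void[OF lam borel_open[OF open_cap]] sets_interior_event[OF lam] by auto
  finally show "{\<omega> \<in> space (M lam). t \<le> support_process lam \<omega> v} \<in> sets (M lam)" .
qed

text \<open>Every sheared point of Q lies above the paraboloid, so this constraint leaves the event
  unchanged, while it makes the sublevel set bounded.\<close>

lemma le_growth_process_iff:
  assumes "\<omega> \<in> full_event"
  shows "t \<le> growth_process \<omega> v \<longleftrightarrow>
    Q \<omega> \<inter> shear -` {x. (norm (fst x))\<^sup>2 / 2 \<le> snd x \<and> parabola_defect v x < t} = {}"
proof -
  have w: "\<omega> \<in> space N" using assms full_event_subset by auto
  have "(norm (fst (shear x)))\<^sup>2 / 2 \<le> snd (shear x)" if "x \<in> Q \<omega>" for x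
    using Q_subset[OF w] that by (auto simp: shear_def)
  then show ?thesis
    using le_growth_iff[OF Q_subset[OF w] full_event_nonempty[OF assms] Q_finite[OF w], of t v] assms
    by (auto simp: growth_process_def not_le[symmetric])
qed

lemma sets_parabola_sublevel:
  "{x :: 'v \<times> real. (norm (fst x))\<^sup>2 / 2 \<le> snd x \<and> parabola_defect v x < t} \<in> sets borel"
proof -
  have "{x :: 'v \<times> real. (norm (fst x))\<^sup>2 / 2 \<le> snd x} \<inter> {x. parabola_defect v x < t} \<in> sets borel"
    by (intro sets.Int borel_closed closed_parabola borel_open open_parabola)
  then show ?thesis by (simp add: Collect_conj_eq)
qed

lemma growth_process_measurable: "(\<lambda>\<omega>. growth_process \<omega> v) \<in> borel_measurable N"
proof (rule borel_measurable_iff_ge[THEN iffD2], rule allI)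
  fix t
  let ?U = "{x :: 'v \<times> real. (norm (fst x))\<^sup>2 / 2 \<le> snd x \<and> parabola_defect v x < t}"
  let ?W = "{\<omega> \<in> space N. Q \<omega> \<inter> shear -` ?U = {}}"
  have "{\<omega> \<in> space N. t \<le> growth_process \<omega> v} =
      (full_event \<inter> ?W) \<union> (if t \<le> 0 then space N - full_event else {})"
    using le_growth_process_iff[of _ t v] full_event_subset
    by (auto simp: growth_process_def)
  also have "\<dots> \<in> sets N"
    using sets_Q_void[OF _ bounded_shear_vimage[OF bounded_parabola_sublevel]]
      measurable_sets[OF shear_measurable sets_parabola_sublevel[of v t]] sets_full_event by auto
  finally show "{\<omega> \<in> space N. t \<le> growth_process \<omega> v} \<in> sets N" .
qed

end

lemma restrict_mspace:
  assumes "compact B" "continuous_on B f"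
  shows "restrict f B \<in> mspace (continuous_functions_on B)"
proof -
  have "continuous_on B (restrict f B)"
    using assms(2) continuous_on_cong[of B B "restrict f B" f] by simp
  then show ?thesis using assms(1) by (simp add: mspace_continuous_functions_on)
qed

section \<open>Convergence in law of the support functions\<close>

context poisson_polytopes
begin

lemma support_joint_survival_tendsto:
  assumes T: "finite T" "T \<subseteq> cball 0 R \<times> UNIV" and R: "R > 0"
  shows "((\<lambda>lam. measure (M lam) {\<omega> \<in> space (M lam). \<forall>(v, t)\<in>T. t \<le> support_process lam \<omega> v}) \<longlongrightarrow>
    measure N {\<omega> \<in> space N. \<forall>(v, t)\<in>T. t \<le> growth_process \<omega> v}) at_top"
proof -
  define V where "V lam = cball 0 1 \<inter> (\<Union>(v, t)\<in>T. {y. cap_defect (chart_scale lam) v y < t})" for lam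
  define U where "U = (\<Union>(v, t)\<in>T. {x :: 'v \<times> real. (norm (fst x))\<^sup>2 / 2 \<le> snd x \<and> parabola_defect v x < t})"
  have V: "V lam \<in> sets borel" for lam
  proof -
    have "open (\<Union>(v, t)\<in>T. {y. cap_defect (chart_scale lam) v y < t})"
      by (intro open_UN ballI) (auto simp: open_cap split: prod.split)
    then show ?thesis unfolding V_def by (intro sets.Int borel_open borel_closed[OF closed_cball])
  qed
  have U: "U \<in> sets borel" "bounded U"
    unfolding U_def using T(1) sets_parabola_sublevel bounded_parabola_sublevel
    by (auto intro!: sets.finite_UN bounded_UN)
  have lim: "((\<lambda>lam. measure (M lam) {\<omega> \<in> space (M lam). P lam \<omega> \<inter> V lam = {}}) \<longlongrightarrow>
    measure N {\<omega> \<in> space N. Q \<omega> \<inter> shear -` U = {}}) at_top"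
  proof (rule void_probability_tendsto[OF V _ U])
    show "V lam \<subseteq> cball 0 1" for lam by (simp add: V_def)
    have "AE x in lborel. \<forall>p\<in>T. parabola_defect (fst p) x \<noteq> snd p"
      using T(1) AE_parabola_defect_neq by (intro AE_finite_allI) auto
    then show "AE x in lborel. snd x > (norm (fst x))\<^sup>2 / 2 \<longrightarrow>
      (\<forall>\<^sub>F lam in at_top. pole_chart (chart_scale lam) x \<in> V lam \<longleftrightarrow> x \<in> U)"
    proof eventually_elim
      case (elim x)
      show ?case
      proof
        assume x: "snd x > (norm (fst x))\<^sup>2 / 2"
        have "\<forall>\<^sub>F e in at_right 0. 0 < (1 - norm (pole_chart e x)) / e\<^sup>2"
          using x by (intro order_tendstoD(1)[OF cap_height_tendsto]) simp
        from eventually_chart_scale[OF this]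
        have 1: "\<forall>\<^sub>F lam in at_top. 0 < (1 - norm (pole_chart (chart_scale lam) x)) / (chart_scale lam)\<^sup>2" .
        have 2: "\<forall>\<^sub>F lam in at_top. \<forall>p\<in>T.
            cap_defect (chart_scale lam) (fst p) (pole_chart (chart_scale lam) x) < snd p \<longleftrightarrow> parabola_defect (fst p) x < snd p"
        proof (intro eventually_ball_finite T(1) ballI)
          fix p assume p: "p \<in> T"
          have tend: "((\<lambda>e. cap_defect e (fst p) (pole_chart e x)) \<longlongrightarrow> parabola_defect (fst p) x) (at_right 0)"
            using cap_defect_pole_chart_tendsto[of "fst p" x] by (simp add: parabola_defect_def)
          \<comment> \<open>Strict inequalities are stable under limits; equality with the level has
            been excluded almost everywhere.\<close>
          have "\<forall>\<^sub>F e in at_right 0. cap_defect e (fst p) (pole_chart e x) < snd p \<longleftrightarrow> parabola_defect (fst p) x < snd p"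
          proof (cases "parabola_defect (fst p) x < snd p")
            case True
            from order_tendstoD(2)[OF tend this] show ?thesis by eventually_elim (simp add: True)
          next
            case False
            with elim p have less: "snd p < parabola_defect (fst p) x" by force
            from order_tendstoD(1)[OF tend less] show ?thesis
              by eventually_elim (use less in auto)
          qed
          then show "\<forall>\<^sub>F lam in at_top. cap_defect (chart_scale lam) (fst p) (pole_chart (chart_scale lam) x) < snd p
              \<longleftrightarrow> parabola_defect (fst p) x < snd p"
            by (rule eventually_chart_scale)
        qed
        from 1 2 eventually_gt_at_top[of 0]
        show "\<forall>\<^sub>F lam in at_top. pole_chart (chart_scale lam) x \<in> V lam \<longleftrightarrow> x \<in> U"
        proof eventually_elim
          case (elim lam)
          have "pole_chart (chart_scale lam) x \<in> cball 0 1"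
            using pole_chart_in_cball_iff[OF chart_scale_pos[OF elim(3)], of x] elim(1) by simp
          then have "pole_chart (chart_scale lam) x \<in> V lam \<longleftrightarrow>
              (\<exists>p\<in>T. cap_defect (chart_scale lam) (fst p) (pole_chart (chart_scale lam) x) < snd p)"
            by (auto simp: V_def case_prod_beta)
          also have "\<dots> \<longleftrightarrow> (\<exists>p\<in>T. parabola_defect (fst p) x < snd p)" using elim(2) by blast
          also have "\<dots> \<longleftrightarrow> x \<in> U" using x by (auto simp: U_def case_prod_beta)
          finally show ?case .
        qed
      qed
    qed
    \<comment> \<open>A common bound for all levels in T, so that localization gives one box for the
      whole union.\<close>
    define H where "H = (\<Sum>p\<in>T. \<bar>snd p\<bar>)"
    have tH: "t \<le> H" if "(v, t) \<in> T" for v t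
      using member_le_sum[of "(v, t)" T "\<lambda>p. \<bar>snd p\<bar>"] that T(1) unfolding H_def by simp
    \<comment> \<open>Keeps the angle \<open>norm (e *\<^sub>R v)\<close> at most 1 on the window,
      where the cosine is at least 1/2.\<close>
    have "\<forall>\<^sub>F e in at_right (0::real). e < 1 / R"
      using R by (intro order_tendstoD(2)[OF tendsto_ident_at]) auto
    from eventually_chart_scale[OF this] eventually_gt_at_top[of 0]
    show "\<forall>\<^sub>F lam in at_top. \<forall>x. pole_chart (chart_scale lam) x \<in> V lam \<longrightarrow>
      norm (fst x) \<le> sqrt (2 * H) + R \<and> snd x \<le> 2 * (H + (sqrt (2 * H) + R) * R)"
    proof eventually_elim
      case (elim lam)
      note e = chart_scale_pos[OF elim(2)]
      have "norm w \<le> sqrt (2 * H) + R \<and> g \<le> 2 * (H + (sqrt (2 * H) + R) * R)"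
        if wg: "pole_chart (chart_scale lam) (w, g) \<in> V lam" for w g
      proof -
        obtain v t where vt: "(v, t) \<in> T" "cap_defect (chart_scale lam) v (pole_chart (chart_scale lam) (w, g)) < t"
          "pole_chart (chart_scale lam) (w, g) \<in> cball 0 1"
          using wg by (auto simp: V_def)
        have v: "norm v \<le> R" using vt(1) T(2) by auto
        have "norm (chart_scale lam *\<^sub>R v) \<le> chart_scale lam * R" using v e by (simp add: mult_left_mono)
        also have "\<dots> \<le> 1" using elim(1) R by (simp add: field_simps)
        finally have "(norm (chart_scale lam *\<^sub>R v))\<^sup>2 \<le> 1" by (simp add: power_le_one)
        then have cos: "cos (norm (chart_scale lam *\<^sub>R v)) \<ge> 1 / 2"
          using one_minus_cos_le[of "norm (chart_scale lam *\<^sub>R v)"] by linarith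
        have "cap_defect (chart_scale lam) v (pole_chart (chart_scale lam) (w, g)) \<le> H"
          using vt(2) tH[OF vt(1)] by simp
        from pole_chart_localization[OF e vt(3) this v cos] show ?thesis by blast
      qed
      then show ?case by auto
    qed
  qed
  have growth: "measure N {\<omega> \<in> space N. \<forall>(v, t)\<in>T. t \<le> growth_process \<omega> v} =
      measure N {\<omega> \<in> space N. Q \<omega> \<inter> shear -` U = {}}"
  proof (rule measure_eq_AE)
    show "AE \<omega> in N. \<omega> \<in> {\<omega> \<in> space N. \<forall>(v, t)\<in>T. t \<le> growth_process \<omega> v} \<longleftrightarrow>
      \<omega> \<in> {\<omega> \<in> space N. Q \<omega> \<inter> shear -` U = {}}"
      using AE_full_event
    proof eventually_elim
      case (elim \<omega>)
      have "(\<forall>(v, t)\<in>T. t \<le> growth_process \<omega> v) \<longleftrightarrow> Q \<omega> \<inter> shear -` U = {}"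
        unfolding le_growth_process_iff[OF elim] U_def by blast
      then show ?case by simp
    qed
    show "{\<omega> \<in> space N. \<forall>(v, t)\<in>T. t \<le> growth_process \<omega> v} \<in> sets N"
      using T(1) growth_process_measurable by (intro sets_joint_survival)
    show "{\<omega> \<in> space N. Q \<omega> \<inter> shear -` U = {}} \<in> sets N"
      using measurable_sets[OF shear_measurable U(1)] by (intro sets_Q_void bounded_shear_vimage U) auto
  qed
  let ?A = "\<lambda>lam. {\<omega> \<in> space (M lam). \<forall>(v, t)\<in>T. t \<le> support_process lam \<omega> v}"
  let ?W = "\<lambda>lam. {\<omega> \<in> space (M lam). P lam \<omega> \<inter> V lam = {}}"
  \<comment> \<open>Survival and voidness are equivalent only on the interior event; elsewhere the
    default value intervenes, at a cost bounded by the vanishing probability of the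
    complement.\<close>
  have "((\<lambda>lam. measure (M lam) (?A lam) - measure (M lam) (?W lam)) \<longlongrightarrow> 0) at_top"
  proof (rule Lim_null_comparison[OF _ interior_event_tendsto])
    show "\<forall>\<^sub>F lam in at_top. norm (measure (M lam) (?A lam) - measure (M lam) (?W lam)) \<le>
        measure (M lam) (space (M lam) - interior_event lam)"
      using eventually_gt_at_top[of 0]
    proof eventually_elim
      case (elim lam)
      interpret prob_space "M lam" by (rule prob_M[OF elim])
      let ?I = "space (M lam) - interior_event lam"
      have I: "?I \<in> events" using sets_interior_event[OF elim] by auto
      have A: "?A lam \<in> events"
        using T(1) support_process_measurable[OF elim] by (intro sets_joint_survival)
      have W: "?W lam \<in> events" by (rule sets_P_void[OF elim V])
      have eq: "(\<forall>(v, t)\<in>T. t \<le> support_process lam \<omega> v) \<longleftrightarrow> P lam \<omega> \<inter> V lam = {}"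
        if w: "\<omega> \<in> interior_event lam" for \<omega>
      proof -
        have "P lam \<omega> \<subseteq> cball 0 1" using P_subset[OF elim] w by (auto simp: interior_event_def)
        then show ?thesis unfolding le_support_process_iff[OF elim w] V_def by blast
      qed
      have "prob (?A lam) \<le> prob (?W lam \<union> ?I)" using eq I W by (intro finite_measure_mono) auto
      also have "\<dots> \<le> prob (?W lam) + prob ?I" using I W by (intro measure_Un_le)
      finally have 1: "prob (?A lam) \<le> prob (?W lam) + prob ?I" .
      have "prob (?W lam) \<le> prob (?A lam \<union> ?I)" using eq I A by (intro finite_measure_mono) auto
      also have "\<dots> \<le> prob (?A lam) + prob ?I" using I A by (intro measure_Un_le)
      finally show ?case using 1 by (simp add: abs_le_iff)
    qed
  qed
  from tendsto_add[OF this lim] show ?thesis unfolding growth by simp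
qed

lemma support_process_mspace:
  assumes "lam > 0" "\<omega> \<in> space (M lam)"
  shows "restrict (support_process lam \<omega>) (cball 0 R) \<in> mspace (continuous_functions_on (cball 0 R))"
  using continuous_rescaled_support[OF P_finite[OF assms] P_subset[OF assms] chart_scale_pos[OF assms(1)], of "cball 0 R"]
  by (simp add: restrict_mspace support_process_def)

lemma growth_process_lipschitz:
  assumes "\<omega> \<in> full_event" "R \<ge> 0"
  shows "\<exists>C. C-lipschitz_on (cball 0 R) (growth_process \<omega>)"
proof -
  obtain L G where L: "L \<ge> 0" "parabola_corners L G (Q \<omega>)"
    using full_event_corners[OF assms(1), of 0] by blast
  have w: "\<omega> \<in> space N" using assms(1) full_event_subset by auto
  from growth_lipschitz[OF Q_subset[OF w] Q_finite[OF w] L(2,1) assms(2) refl]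
  show ?thesis using assms(1) by (auto simp: growth_process_def)
qed

lemma continuous_growth_process:
  assumes "\<omega> \<in> space N" "R \<ge> 0"
  shows "continuous_on (cball 0 R) (growth_process \<omega>)"
proof (cases "\<omega> \<in> full_event")
  case True
  then show ?thesis using growth_process_lipschitz[OF _ assms(2)] lipschitz_on_continuous_on by blast
qed (simp add: growth_process_def)

lemma growth_process_mspace:
  assumes "\<omega> \<in> space N" "R \<ge> 0"
  shows "restrict (growth_process \<omega>) (cball 0 R) \<in> mspace (continuous_functions_on (cball 0 R))"
  using continuous_growth_process[OF assms] by (intro restrict_mspace compact_cball)

lemma good_event_D:
  assumes "\<omega> \<in> good_event L G lam"
  shows "\<omega> \<in> space (M lam)" "0 \<in> interior (convex hull P lam \<omega>)" "cap_corners (chart_scale lam) L G (P lam \<omega>)"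
  using assms by (auto simp: good_event_def interior_event_def cap_corner_event_def)

lemma support_process_bounds:
  assumes "lam > 0" "\<omega> \<in> good_event L G lam" "L \<ge> 0" "norm v \<le> R"
  shows "0 \<le> support_process lam \<omega> v" "support_process lam \<omega> v \<le> R\<^sup>2 / 2 + (L + 1) * R + G"
proof -
  note w = good_event_D[OF assms(2)]
  note X = P_finite[OF assms(1) w(1)] P_subset[OF assms(1) w(1)]
  show "0 \<le> support_process lam \<omega> v"
    unfolding support_process_def by (rule rescaled_support_nonneg[OF X chart_scale_pos[OF assms(1)]])
  show "support_process lam \<omega> v \<le> R\<^sup>2 / 2 + (L + 1) * R + G"
    unfolding support_process_def
    by (rule rescaled_support_bound[OF X(1) w(2) chart_scale_pos[OF assms(1)] w(3) assms(3,4)])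
qed

lemma support_law_limit:
  assumes R: "R > 0"
  shows "law_limit (continuous_functions_on (cball 0 R))
    M (\<lambda>lam \<omega>. restrict (support_process lam \<omega>) (cball 0 R))
    N (\<lambda>\<omega>. restrict (growth_process \<omega>) (cball 0 R))"
proof (rule law_limit_random_functions[OF prob_M prob_N compact_cball support_process_mspace growth_process_mspace])
  show "(\<lambda>\<omega>. restrict (support_process lam \<omega>) (cball 0 R) v) \<in> borel_measurable (M lam)"
    if "lam > 0" "v \<in> cball 0 R" for lam v
    using support_process_measurable[OF that(1), of v] that(2) by simp
  show "(\<lambda>\<omega>. restrict (growth_process \<omega>) (cball 0 R) v) \<in> borel_measurable N" if "v \<in> cball 0 R" for v
    using growth_process_measurable[of v] that by simp
  show "((\<lambda>lam. measure (M lam) {\<omega> \<in> space (M lam). \<forall>(v, t)\<in>T. t \<le> restrict (support_process lam \<omega>) (cball 0 R) v}) \<longlongrightarrow>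
    measure N {\<omega> \<in> space N. \<forall>(v, t)\<in>T. t \<le> restrict (growth_process \<omega>) (cball 0 R) v}) at_top"
    if T: "finite T" "T \<subseteq> cball 0 R \<times> UNIV" for T
  proof -
    have "(\<forall>(v, t)\<in>T. t \<le> restrict f (cball 0 R) v) \<longleftrightarrow> (\<forall>(v, t)\<in>T. t \<le> f v)" for f :: "'v \<Rightarrow> real"
      using T(2) by (intro ball_cong) auto
    then show ?thesis using support_joint_survival_tendsto[OF T R] by simp
  qed
  fix \<epsilon> :: real assume "\<epsilon> > 0"
  \<comment> \<open>For tightness one hit near the pole suffices, hence L = 0, where all corner
    points coincide with the origin.\<close>
  then obtain G where G: "\<forall>\<^sub>F lam in at_top. measure (M lam) (good_event 0 G lam) \<ge> 1 - \<epsilon>"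
    "measure N (parabola_corner_event 0 G) \<ge> 1 - \<epsilon>"
    using good_events by blast
  define H where "H = R\<^sup>2 / 2 + (0 + 1) * R + G"
  define C where "C = sqrt (2 * H) + R"
  have "\<forall>\<^sub>F lam in at_top. \<exists>A\<in>sets (M lam). measure (M lam) A \<ge> 1 - \<epsilon> \<and>
      (\<forall>\<omega>\<in>A. (\<forall>v\<in>cball 0 R. \<bar>restrict (support_process lam \<omega>) (cball 0 R) v\<bar> \<le> H) \<and>
        C-lipschitz_on (cball 0 R) (restrict (support_process lam \<omega>) (cball 0 R)))"
    using G(1) eventually_gt_at_top[of 0]
  proof eventually_elim
    case (elim lam)
    have "(\<forall>v\<in>cball 0 R. \<bar>support_process lam \<omega> v\<bar> \<le> H) \<and> C-lipschitz_on (cball 0 R) (support_process lam \<omega>)"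
      if "\<omega> \<in> good_event 0 G lam" for \<omega>
    proof -
      note w = good_event_D[OF that]
      have "C-lipschitz_on (cball 0 R) (support_process lam \<omega>)"
        unfolding support_process_def C_def using R
        by (intro rescaled_support_lipschitz[OF P_finite[OF elim(2) w(1)] w(2) P_subset[OF elim(2) w(1)]
              chart_scale_pos[OF elim(2)] w(3) _ _ H_def]) auto
      moreover have "\<bar>support_process lam \<omega> v\<bar> \<le> H" if "v \<in> cball 0 R" for v
        using support_process_bounds[OF elim(2) \<open>\<omega> \<in> good_event 0 G lam\<close>, of v R] that by (simp add: H_def)
      ultimately show ?thesis by blast
    qed
    then show ?case unfolding lipschitz_on_restrict using elim(1) sets_good_event[OF elim(2), of 0 G]
      by (intro bexI[of _ "good_event 0 G lam"]) simp_all
  qed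
  moreover have "\<exists>A\<in>sets N. measure N A \<ge> 1 - \<epsilon> \<and>
      (\<forall>\<omega>\<in>A. (\<forall>v\<in>cball 0 R. \<bar>restrict (growth_process \<omega>) (cball 0 R) v\<bar> \<le> H) \<and>
        C-lipschitz_on (cball 0 R) (restrict (growth_process \<omega>) (cball 0 R)))"
  proof (rule bexI[of _ "parabola_corner_event 0 G \<inter> full_event"], rule conjI)
    show "parabola_corner_event 0 G \<inter> full_event \<in> sets N"
      using sets_parabola_corner_event sets_full_event by auto
    have "measure N (parabola_corner_event 0 G \<inter> full_event) = measure N (parabola_corner_event 0 G)"
      using AE_full_event sets_parabola_corner_event sets_full_event
      by (intro measure_eq_AE) auto
    then show "measure N (parabola_corner_event 0 G \<inter> full_event) \<ge> 1 - \<epsilon>" using G(2) by simp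
    show "\<forall>\<omega>\<in>parabola_corner_event 0 G \<inter> full_event.
      (\<forall>v\<in>cball 0 R. \<bar>restrict (growth_process \<omega>) (cball 0 R) v\<bar> \<le> H) \<and>
        C-lipschitz_on (cball 0 R) (restrict (growth_process \<omega>) (cball 0 R))"
    proof
      fix \<omega> assume "\<omega> \<in> parabola_corner_event 0 G \<inter> full_event"
      then have w: "\<omega> \<in> space N" "parabola_corners 0 G (Q \<omega>)" "\<omega> \<in> full_event"
        by (auto simp: parabola_corner_event_def)
      note X = Q_subset[OF w(1)] Q_finite[OF w(1)]
      have "C-lipschitz_on (cball 0 R) (growth (Q \<omega>))"
        using R unfolding C_def by (intro growth_lipschitz[OF X w(2) _ _ H_def]) auto
      moreover have "\<bar>growth (Q \<omega>) v\<bar> \<le> H" if "norm v \<le> R" for v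
        using growth_bound[OF X w(2) _ that] growth_nonneg[OF X(1) full_event_nonempty[OF w(3)] X(2), of v] by (simp add: H_def)
      ultimately show "(\<forall>v\<in>cball 0 R. \<bar>restrict (growth_process \<omega>) (cball 0 R) v\<bar> \<le> H) \<and>
        C-lipschitz_on (cball 0 R) (restrict (growth_process \<omega>) (cball 0 R))"
        unfolding lipschitz_on_restrict using w(3) by (simp add: growth_process_def)
    qed
  qed
  ultimately show "\<exists>L H.
       (\<forall>\<^sub>F lam in at_top. \<exists>A\<in>sets (M lam). measure (M lam) A \<ge> 1 - \<epsilon> \<and>
          (\<forall>\<omega>\<in>A. (\<forall>v\<in>cball 0 R. \<bar>restrict (support_process lam \<omega>) (cball 0 R) v\<bar> \<le> H) \<and>
            L-lipschitz_on (cball 0 R) (restrict (support_process lam \<omega>) (cball 0 R)))) \<and>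
       (\<exists>A\<in>sets N. measure N A \<ge> 1 - \<epsilon> \<and>
          (\<forall>\<omega>\<in>A. (\<forall>v\<in>cball 0 R. \<bar>restrict (growth_process \<omega>) (cball 0 R) v\<bar> \<le> H) \<and>
            L-lipschitz_on (cball 0 R) (restrict (growth_process \<omega>) (cball 0 R))))"
    by blast
qed (use R in auto)

end

section \<open>Radius-vector functions and hull processes\<close>

text \<open>A Hopf-Lax formula with quadratic cost, truncated to \<open>norm a \<le> H\<close> so
  that it becomes a functional on the continuous functions over \<open>cball 0 H\<close>.\<close>

definition sup_convolution :: "real \<Rightarrow> ('v::euclidean_space \<Rightarrow> real) \<Rightarrow> 'v \<Rightarrow> real" where
  "sup_convolution H \<phi> v = (SUP a\<in>cball 0 H. \<phi> a - (norm (v - a))\<^sup>2 / 2)"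

lemma sup_convolution_ge:
  assumes "continuous_on (cball 0 H) \<phi>" "norm a \<le> H"
  shows "\<phi> a - (norm (v - a))\<^sup>2 / 2 \<le> sup_convolution H \<phi> v"
proof -
  have "continuous_on (cball 0 H) (\<lambda>a. \<phi> a - (norm (v - a))\<^sup>2 / 2)"
    by (intro continuous_intros assms(1)) auto
  then have "bdd_above ((\<lambda>a. \<phi> a - (norm (v - a))\<^sup>2 / 2) ` cball 0 H)"
    by (intro bounded_imp_bdd_above compact_imp_bounded compact_continuous_image compact_cball)
  then show ?thesis unfolding sup_convolution_def using assms(2) by (intro cSUP_upper) auto
qed

lemma sup_convolution_le:
  assumes "H \<ge> 0" "\<And>a. norm a \<le> H \<Longrightarrow> \<phi> a - (norm (v - a))\<^sup>2 / 2 \<le> c"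
  shows "sup_convolution H \<phi> v \<le> c"
  unfolding sup_convolution_def using assms by (intro cSUP_least) auto

lemma sup_convolution_shift:
  assumes "H \<ge> 0" "continuous_on (cball 0 H) \<phi>" "norm v \<le> R" "norm v' \<le> R"
  shows "sup_convolution H \<phi> v' \<le> sup_convolution H \<phi> v + (H + R) * norm (v - v')"
proof (rule sup_convolution_le[OF assms(1)])
  fix a :: 'a assume a: "norm a \<le> H"
  let ?x = "norm (v - a)" and ?y = "norm (v' - a)"
  have "?x - ?y \<le> norm (v - v')" using norm_triangle_ineq2[of "v - a" "v' - a"] by simp
  then have "(?x - ?y) * (?x + ?y) \<le> norm (v - v') * (?x + ?y)" by (intro mult_right_mono) auto
  also have "\<dots> \<le> norm (v - v') * (2 * (H + R))"
    using norm_triangle_ineq4[of v a] norm_triangle_ineq4[of v' a] a assms(3,4)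
    by (intro mult_left_mono) auto
  finally have "?x\<^sup>2 / 2 - ?y\<^sup>2 / 2 \<le> (H + R) * norm (v - v')"
    by (simp add: power2_eq_square algebra_simps)
  with sup_convolution_ge[OF assms(2) a, of v]
  show "\<phi> a - ?y\<^sup>2 / 2 \<le> sup_convolution H \<phi> v + (H + R) * norm (v - v')" by simp
qed

lemma sup_convolution_mspace:
  assumes "H \<ge> 0" "R \<ge> 0" "continuous_on (cball 0 H) \<phi>"
  shows "restrict (sup_convolution H \<phi>) (cball 0 R) \<in> mspace (continuous_functions_on (cball 0 R))"
proof (rule restrict_mspace[OF compact_cball])
  have "(H + R)-lipschitz_on (cball 0 R) (sup_convolution H \<phi>)"
    using sup_convolution_shift[OF assms(1,3)] assms by (intro lipschitz_on_of_shift) auto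
  then show "continuous_on (cball 0 R) (sup_convolution H \<phi>)" by (rule lipschitz_on_continuous_on)
qed

lemma sup_convolution_close:
  assumes "H \<ge> 0" "continuous_on (cball 0 H) \<psi>"
    and "\<And>a. norm a \<le> H \<Longrightarrow> \<phi> a \<le> \<psi> a + c"
  shows "sup_convolution H \<phi> v \<le> sup_convolution H \<psi> v + c"
proof (rule sup_convolution_le[OF assms(1)])
  fix a :: 'a assume a: "norm a \<le> H"
  from sup_convolution_ge[OF assms(2) a, of v] assms(3)[OF a]
  show "\<phi> a - (norm (v - a))\<^sup>2 / 2 \<le> sup_convolution H \<psi> v + c" by simp
qed

lemma sup_convolution_cong:
  assumes "\<And>a. norm a \<le> H \<Longrightarrow> \<phi> a = \<psi> a"
  shows "sup_convolution H \<phi> v = sup_convolution H \<psi> v"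
  unfolding sup_convolution_def using assms by (intro SUP_cong) auto

text \<open>Suprema are 1-Lipschitz in the uniform norm.\<close>

lemma sup_convolution_continuous_map:
  fixes H R :: real
  assumes "H \<ge> 0" "R \<ge> 0"
  shows "continuous_map (mtopology_of (continuous_functions_on (cball 0 H)))
    (mtopology_of (continuous_functions_on (cball 0 R)))
    (\<lambda>\<phi> :: 'v::euclidean_space \<Rightarrow> real. restrict (sup_convolution H \<phi>) (cball 0 R))"
proof (rule Lipschitz_continuous_imp_continuous_map)
  let ?m = "continuous_functions_on (cball (0 :: 'v) H)" and ?m' = "continuous_functions_on (cball (0 :: 'v) R)"
  let ?G = "\<lambda>\<phi>. restrict (sup_convolution H \<phi>) (cball (0 :: 'v) R)"
  have cont: "continuous_on (cball 0 H) \<phi>" if "\<phi> \<in> mspace ?m" for \<phi>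
    using that by (simp add: mspace_continuous_functions_on)
  have "mdist ?m' (?G \<phi>) (?G \<psi>) \<le> 1 * mdist ?m \<phi> \<psi>" if \<phi>: "\<phi> \<in> mspace ?m" and \<psi>: "\<psi> \<in> mspace ?m" for \<phi> \<psi>
    unfolding mult_1
  proof (rule mdist_continuous_functions_on_le)
    fix v :: 'v assume v: "v \<in> cball 0 R"
    let ?c = "mdist ?m \<phi> \<psi>"
    have ab: "\<bar>\<phi> a - \<psi> a\<bar> \<le> ?c" if "norm a \<le> H" for a
      using abs_le_mdist_continuous_functions_on[OF \<phi> \<psi>, of a] that by simp
    have 1: "\<phi> a \<le> \<psi> a + ?c" and 2: "\<psi> a \<le> \<phi> a + ?c" if "norm a \<le> H" for a
      using ab[OF that] by linarith+
    have "sup_convolution H \<phi> v \<le> sup_convolution H \<psi> v + ?c"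
      by (rule sup_convolution_close[OF assms(1) cont[OF \<psi>] 1])
    moreover have "sup_convolution H \<psi> v \<le> sup_convolution H \<phi> v + ?c"
      by (rule sup_convolution_close[OF assms(1) cont[OF \<phi>] 2])
    ultimately show "\<bar>?G \<phi> v - ?G \<psi> v\<bar> \<le> ?c" using v by (simp add: abs_le_iff)
  qed simp
  then show "Lipschitz_continuous_map ?m ?m' ?G"
    unfolding Lipschitz_continuous_map_def
    using sup_convolution_mspace[OF assms cont] by blast
qed

text \<open>The largest coordinate of p selects the vertex; the unit radius of the cell costs at
  most \<open>norm p\<close>.\<close>

lemma corner_direction:
  fixes p :: "'v::euclidean_space"
  assumes "L \<ge> 0"
  shows "\<exists>a\<in>corner_points L. \<forall>w\<in>cball a 1. w \<bullet> p \<ge> (L / real DIM('v) - 1) * norm p"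
proof -
  obtain b where b: "b \<in> Basis" "\<bar>p \<bullet> b\<bar> \<ge> norm p / real DIM('v)"
    by (rule large_coordinate)
  define a where "a = (if p \<bullet> b \<ge> 0 then L else - L) *\<^sub>R b"
  have a: "a \<in> corner_points L" using b(1) by (auto simp: a_def corner_points_def)
  have "a \<bullet> p = L * \<bar>p \<bullet> b\<bar>" by (simp add: a_def inner_commute)
  also have "\<dots> \<ge> L * (norm p / real DIM('v))" using b(2) assms by (intro mult_left_mono)
  finally have ap: "a \<bullet> p \<ge> L / real DIM('v) * norm p" by simp
  have "w \<bullet> p \<ge> (L / real DIM('v) - 1) * norm p" if "w \<in> cball a 1" for w
  proof -
    have "(a - w) \<bullet> p \<le> norm (a - w) * norm p" by (rule norm_cauchy_schwarz)
    also have "\<dots> \<le> 1 * norm p" using that by (intro mult_right_mono) (auto simp: dist_norm)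
    finally show ?thesis using ap by (simp add: inner_diff_left algebra_simps)
  qed
  with a show ?thesis by blast
qed

text \<open>Along a horizontal line the shear adds a parabola with quadratic coefficient 1/2 in
  arclength, which cancels the -1/2 of the arc.\<close>

lemma shear_parabolic_segment:
  fixes x1 x2 y :: "'v::euclidean_space \<times> real"
  assumes "fst x1 \<noteq> fst x2"
  shows "y \<in> parabolic_segment x1 x2 \<longleftrightarrow> shear y \<in> closed_segment (shear x1) (shear x2)"
proof -
  obtain v1 h1 v2 h2 where x: "x1 = (v1, h1)" "x2 = (v2, h2)" by (metis prod.exhaust)
  define l where "l = norm (v2 - v1)"
  have l: "l > 0" using assms by (simp add: l_def x)
  \<comment> \<open>The arc parametrised by the fraction \<tau> of the horizontal distance; the last
    term is its excess over the chord.\<close>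
  define k where "k \<tau> = (v1 + \<tau> *\<^sub>R (v2 - v1), (1 - \<tau>) * h1 + \<tau> * h2 + \<tau> * (1 - \<tau>) * l\<^sup>2 / 2)" for \<tau>
  have "y \<in> parabolic_segment x1 x2 \<longleftrightarrow> (\<exists>\<tau>. 0 \<le> \<tau> \<and> \<tau> \<le> 1 \<and> y = k \<tau>)"
  proof
    assume "y \<in> parabolic_segment x1 x2"
    then obtain s a where s: "y = (v1 + s *\<^sub>R ((v2 - v1) /\<^sub>R l), - s\<^sup>2 / 2 + a * s + h1)" "0 \<le> s" "s \<le> l"
      "- l\<^sup>2 / 2 + a * l + h1 = h2"
      by (auto simp: parabolic_segment_def x l_def)
    define \<tau> where "\<tau> = s / l"
    have s\<tau>: "s = \<tau> * l" using l by (simp add: \<tau>_def)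
    have "- s\<^sup>2 / 2 + a * s + h1 = (1 - \<tau>) * h1 + \<tau> * h2 + \<tau> * (1 - \<tau>) * l\<^sup>2 / 2"
      unfolding s(4)[symmetric] s\<tau> by (simp add: field_simps power2_eq_square)
    moreover have "s *\<^sub>R ((v2 - v1) /\<^sub>R l) = \<tau> *\<^sub>R (v2 - v1)" by (simp add: \<tau>_def divide_inverse)
    ultimately have "y = k (s / l)" by (simp add: k_def s(1) \<tau>_def)
    moreover have "0 \<le> s / l" "s / l \<le> 1" using s(2,3) l by auto
    ultimately show "\<exists>\<tau>. 0 \<le> \<tau> \<and> \<tau> \<le> 1 \<and> y = k \<tau>" by blast
  next
    assume "\<exists>\<tau>. 0 \<le> \<tau> \<and> \<tau> \<le> 1 \<and> y = k \<tau>"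
    then obtain \<tau> where \<tau>: "0 \<le> \<tau>" "\<tau> \<le> 1" "y = k \<tau>" by blast
    define a where "a = (h2 - h1 + l\<^sup>2 / 2) / l"
    have "y = (v1 + (\<tau> * l) *\<^sub>R ((v2 - v1) /\<^sub>R l), - (\<tau> * l)\<^sup>2 / 2 + a * (\<tau> * l) + h1)"
      using l by (simp add: \<tau>(3) k_def a_def field_simps power2_eq_square)
    moreover have "0 \<le> \<tau> * l" "\<tau> * l \<le> l" using \<tau> l by (auto simp: mult_le_cancel_right1)
    moreover have "- l\<^sup>2 / 2 + a * l + h1 = h2" using l by (simp add: a_def)
    ultimately show "y \<in> parabolic_segment x1 x2"
      unfolding parabolic_segment_def x prod.case l_def[symmetric] by blast
  qed
  also have "\<dots> \<longleftrightarrow> (\<exists>\<tau>. 0 \<le> \<tau> \<and> \<tau> \<le> 1 \<and> shear y = (1 - \<tau>) *\<^sub>R shear x1 + \<tau> *\<^sub>R shear x2)"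
  proof -
    have "y = k \<tau> \<longleftrightarrow> shear y = (1 - \<tau>) *\<^sub>R shear x1 + \<tau> *\<^sub>R shear x2" for \<tau>
    proof -
      obtain v h where y: "y = (v, h)" by fastforce
      let ?v = "v1 + \<tau> *\<^sub>R (v2 - v1)"
      have "(norm ?v)\<^sup>2 = (1 - \<tau>) * (norm v1)\<^sup>2 + \<tau> * (norm v2)\<^sup>2 - \<tau> * (1 - \<tau>) * l\<^sup>2"
        unfolding l_def power2_norm_eq_inner
        by (simp add: inner_diff_left inner_diff_right inner_add_left inner_add_right inner_commute algebra_simps)
      then have "(1 - \<tau>) * (h1 + (norm v1)\<^sup>2 / 2) + \<tau> * (h2 + (norm v2)\<^sup>2 / 2) =
          (1 - \<tau>) * h1 + \<tau> * h2 + \<tau> * (1 - \<tau>) * l\<^sup>2 / 2 + (norm ?v)\<^sup>2 / 2"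
        by (simp add: field_simps)
      moreover have "(1 - \<tau>) *\<^sub>R v1 + \<tau> *\<^sub>R v2 = ?v" by (simp add: algebra_simps)
      ultimately have "(1 - \<tau>) *\<^sub>R shear x1 + \<tau> *\<^sub>R shear x2 =
          (?v, (1 - \<tau>) * h1 + \<tau> * h2 + \<tau> * (1 - \<tau>) * l\<^sup>2 / 2 + (norm ?v)\<^sup>2 / 2)"
        by (simp add: shear_def x)
      then show ?thesis by (auto simp: y k_def shear_def)
    qed
    then show ?thesis by simp
  qed
  also have "\<dots> \<longleftrightarrow> shear y \<in> closed_segment (shear x1) (shear x2)"
    by (auto simp: in_segment)
  finally show ?thesis .
qed

lemma parabola_defect_segment:
  assumes "z \<in> closed_segment x y" "c \<le> parabola_defect a x" "c \<le> parabola_defect a y"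
  shows "c \<le> parabola_defect a z"
proof -
  obtain \<tau> where \<tau>: "0 \<le> \<tau>" "\<tau> \<le> 1" "z = (1 - \<tau>) *\<^sub>R x + \<tau> *\<^sub>R y"
    using assms(1) by (auto simp: in_segment)
  define n where "n = (norm a)\<^sup>2 / 2"
  have p: "parabola_defect a q = snd q - fst q \<bullet> a + n" for q :: "'a \<times> real" by (simp add: parabola_defect_def n_def)
  have "parabola_defect a z = (1 - \<tau>) * parabola_defect a x + \<tau> * parabola_defect a y"
    unfolding p by (simp add: \<tau>(3) inner_add_left inner_diff_left algebra_simps)
  also have "\<dots> \<ge> (1 - \<tau>) * c + \<tau> * c" using assms \<tau> by (intro add_mono mult_left_mono) auto
  finally show ?thesis by (simp add: algebra_simps)
qed

text \<open>The easy half of the duality: in sheared coordinates the region above an affine graph is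
  convex and closed upwards, so a bound valid on X passes to the least up-convex set.\<close>

lemma paraboloid_hull_lower:
  fixes X :: "('v::euclidean_space \<times> real) set"
  assumes X: "X \<subseteq> UNIV \<times> {0..}" and c: "\<And>x. x \<in> X \<Longrightarrow> c \<le> parabola_defect a (shear x)"
    and y: "y \<in> paraboloid_hull X"
  shows "c \<le> parabola_defect a (shear y)"
proof -
  let ?A = "UNIV \<times> {0..} \<inter> {y. c \<le> parabola_defect a (shear y)}"
  have "up_convex ?A"
    unfolding up_convex_def
  proof (intro conjI ballI impI allI)
    fix x1 x2 :: "'v \<times> real" assume x: "x1 \<in> ?A" "x2 \<in> ?A" and ne: "fst x1 \<noteq> fst x2"
    have "parabolic_segment x1 x2 \<subseteq> UNIV \<times> {0..}"
      using x by (intro parabolic_segment_nonneg[OF ne]) (auto simp: mem_Times_iff)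
    moreover have "c \<le> parabola_defect a (shear z)" if "z \<in> parabolic_segment x1 x2" for z
      using that x parabola_defect_segment unfolding shear_parabolic_segment[OF ne] by blast
    ultimately show "parabolic_segment x1 x2 \<subseteq> ?A" by blast
  qed (auto simp: parabola_defect_shear)
  then have "paraboloid_hull X \<subseteq> ?A"
    unfolding paraboloid_hull_def using X c by (intro hull_minimal) auto
  with y show ?thesis by auto
qed

lemma convex_shear_up_convex:
  fixes A :: "('v::euclidean_space \<times> real) set"
  assumes A: "up_convex A"
  shows "convex (shear ` A)"
  unfolding convex_contains_segment
proof (intro ballI subsetI)
  fix y1 y2 z assume "y1 \<in> shear ` A" "y2 \<in> shear ` A" and z: "z \<in> closed_segment y1 y2"
  then obtain x1 x2 where x: "x1 \<in> A" "x2 \<in> A" "y1 = shear x1" "y2 = shear x2" by blast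
  obtain w g where wg: "z = (w, g)" by fastforce
  define y where "y = (w, g - (norm w)\<^sup>2 / 2)"
  have zy: "z = shear y" by (simp add: y_def shear_def wg)
  have "y \<in> A"
  proof (cases "fst x1 = fst x2")
    case False
    have "y \<in> parabolic_segment x1 x2"
      using z unfolding shear_parabolic_segment[OF False] zy x .
    then show ?thesis using A x False unfolding up_convex_def by blast
  next
    \<comment> \<open>Vertical segments are not parabolic segments; they are supplied by upward
      closedness.\<close>
    case True
    obtain v h1 h2 where v: "x1 = (v, h1)" "x2 = (v, h2)" using True by (metis prod.collapse)
    obtain \<tau> where \<tau>: "0 \<le> \<tau>" "\<tau> \<le> 1" "z = (1 - \<tau>) *\<^sub>R y1 + \<tau> *\<^sub>R y2"
      using z by (auto simp: in_segment)
    define n where "n = (norm v)\<^sup>2 / 2"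
    have "w = (1 - \<tau>) *\<^sub>R v + \<tau> *\<^sub>R v" "g = (1 - \<tau>) * (h1 + n) + \<tau> * (h2 + n)"
      using \<tau>(3) by (simp_all add: wg x v shear_def n_def)
    then have "w = v" "g = (1 - \<tau>) * h1 + \<tau> * h2 + (norm v)\<^sup>2 / 2"
      by (simp flip: scaleR_add_left, simp add: n_def[symmetric] algebra_simps)
    then have y: "y = (v, (1 - \<tau>) * h1 + \<tau> * h2)" by (simp add: y_def)
    have "min h1 h2 \<le> (1 - \<tau>) * h1 + \<tau> * h2"
    proof -
      have "(1 - \<tau>) * min h1 h2 + \<tau> * min h1 h2 \<le> (1 - \<tau>) * h1 + \<tau> * h2"
        using \<tau> by (intro add_mono mult_left_mono) auto
      then show ?thesis by (simp add: algebra_simps)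
    qed
    moreover have "(v, min h1 h2) \<in> A" using x v by (simp add: min_def)
    ultimately show ?thesis using A unfolding up_convex_def y by blast
  qed
  then show "z \<in> shear ` A" using zy by blast
qed

text \<open>A hyperplane separating a point below the hull from the sheared hull is the graph of an
  affine function; its slope is bounded because the corner cells surround the point.\<close>

lemma paraboloid_hull_upper:
  fixes X :: "('v::euclidean_space \<times> real) set"
  assumes X: "X \<subseteq> UNIV \<times> {0..}" "\<And>A. bounded A \<Longrightarrow> finite (X \<inter> A)"
    and corners: "parabola_corners L G X" "L \<ge> 0" and v: "norm v \<le> R" and L: "L / real DIM('v) - 1 \<ge> R + 1"
    and h: "(v, h) \<notin> paraboloid_hull X" "h \<ge> - 1"
  shows "\<exists>a. norm a \<le> G + 1 \<and> h \<le> growth X a - (norm (v - a))\<^sup>2 / 2"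
proof -
  have ne: "X \<noteq> {}" by (rule parabola_corners_nonempty[OF corners(1)])
  let ?A = "paraboloid_hull X"
  have A: "up_convex ?A" by (rule up_convex_paraboloid_hull[OF X(1)])
  have XA: "X \<subseteq> ?A" unfolding paraboloid_hull_def by (rule hull_subset)
  define t where "t = h + (norm v)\<^sup>2 / 2"
  have t: "t \<ge> - 1" using h(2) zero_le_power2[of "norm v"] unfolding t_def by linarith
  have "(v, t) \<notin> shear ` ?A"
    using h(1) by (auto simp: shear_def t_def)
  then have "(v, t) \<notin> interior (shear ` ?A)" using interior_subset by blast
  from supporting_hyperplane_not_interior[OF convex_shear_up_convex[OF A] this]
  obtain bc where bc: "bc \<noteq> 0" "\<And>y. y \<in> shear ` ?A \<Longrightarrow> bc \<bullet> y \<le> bc \<bullet> (v, t)" by blast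
  obtain b c where b: "bc = (b, c)" by fastforce
  have sep: "b \<bullet> w + c * g \<le> b \<bullet> v + c * t" if "(w, g) \<in> shear ` ?A" for w g
    using bc(2)[OF that] by (simp add: b)
  have up: "(w, g') \<in> shear ` ?A" if "(w, g) \<in> shear ` ?A" "g' \<ge> g" for w g g'
  proof -
    have "(w, g - (norm w)\<^sup>2 / 2) \<in> ?A" using that(1) by (auto simp: shear_def)
    then have "(w, g' - (norm w)\<^sup>2 / 2) \<in> ?A" using A that(2) unfolding up_convex_def by (meson diff_right_mono)
    then show ?thesis by (force simp: shear_def)
  qed
  have corner: "\<exists>w g. (w, g) \<in> shear ` ?A \<and> 0 \<le> g \<and> g \<le> G \<and> (R + 1) * norm p \<le> w \<bullet> p" for p :: 'v
  proof -
    obtain a where a: "a \<in> corner_points L" "\<And>w. w \<in> cball a 1 \<Longrightarrow> w \<bullet> p \<ge> (L / real DIM('v) - 1) * norm p"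
      using corner_direction[OF corners(2), of p] by blast
    then obtain x where x: "x \<in> X" "shear x \<in> cball a 1 \<times> {0..G}"
      using corners(1) by (force simp: parabola_corners_def)
    obtain w g where wg: "shear x = (w, g)" by fastforce
    have "(R + 1) * norm p \<le> (L / real DIM('v) - 1) * norm p" using L by (intro mult_right_mono) auto
    also have "\<dots> \<le> w \<bullet> p" using a(2) x(2) wg by simp
    finally show ?thesis using x wg XA by (force intro!: exI[of _ w] exI[of _ g])
  qed
  \<comment> \<open>For c = 0 the hyperplane would be vertical, but a hit lies beyond v in direction
    b; c > 0 contradicts upward closedness.\<close>
  have c: "c < 0"
  proof (rule ccontr)
    assume "\<not> c < 0"
    show False
    proof (cases "c = 0")
      case True
      then have b0: "b \<noteq> 0" using bc(1) b by (auto simp: zero_prod_def)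
      obtain w g where w: "(w, g) \<in> shear ` ?A" "(R + 1) * norm b \<le> w \<bullet> b" using corner[of b] by blast
      have "b \<bullet> v \<le> norm b * norm v" by (rule norm_cauchy_schwarz)
      also have "\<dots> \<le> R * norm b" using mult_left_mono[OF v norm_ge_zero[of b]] by (simp add: mult.commute)
      finally have "(R + 1) * norm b \<le> R * norm b" using sep[OF w(1)] w(2) True by (simp add: inner_commute)
      then show False using b0 by (simp add: algebra_simps)
    next
      case False
      then have cpos: "c > 0" using \<open>\<not> c < 0\<close> by simp
      obtain w g where w: "(w, g) \<in> shear ` ?A" using corner[of 0] by blast
      define g' where "g' = max g (t + (b \<bullet> v - b \<bullet> w + 1) / c)"
      have "(w, g') \<in> shear ` ?A" by (rule up[OF w]) (simp add: g'_def)
      from sep[OF this] have "c * g' \<le> b \<bullet> v - b \<bullet> w + c * t" by simp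
      moreover have "c * (t + (b \<bullet> v - b \<bullet> w + 1) / c) \<le> c * g'" using cpos by (intro mult_left_mono) (auto simp: g'_def)
      moreover have "c * (t + (b \<bullet> v - b \<bullet> w + 1) / c) = c * t + (b \<bullet> v - b \<bullet> w + 1)"
        unfolding distrib_left using cpos by simp
      ultimately show False by linarith
    qed
  qed
  \<comment> \<open>The slope of the separating affine function, which has value t at v and stays
    below the sheared hull.\<close>
  define a where "a = (1 / - c) *\<^sub>R b"
  have slope: "t + a \<bullet> (w - v) \<le> g" if "(w, g) \<in> shear ` ?A" for w g
    using sep[OF that] c by (simp add: a_def inner_diff_right field_simps)
  \<comment> \<open>Some hit lies beyond v by at least 1 in the direction of a, at height at most G.
    The affine function rises to it from a value of at least -1, hence the bound G + 1.\<close>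
  have "norm a \<le> G + 1"
  proof -
    obtain w g where w: "(w, g) \<in> shear ` ?A" "g \<le> G" "(R + 1) * norm a \<le> w \<bullet> a" using corner[of a] by blast
    have "a \<bullet> v \<le> norm a * norm v" by (rule norm_cauchy_schwarz)
    also have "\<dots> \<le> R * norm a" using mult_left_mono[OF v norm_ge_zero[of a]] by (simp add: mult.commute)
    finally have "norm a \<le> a \<bullet> (w - v)" using w(3) by (simp add: inner_diff_right inner_commute algebra_simps)
    then show ?thesis using slope[OF w(1)] w(2) t by linarith
  qed
  moreover have "h + (norm (v - a))\<^sup>2 / 2 \<le> growth X a"
  proof -
    obtain x where x: "x \<in> X" "growth X a = parabola_defect a (shear x)"
      using growth_attained[OF X(1) ne X(2)] by blast
    obtain w g where wg: "shear x = (w, g)" by fastforce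
    have "(w, g) \<in> shear ` ?A" using x(1) XA wg by (metis image_eqI subsetD)
    from slope[OF this] have "t - a \<bullet> v + (norm a)\<^sup>2 / 2 \<le> growth X a"
      by (simp add: x(2) wg parabola_defect_def inner_diff_right inner_commute)
    moreover have "(norm (v - a))\<^sup>2 = (norm v)\<^sup>2 - 2 * (a \<bullet> v) + (norm a)\<^sup>2"
      by (simp add: power2_norm_eq_inner inner_diff_left inner_diff_right inner_commute)
    ultimately show ?thesis unfolding t_def by linarith
  qed
  ultimately show ?thesis by (intro exI[of _ a]) auto
qed

section \<open>Duality for the boundary of the hull\<close>

definition hull_boundary :: "('v::euclidean_space \<times> real) set \<Rightarrow> 'v \<Rightarrow> real" where
  "hull_boundary X = lower_boundary (paraboloid_hull X)"

lemma hull_boundary: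
  fixes X :: "('v::euclidean_space \<times> real) set"
  assumes X: "X \<subseteq> UNIV \<times> {0..}" "\<And>A. bounded A \<Longrightarrow> finite (X \<inter> A)"
    and corners: "parabola_corners L G X" "L \<ge> 0" and v: "norm v \<le> R" and L: "L / real DIM('v) - 1 \<ge> R + 1"
  shows growth_le_hull_boundary: "growth X a - (norm (v - a))\<^sup>2 / 2 \<le> hull_boundary X v"
    and hull_boundary_less: "h < hull_boundary X v \<Longrightarrow>
      \<exists>a. norm a \<le> G + 1 \<and> h \<le> growth X a - (norm (v - a))\<^sup>2 / 2"
proof -
  have ne: "X \<noteq> {}" by (rule parabola_corners_nonempty[OF corners(1)])
  let ?S = "{h. (v, h) \<in> paraboloid_hull X}"
  have lower: "growth X a - (norm (v - a))\<^sup>2 / 2 \<le> h" if "h \<in> ?S" for a h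
  proof -
    have "growth X a \<le> parabola_defect a (shear (v, h))"
    proof (rule paraboloid_hull_lower[OF X(1)])
      show "growth X a \<le> parabola_defect a (shear x)" if "x \<in> X" for x
        by (rule growth_le[OF X(1) ne X(2) that])
    qed (use that in simp)
    then show ?thesis by (simp add: parabola_defect_shear norm_minus_commute)
  qed
  obtain x0 where x0: "x0 \<in> X" using ne by blast
  obtain w0 g0 where wg0: "shear x0 = (w0, g0)" by fastforce
  \<comment> \<open>A uniform bound on the dual expression. A height above it cannot satisfy the
    conclusion of \<open>paraboloid_hull_upper\<close> and so lies in the hull; thus the infimum at
    v is over a nonempty set.\<close>
  have ub: "growth X a - (norm (v - a))\<^sup>2 / 2 \<le> \<bar>g0\<bar> + norm (v - w0) * (G + 1)" if a: "norm a \<le> G + 1" for a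
  proof -
    have "growth X a \<le> g0 - w0 \<bullet> a + (norm a)\<^sup>2 / 2"
      using growth_le[OF X(1) ne X(2) x0, of a] by (simp add: wg0 parabola_defect_def)
    moreover have "(norm (v - a))\<^sup>2 = (norm v)\<^sup>2 - 2 * (v \<bullet> a) + (norm a)\<^sup>2"
      by (simp add: power2_norm_eq_inner inner_diff_left inner_diff_right inner_commute)
    moreover have "(v - w0) \<bullet> a \<le> norm (v - w0) * (G + 1)"
      by (rule order_trans[OF norm_cauchy_schwarz mult_left_mono[OF a norm_ge_zero]])
    moreover have "0 \<le> (norm v)\<^sup>2" by simp
    moreover have "(v - w0) \<bullet> a = v \<bullet> a - w0 \<bullet> a" by (rule inner_diff_left)
    ultimately show ?thesis by linarith
  qed
  have S: "?S \<noteq> {}"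
  proof
    assume "?S = {}"
    define h where "h = \<bar>g0\<bar> + norm (v - w0) * (\<bar>G\<bar> + 1) + 1"
    have hp: "h \<ge> - 1" by (simp add: h_def add_nonneg_nonneg)
    have "(v, h) \<notin> paraboloid_hull X" using \<open>?S = {}\<close> by blast
    from paraboloid_hull_upper[OF X corners v L this hp]
    obtain a where a: "norm a \<le> G + 1" "h \<le> growth X a - (norm (v - a))\<^sup>2 / 2" by blast
    have "norm (v - w0) * (G + 1) \<le> norm (v - w0) * (\<bar>G\<bar> + 1)" by (intro mult_left_mono) auto
    with ub[OF a(1)] a(2) show False by (simp add: h_def)
  qed
  have eq: "hull_boundary X v = Inf ?S" by (simp add: hull_boundary_def lower_boundary_def)
  show "growth X a - (norm (v - a))\<^sup>2 / 2 \<le> hull_boundary X v"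
    unfolding eq using S lower by (intro cInf_greatest) auto
  have bdd: "bdd_below ?S" using lower[of _ 0] by (intro bdd_belowI) blast
  have nonneg: "0 \<le> hull_boundary X v"
  proof -
    have "paraboloid_hull X \<subseteq> UNIV \<times> {0..}" using up_convex_paraboloid_hull[OF X(1)] by (simp add: up_convex_def)
    then show ?thesis unfolding eq using S by (intro cInf_greatest) auto
  qed
  assume h: "h < hull_boundary X v"
  \<comment> \<open>Raising h to at least -1 meets the hypothesis of
    \<open>paraboloid_hull_upper\<close>, and it stays below the boundary, which is
    nonnegative.\<close>
  define h' where "h' = max h (- 1)"
  have "h' < hull_boundary X v" using h nonneg by (simp add: h'_def)
  then have "(v, h') \<notin> paraboloid_hull X" unfolding eq using cInf_lower[OF _ bdd, of h'] by auto
  from paraboloid_hull_upper[OF X corners v L this]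
  obtain a where "norm a \<le> G + 1" "h' \<le> growth X a - (norm (v - a))\<^sup>2 / 2" by (auto simp: h'_def)
  then show "\<exists>a. norm a \<le> G + 1 \<and> h \<le> growth X a - (norm (v - a))\<^sup>2 / 2"
    by (intro exI[of _ a]) (simp add: h'_def)
qed

text \<open>Every level below the boundary is reached by some a with norm at most
  \<open>G + 1\<close>, so truncation at any larger H loses nothing.\<close>

lemma hull_boundary_eq_sup_convolution:
  fixes X :: "('v::euclidean_space \<times> real) set"
  assumes X: "X \<subseteq> UNIV \<times> {0..}" "\<And>A. bounded A \<Longrightarrow> finite (X \<inter> A)"
    and corners: "parabola_corners L G X" "L \<ge> 0" and v: "norm v \<le> R" and L: "L / real DIM('v) - 1 \<ge> R + 1"
    and H: "H \<ge> G + 1" "H \<ge> 0" and cont: "continuous_on (cball 0 H) (growth X)"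
  shows "hull_boundary X v = sup_convolution H (growth X) v"
proof (rule antisym)
  show "hull_boundary X v \<le> sup_convolution H (growth X) v"
  proof (rule dense_le)
    fix h assume "h < hull_boundary X v"
    from hull_boundary_less[OF X corners v L this]
    obtain a where a: "norm a \<le> G + 1" "h \<le> growth X a - (norm (v - a))\<^sup>2 / 2" by blast
    have "growth X a - (norm (v - a))\<^sup>2 / 2 \<le> sup_convolution H (growth X) v"
      using a(1) H by (intro sup_convolution_ge[OF cont]) auto
    with a(2) show "h \<le> sup_convolution H (growth X) v" by linarith
  qed
  show "sup_convolution H (growth X) v \<le> hull_boundary X v"
    by (intro sup_convolution_le[OF H(2)] growth_le_hull_boundary[OF X corners v L])
qed

section \<open>Radial functions of convex hulls\<close>

definition radial :: "'a::euclidean_space set \<Rightarrow> 'a \<Rightarrow> real" where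
  "radial X u = Sup {\<rho>. \<rho> > 0 \<and> \<rho> *\<^sub>R u \<in> convex hull X}"

lemma radial:
  fixes X :: "'a::euclidean_space set"
  assumes X: "finite X" "X \<subseteq> cball 0 1" "0 \<in> interior (convex hull X)" and u: "norm u = 1"
  shows radial_pos: "0 < radial X u" and radial_le_1: "radial X u \<le> 1"
    and radial_mem: "radial X u *\<^sub>R u \<in> convex hull X"
    and radial_iff: "t > 0 \<Longrightarrow> t *\<^sub>R u \<in> convex hull X \<longleftrightarrow> t \<le> radial X u"
proof -
  let ?K = "convex hull X" and ?S = "{\<rho>. \<rho> > 0 \<and> \<rho> *\<^sub>R u \<in> convex hull X}"
  obtain r where r: "r > 0" "cball 0 r \<subseteq> ?K" using X(3) by (auto simp: mem_interior_cball)
  have "r *\<^sub>R u \<in> cball 0 r" using u r(1) by simp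
  then have rS: "r \<in> ?S" using r by blast
  have K: "?K \<subseteq> cball 0 1" by (rule hull_minimal[where S = convex, OF X(2) convex_cball])
  have le: "\<rho> \<le> 1" if "\<rho> \<in> ?S" for \<rho>
  proof -
    have "\<rho> *\<^sub>R u \<in> cball 0 1" using that K by blast
    then show ?thesis using that u by simp
  qed
  then have bdd: "bdd_above ?S" by (rule bdd_aboveI)
  show "radial X u \<le> 1" unfolding radial_def using rS le by (intro cSup_least) auto
  have "r \<le> radial X u" unfolding radial_def by (rule cSup_upper[OF rS bdd])
  then show pos: "0 < radial X u" using r(1) by linarith
  have "closed ?K" using X(1) by (intro compact_imp_closed finite_imp_compact_convex_hull)
  then have "closed ((\<lambda>\<rho>. \<rho> *\<^sub>R u) -` ?K)"
    by (intro continuous_closed_vimage continuous_intros)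
  moreover have "?S \<subseteq> (\<lambda>\<rho>. \<rho> *\<^sub>R u) -` ?K" by auto
  ultimately have "closure ?S \<subseteq> (\<lambda>\<rho>. \<rho> *\<^sub>R u) -` ?K" by (rule closure_minimal[rotated])
  moreover have "radial X u \<in> closure ?S"
    unfolding radial_def using rS bdd by (intro closure_contains_Sup) auto
  ultimately show mem: "radial X u *\<^sub>R u \<in> ?K" by blast
  show "t *\<^sub>R u \<in> ?K \<longleftrightarrow> t \<le> radial X u" if t: "t > 0"
  proof
    assume "t *\<^sub>R u \<in> ?K"
    then show "t \<le> radial X u" unfolding radial_def using t bdd by (intro cSup_upper) auto
  next
    assume le: "t \<le> radial X u"
    have 0: "0 \<in> ?K" using X(3) interior_subset by blast
    let ?\<tau> = "t / radial X u"
    have "(1 - ?\<tau>) *\<^sub>R 0 + ?\<tau> *\<^sub>R (radial X u *\<^sub>R u) \<in> ?K"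
      using le t pos by (intro convexD_alt[OF convex_convex_hull 0 mem]) auto
    then show "t *\<^sub>R u \<in> ?K" using pos by simp
  qed
qed

text \<open>The boundary point on the ray of u is mixed with a vector of the inscribed ball so that
  the mixture falls on the ray of u'. The constant depends on the configuration through r, which is
  enough for continuity of each realisation.\<close>

lemma radial_shift:
  fixes X :: "'a::euclidean_space set"
  assumes X: "finite X" "X \<subseteq> cball 0 1" "0 \<in> interior (convex hull X)"
    and r: "r > 0" "cball 0 r \<subseteq> convex hull X" and u: "norm u = 1" "norm u' = 1"
  shows "radial X u \<le> radial X u' + norm (u - u') / r"
proof (cases "u = u'")
  case False
  define \<eta> where "\<eta> = norm (u - u')"
  have \<eta>: "\<eta> > 0" using False by (simp add: \<eta>_def)
  let ?\<rho> = "radial X u"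
  note \<rho> = radial_pos[OF X u(1)] radial_le_1[OF X u(1)] radial_mem[OF X u(1)]
  \<comment> \<open>The weight at which z, a multiple of \<open>u' - u\<close> inside the inscribed
    ball, turns \<open>(1 - \<tau>) * ?\<rho>\<close> times u into the same multiple of u'.\<close>
  define \<tau> where "\<tau> = \<eta> / (r + \<eta>)"
  have \<tau>: "0 < \<tau>" "\<tau> \<le> 1" "\<tau> * r = (1 - \<tau>) * \<eta>" using \<eta> r(1) by (auto simp: \<tau>_def field_simps)
  define z where "z = (r * ?\<rho> / \<eta>) *\<^sub>R (u' - u)"
  have "norm z = r * ?\<rho>" using \<eta> r(1) \<rho>(1) by (simp add: z_def \<eta>_def norm_minus_commute)
  also have "\<dots> \<le> r * 1" using r(1) \<rho>(2) by (intro mult_left_mono) auto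
  finally have z: "z \<in> convex hull X" using r(2) by auto
  have "(1 - \<tau>) *\<^sub>R (?\<rho> *\<^sub>R u) + \<tau> *\<^sub>R z \<in> convex hull X"
    using \<tau> by (intro convexD_alt[OF convex_convex_hull \<rho>(3) z]) auto
  also have "\<tau> *\<^sub>R z = ((1 - \<tau>) * ?\<rho>) *\<^sub>R (u' - u)"
  proof -
    have "\<tau> * (r * ?\<rho> / \<eta>) = (\<tau> * r) * ?\<rho> / \<eta>" by simp
    also have "\<dots> = (1 - \<tau>) * ?\<rho>" unfolding \<tau>(3) using \<eta> by simp
    finally show ?thesis by (simp add: z_def)
  qed
  also have "(1 - \<tau>) *\<^sub>R (?\<rho> *\<^sub>R u) + ((1 - \<tau>) * ?\<rho>) *\<^sub>R (u' - u) = ((1 - \<tau>) * ?\<rho>) *\<^sub>R u'"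
    by (simp add: scaleR_diff_right)
  finally have mem: "((1 - \<tau>) * ?\<rho>) *\<^sub>R u' \<in> convex hull X" .
  have "1 - \<tau> > 0" using r(1) \<eta> by (simp add: \<tau>_def field_simps)
  then have "(1 - \<tau>) * ?\<rho> > 0" using \<rho>(1) by simp
  then have "(1 - \<tau>) * ?\<rho> \<le> radial X u'" using radial_iff[OF X u(2)] mem by blast
  moreover have "\<tau> * ?\<rho> \<le> \<tau> * 1" using \<tau>(1) \<rho>(2) by (intro mult_left_mono) auto
  moreover have "\<tau> \<le> \<eta> / r" unfolding \<tau>_def using \<eta> r(1) by (intro divide_left_mono) auto
  ultimately show ?thesis by (simp add: \<eta>_def algebra_simps)
qed simp

text \<open>It rewrites membership as countably many hitting conditions, as measurability of the
  radius demands. Strict separation from a finite set is an open condition on the direction, so it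
  already occurs for a direction in D.\<close>

lemma mem_convex_hull_iff_countable:
  fixes X D :: "'a::euclidean_space set"
  assumes X: "finite X" "X \<noteq> {}" and D: "\<And>U. open U \<Longrightarrow> U \<noteq> {} \<Longrightarrow> \<exists>d\<in>D. d \<in> U"
  shows "z \<in> convex hull X \<longleftrightarrow> (\<forall>w\<in>D. \<exists>x\<in>X. z \<bullet> w \<le> x \<bullet> w)"
proof
  assume z: "z \<in> convex hull X"
  show "\<forall>w\<in>D. \<exists>x\<in>X. z \<bullet> w \<le> x \<bullet> w"
  proof (rule ballI, rule ccontr)
    fix w assume "\<not> (\<exists>x\<in>X. z \<bullet> w \<le> x \<bullet> w)"
    then have less: "\<And>x. x \<in> X \<Longrightarrow> x \<bullet> w < z \<bullet> w" by (auto simp: not_le)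
    let ?m = "Max ((\<lambda>x. x \<bullet> w) ` X)"
    have "?m \<in> (\<lambda>x. x \<bullet> w) ` X" using X by (intro Max_in) auto
    then have "?m < z \<bullet> w" using less by auto
    moreover have "x \<bullet> w \<le> ?m" if "x \<in> X" for x using X that by (intro Max_ge) auto
    from convex_hull_inner_le[OF this z] have "z \<bullet> w \<le> ?m" .
    ultimately show False by simp
  qed
next
  assume w: "\<forall>w\<in>D. \<exists>x\<in>X. z \<bullet> w \<le> x \<bullet> w"
  show "z \<in> convex hull X"
  proof (rule ccontr)
    assume "z \<notin> convex hull X"
    moreover have "closed (convex hull X)" using X(1) by (intro compact_imp_closed finite_imp_compact_convex_hull)
    ultimately obtain a b where ab: "a \<bullet> z < b" "\<And>x. x \<in> convex hull X \<Longrightarrow> a \<bullet> x > b"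
      using separating_hyperplane_closed_point[OF convex_convex_hull] by metis
    let ?U = "\<Inter>x\<in>X. {w. x \<bullet> w < z \<bullet> w}"
    have "open ?U" using X(1) by (intro open_INT ballI open_Collect_less continuous_intros)
    moreover have "- a \<in> ?U"
    proof
      fix x assume "x \<in> X"
      then have "a \<bullet> x > b" by (intro ab(2) hull_inc)
      then show "- a \<in> {w. x \<bullet> w < z \<bullet> w}" using ab(1) by (simp add: inner_commute)
    qed
    ultimately obtain w' where "w' \<in> D" "w' \<in> ?U" using D by blast
    with w show False by force
  qed
qed

section \<open>The rescaled radius function and its dual expression\<close>

definition rescaled_radius :: "real \<Rightarrow> ('v::euclidean_space \<times> real) set \<Rightarrow> 'v \<Rightarrow> real" where
  "rescaled_radius e X v = radius_defect X (exp_map (e *\<^sub>R v)) / e\<^sup>2"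

lemma rescaled_radius_interior:
  "0 \<in> interior (convex hull X) \<Longrightarrow> rescaled_radius e X v = (1 - radial X (exp_map (e *\<^sub>R v))) / e\<^sup>2"
  by (simp add: rescaled_radius_def radius_defect_def radial_def)

lemma rescaled_radius_not_interior:
  "0 \<notin> interior (convex hull X) \<Longrightarrow> rescaled_radius e X v = 1 / e\<^sup>2"
  by (simp add: rescaled_radius_def radius_defect_def)

lemma continuous_rescaled_radius:
  assumes X: "finite X" "X \<subseteq> cball 0 1" and e: "e > 0"
  shows "continuous_on B (rescaled_radius e X)"
proof (cases "0 \<in> interior (convex hull X)")
  case True
  obtain r where r: "r > 0" "cball 0 r \<subseteq> convex hull X" using True by (auto simp: mem_interior_cball)
  show ?thesis
  proof (rule lipschitz_on_continuous_on[OF lipschitz_on_of_shift])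
    fix v a
    have "radial X (exp_map (e *\<^sub>R v)) \<le> radial X (exp_map (e *\<^sub>R a)) + norm (exp_map (e *\<^sub>R v) - exp_map (e *\<^sub>R a)) / r"
      by (rule radial_shift[OF X True r]) simp_all
    also have "norm (exp_map (e *\<^sub>R v) - exp_map (e *\<^sub>R a)) \<le> e * norm (v - a)"
      using norm_exp_map_diff_le[of "e *\<^sub>R v" "e *\<^sub>R a"] e by (simp add: scaleR_diff_right[symmetric])
    finally have "(1 - radial X (exp_map (e *\<^sub>R a))) / e\<^sup>2 \<le> (1 - radial X (exp_map (e *\<^sub>R v)) + e * norm (v - a) / r) / e\<^sup>2"
      using r by (intro divide_right_mono) (auto simp: divide_right_mono)
    also have "\<dots> = (1 - radial X (exp_map (e *\<^sub>R v))) / e\<^sup>2 + 1 / (e * r) * norm (v - a)"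
      using e r(1) by (simp add: field_simps power2_eq_square)
    finally show "rescaled_radius e X a \<le> rescaled_radius e X v + 1 / (e * r) * norm (v - a)"
      by (simp only: rescaled_radius_interior[OF True])
  qed (use e r in auto)
qed (simp add: rescaled_radius_not_interior)

text \<open>In the upper hemisphere the angle to the pole is \<open>arctan (norm p / q)\<close>,
  which is at most its argument.\<close>

lemma exp_map_onto:
  fixes p :: "'v::euclidean_space"
  assumes "(norm p)\<^sup>2 + q\<^sup>2 = 1" "q > 0"
  shows "\<exists>a. exp_map a = (p, q) \<and> norm a \<le> norm p / q"
proof (cases "p = 0")
  case True
  then have "q = 1" using assms by (simp add: power2_eq_1_iff)
  with True show ?thesis by (intro exI[of _ 0]) (simp add: exp_map_0)
next
  case False
  define x where "x = norm p / q"
  define \<theta> where "\<theta> = arctan x"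
  have x: "x > 0" using False assms by (simp add: x_def)
  have \<theta>: "\<theta> > 0" using x by (simp add: \<theta>_def)
  have "1 + x\<^sup>2 = (1 / q)\<^sup>2" using assms by (simp add: x_def field_simps)
  then have "sqrt (1 + x\<^sup>2) = 1 / q" using assms(2) by simp
  then have cs: "cos \<theta> = q" "sin \<theta> = norm p" using assms(2) by (simp_all add: \<theta>_def cos_arctan sin_arctan x_def)
  let ?a = "(\<theta> / norm p) *\<^sub>R p"
  have n: "norm ?a = \<theta>" using False \<theta> by simp
  have "exp_map ?a = (p, q)"
    unfolding exp_map_eq n using False \<theta> cs by (simp add: sin_quotient_def)
  moreover have "norm ?a \<le> norm p / q" unfolding n using arctan_le_self[of x] x by (simp add: \<theta>_def x_def)
  ultimately show ?thesis by blast
qed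

text \<open>The boundary point in direction v is tested against the half-space that the support
  function defines in direction a. The cosine of the angle between the two directions is the price
  for measuring along the ray instead of along the normal.\<close>

lemma rescaled_radius_lower:
  assumes X: "finite X" "X \<subseteq> cball 0 1" "0 \<in> interior (convex hull X)" and e: "e > 0"
  shows "rescaled_support e X a - cap_defect e v (exp_map (e *\<^sub>R a)) \<le>
    (exp_map (e *\<^sub>R v) \<bullet> exp_map (e *\<^sub>R a)) * rescaled_radius e X v"
proof -
  let ?u = "exp_map (e *\<^sub>R v)" and ?u' = "exp_map (e *\<^sub>R a)"
  let ?\<rho> = "radial X ?u" and ?S = "rescaled_support e X a"
  have "x \<bullet> ?u' \<le> 1 - e\<^sup>2 * ?S" if "x \<in> X" for x
    using rescaled_support_le[OF X(1,3) e that, of a] e by (simp add: cap_defect_def field_simps)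
  from convex_hull_inner_le[OF this radial_mem[OF X norm_exp_map]]
  have "?\<rho> * (?u \<bullet> ?u') \<le> 1 - e\<^sup>2 * ?S" by simp
  then have "(e\<^sup>2 * ?S - 1 + ?u \<bullet> ?u') / e\<^sup>2 \<le> (?u \<bullet> ?u' - ?\<rho> * (?u \<bullet> ?u')) / e\<^sup>2"
    by (intro divide_right_mono) auto
  moreover have "(e\<^sup>2 * ?S - 1 + ?u \<bullet> ?u') / e\<^sup>2 = ?S - cap_defect e v ?u'"
    using e by (simp add: cap_defect_def inner_commute field_simps)
  moreover have "(?u \<bullet> ?u' - ?\<rho> * (?u \<bullet> ?u')) / e\<^sup>2 = (?u \<bullet> ?u') * rescaled_radius e X v"
    by (simp add: rescaled_radius_interior[OF X(3)] algebra_simps)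
  ultimately show ?thesis by simp
qed

text \<open>The supporting hyperplane at the boundary point in direction \<open>exp_map (e v)\<close> attains the
  dual expression of the radius; the corner cells force its normal to be close to the pole.\<close>

lemma rescaled_radius_upper:
  fixes X :: "('v::euclidean_space \<times> real) set"
  assumes X: "finite X" "X \<subseteq> cball 0 1" "0 \<in> interior (convex hull X)" and e: "e > 0"
    and corners: "cap_corners e L G X" "L \<ge> 0" and v: "norm v \<le> R" and L: "L / real DIM('v) - 1 \<ge> 3 * R + 1"
    and cos: "cos (norm (e *\<^sub>R v)) \<ge> 1 / 2"
  shows "\<exists>a. norm a \<le> G \<and> (exp_map (e *\<^sub>R v) \<bullet> exp_map (e *\<^sub>R a)) * rescaled_radius e X v \<le>
    rescaled_support e X a - cap_defect e v (exp_map (e *\<^sub>R a))"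
proof -
  let ?u = "exp_map (e *\<^sub>R v)"
  let ?\<rho> = "radial X ?u" and ?K = "convex hull X"
  have R: "R \<ge> 0" using v norm_ge_zero order_trans by blast
  note u1 = norm_exp_map[of "e *\<^sub>R v"]
  note \<rho> = radial_pos[OF X u1] radial_le_1[OF X u1] radial_mem[OF X u1]
  have "?\<rho> *\<^sub>R ?u \<notin> interior ?K"
  proof
    assume "?\<rho> *\<^sub>R ?u \<in> interior ?K"
    then obtain r where r: "r > 0" "cball (?\<rho> *\<^sub>R ?u) r \<subseteq> ?K" by (auto simp: mem_interior_cball)
    have "dist (?\<rho> *\<^sub>R ?u) ((?\<rho> + r) *\<^sub>R ?u) = r"
      using r(1) by (simp add: dist_norm scaleR_left_distrib)
    then have "(?\<rho> + r) *\<^sub>R ?u \<in> ?K" using r(2) by auto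
    then show False using radial_iff[OF X norm_exp_map, of "?\<rho> + r" "e *\<^sub>R v"] r(1) \<rho>(1) by simp
  qed
  from supporting_hyperplane_not_interior[OF convex_convex_hull this]
  obtain n0 where n0: "n0 \<noteq> 0" "\<And>y. y \<in> ?K \<Longrightarrow> n0 \<bullet> y \<le> n0 \<bullet> (?\<rho> *\<^sub>R ?u)" by blast
  define n where "n = n0 /\<^sub>R norm n0"
  have n: "norm n = 1" using n0(1) by (simp add: n_def)
  have sup: "y \<bullet> n \<le> ?\<rho> * (?u \<bullet> n)" if "y \<in> ?K" for y
  proof -
    have "(n0 \<bullet> y) / norm n0 \<le> (n0 \<bullet> (?\<rho> *\<^sub>R ?u)) / norm n0"
      by (intro divide_right_mono n0(2) that) simp
    then show ?thesis by (simp add: n_def inner_commute divide_inverse algebra_simps)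
  qed
  obtain p q where pq: "n = (p, q)" by fastforce
  have pq1: "(norm p)\<^sup>2 + q\<^sup>2 = 1"
    using n unfolding pq norm_Pair by (simp add: real_sqrt_eq_1_iff)
  obtain r where r: "r > 0" "cball 0 r \<subseteq> ?K" using X(3) by (auto simp: mem_interior_cball)
  have "r *\<^sub>R n \<in> ?K" using r n by (intro subsetD[OF r(2)]) simp
  from sup[OF this] have "r \<le> ?\<rho> * (?u \<bullet> n)" using n by (simp add: dot_square_norm)
  \<comment> \<open>The inscribed ball forces a positive component along the normal; this later
    excludes normals outside the open upper hemisphere.\<close>
  then have un: "?u \<bullet> n > 0" using r(1) \<rho>(1) by (smt (verit) zero_less_mult_pos)
  define s where "s = sin_quotient (norm (e *\<^sub>R v))"
  define k where "k = cos (norm (e *\<^sub>R v))"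
  have u: "?u \<bullet> n = e * s * (v \<bullet> p) + k * q" by (simp add: exp_map_eq pq s_def k_def algebra_simps)
  have vp: "\<bar>s * (v \<bullet> p)\<bar> \<le> R * norm p"
  proof -
    have "\<bar>s * (v \<bullet> p)\<bar> \<le> 1 * (norm v * norm p)"
      unfolding abs_mult s_def by (intro mult_mono abs_sin_quotient_le Cauchy_Schwarz_ineq2) auto
    also have "\<dots> \<le> R * norm p" using v by (simp add: mult_right_mono)
    finally show ?thesis .
  qed
  have evp: "e * s * (v \<bullet> p) \<le> e * (R * norm p)"
    using mult_left_mono[of "s * (v \<bullet> p)" "R * norm p" e] vp e by (simp add: mult.assoc abs_le_iff)
  obtain w g where w: "pole_chart e (w, g) \<in> X" "0 \<le> g" "g \<le> G" "(3 * R + 1) * norm p \<le> w \<bullet> p"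
  proof -
    obtain a where a: "a \<in> corner_points L" "\<And>w. w \<in> cball a 1 \<Longrightarrow> w \<bullet> p \<ge> (L / real DIM('v) - 1) * norm p"
      using corner_direction[OF corners(2), of p] by blast
    then obtain w g where wg: "pole_chart e (w, g) \<in> X" "w \<in> cball a 1" "0 \<le> g" "g \<le> G"
      using corners(1) by (force simp: cap_corners_def)
    have "(3 * R + 1) * norm p \<le> (L / real DIM('v) - 1) * norm p" using L by (intro mult_right_mono) auto
    also have "\<dots> \<le> w \<bullet> p" by (rule a(2)[OF wg(2)])
    finally show ?thesis using that wg by blast
  qed
  have "pole_chart e (w, g) \<in> ?K" using w(1) by (rule hull_inc)
  from sup[OF this] have "e * (w \<bullet> p) + (1 - e\<^sup>2 * g) * q \<le> ?\<rho> * (e * s * (v \<bullet> p)) + ?\<rho> * k * q"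
    unfolding u by (simp add: pole_chart_def pq algebra_simps)
  also have "?\<rho> * (e * s * (v \<bullet> p)) \<le> 1 * (e * (R * norm p))"
  proof -
    have "?\<rho> * (e * s * (v \<bullet> p)) \<le> ?\<rho> * (e * (R * norm p))" using evp \<rho>(1) by (intro mult_left_mono) auto
    also have "\<dots> \<le> 1 * (e * (R * norm p))" using \<rho>(2) e R by (intro mult_right_mono) auto
    finally show ?thesis .
  qed
  finally have "e * (w \<bullet> p) + (1 - e\<^sup>2 * g) * q \<le> e * (R * norm p) + ?\<rho> * k * q" by simp
  moreover have "e * ((3 * R + 1) * norm p) \<le> e * (w \<bullet> p)" using w(4) e by (intro mult_left_mono) auto
  \<comment> \<open>The cell contributes 3R + 1 and the boundary point takes away R. The remaining
    2R + 1 has to beat the 2R that arises in \<open>q0\<close> from a cosine of at least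
    1/2.\<close>
  ultimately have main: "e * ((2 * R + 1) * norm p) \<le> q * (?\<rho> * k - 1 + e\<^sup>2 * g)"
    by (simp add: algebra_simps)
  have k1: "k \<le> 1" "1 / 2 \<le> k" using cos by (auto simp: k_def)
  have \<rho>k: "0 \<le> ?\<rho> * k" "?\<rho> * k \<le> 1" using \<rho>(1,2) k1 mult_mono[OF \<rho>(2) k1(1)] by auto
  have q0: "q > 0"
  proof (rule ccontr)
    assume "\<not> q > 0"
    then have q: "q \<le> 0" by simp
    have "0 \<le> e\<^sup>2 * g" using w(2) by simp
    then have "q * (?\<rho> * k - 1 + e\<^sup>2 * g) \<le> q * (- 1)"
      using q \<rho>k by (intro mult_left_mono_neg) auto
    then have 1: "e * ((2 * R + 1) * norm p) \<le> - q" using main by simp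
    have "- (k * q) < e * s * (v \<bullet> p)" using un unfolding u by simp
    moreover have "(- q) * (1 / 2) \<le> (- q) * k" using q k1 by (intro mult_left_mono) auto
    ultimately have 2: "- q < 2 * (e * (R * norm p))" using evp by (simp add: mult.commute)
    have "e * ((2 * R + 1) * norm p) < 2 * (e * (R * norm p))" using 1 2 by linarith
    then have "e * norm p < 0" by (simp add: algebra_simps)
    then show False using e by (simp add: mult_less_0_iff)
  qed
  have "q * (?\<rho> * k - 1 + e\<^sup>2 * g) \<le> q * (e\<^sup>2 * G)"
    using q0 \<rho>k w(3) mult_left_mono[OF w(3), of "e\<^sup>2"] by (intro mult_left_mono) auto
  moreover have "e * norm p \<le> e * ((2 * R + 1) * norm p)"
    using e R by (intro mult_left_mono) (auto simp: algebra_simps)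
  ultimately have "e * norm p \<le> q * (e\<^sup>2 * G)" using main by linarith
  then have "e * norm p \<le> e * (q * (e * G))" by (simp add: power2_eq_square algebra_simps)
  then have "norm p \<le> q * (e * G)" using e by simp
  then have pq_le: "norm p / q \<le> e * G" using q0 by (simp add: field_simps)
  \<comment> \<open>The normal is within order e of the pole, so after division by e its parameter
    is bounded independently of e.\<close>
  obtain a' where a': "exp_map a' = (p, q)" "norm a' \<le> norm p / q" using exp_map_onto[OF pq1 q0] by blast
  define a where "a = a' /\<^sub>R e"
  have ea: "e *\<^sub>R a = a'" using e by (simp add: a_def)
  have na: "norm a \<le> G" using a'(2) pq_le e by (simp add: a_def field_simps)
  have n': "exp_map (e *\<^sub>R a) = n" using a'(1) ea pq by simp
  have "1 - ?\<rho> * (?u \<bullet> n) \<le> e\<^sup>2 * rescaled_support e X a"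
  proof -
    obtain x where x: "x \<in> X" "rescaled_support e X a = cap_defect e a x"
      using rescaled_support_attained[OF X(1,3) e] by blast
    have "x \<bullet> n \<le> ?\<rho> * (?u \<bullet> n)" by (rule sup[OF hull_inc[OF x(1)]])
    then show ?thesis using e x(2) by (simp add: cap_defect_def n')
  qed
  then have "(?u \<bullet> n - ?\<rho> * (?u \<bullet> n)) / e\<^sup>2 \<le> (e\<^sup>2 * rescaled_support e X a - 1 + ?u \<bullet> n) / e\<^sup>2"
    by (intro divide_right_mono) auto
  moreover have "(e\<^sup>2 * rescaled_support e X a - 1 + ?u \<bullet> n) / e\<^sup>2 = rescaled_support e X a - cap_defect e v n"
    using e by (simp add: cap_defect_def inner_commute field_simps)
  moreover have "(?u \<bullet> n - ?\<rho> * (?u \<bullet> n)) / e\<^sup>2 = (?u \<bullet> n) * rescaled_radius e X v"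
    by (simp add: rescaled_radius_interior[OF X(3)] algebra_simps)
  ultimately show ?thesis using na n' by (intro exI[of _ a]) simp
qed

text \<open>The supremum is at most the radius without any error, since half the squared distance
  dominates the cap defect. Conversely, that replacement costs \<eta>, and the cosine, within
  \<open>2 * (e * H)\<^sup>2\<close> of 1, costs \<open>4 * B * (e * H)\<^sup>2\<close> because the
  radius is at most 2B.\<close>

lemma rescaled_radius_approx:
  fixes X :: "('v::euclidean_space \<times> real) set"
  assumes X: "finite X" "X \<subseteq> cball 0 1" "0 \<in> interior (convex hull X)" and e: "e > 0"
    and corners: "cap_corners e L G X" "L \<ge> 0" and v: "norm v \<le> R" and L: "L / real DIM('v) - 1 \<ge> 3 * R + 1"
    and H: "G \<le> H" "R \<le> H" and eH: "e * H \<le> 1 / 2"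
    and B: "\<And>a. norm a \<le> H \<Longrightarrow> rescaled_support e X a \<le> B"
    and \<eta>: "\<And>a. norm a \<le> H \<Longrightarrow> (norm (v - a))\<^sup>2 / 2 - \<eta> \<le> cap_defect e v (exp_map (e *\<^sub>R a))"
  shows "\<bar>rescaled_radius e X v - sup_convolution H (rescaled_support e X) v\<bar> \<le> \<eta> + 4 * B * (e * H)\<^sup>2"
proof -
  let ?S = "rescaled_support e X" and ?r = "rescaled_radius e X v"
  let ?q = "\<lambda>a. cap_defect e v (exp_map (e *\<^sub>R a))" and ?c = "\<lambda>a. exp_map (e *\<^sub>R v) \<bullet> exp_map (e *\<^sub>R a)"
  have R: "R \<ge> 0" using v norm_ge_zero order_trans by blast
  have H0: "H \<ge> 0" using H(2) R by linarith
  have cont: "continuous_on (cball 0 H) ?S" by (rule continuous_rescaled_support[OF X(1,2) e])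
  have r0: "?r \<ge> 0"
    using radial_le_1[OF X norm_exp_map[of "e *\<^sub>R v"]] by (simp add: rescaled_radius_interior[OF X(3)])
  have c_eq: "?c a = 1 - e\<^sup>2 * ?q a" for a using e by (simp add: cap_defect_def inner_commute)
  have q_le: "?q a \<le> (norm (v - a))\<^sup>2 / 2" for a by (rule cap_defect_exp_map_le[OF e])
  have q0: "?q a \<ge> 0" for a by (rule cap_defect_nonneg) simp
  have c1: "?c a \<le> 1" for a unfolding c_eq using q0 by simp
  have S0: "?S a \<ge> 0" for a by (rule rescaled_support_nonneg[OF X(1,2) e])
  have B0: "B \<ge> 0" using S0[of 0] B[of 0] H0 by simp
  have eq: "e\<^sup>2 * ?q a \<le> 2 * (e * H)\<^sup>2" if "norm a \<le> H" for a
  proof -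
    have "norm (v - a) \<le> 2 * H" using norm_triangle_ineq4[of v a] v H(2) that by linarith
    then have "(norm (v - a))\<^sup>2 \<le> (2 * H)\<^sup>2" by (intro power_mono) auto
    then have "?q a \<le> 2 * H\<^sup>2" using q_le[of a] by (simp add: power_mult_distrib)
    then have "e\<^sup>2 * ?q a \<le> e\<^sup>2 * (2 * H\<^sup>2)" by (intro mult_left_mono) auto
    then show ?thesis by (simp add: power_mult_distrib)
  qed
  have eH2: "(e * H)\<^sup>2 \<le> (1 / 2)\<^sup>2" using eH e H0 by (intro power_mono) auto
  have "sup_convolution H ?S v \<le> ?r"
  proof (rule sup_convolution_le[OF H0])
    fix a :: 'v
    have "?S a - (norm (v - a))\<^sup>2 / 2 \<le> ?S a - ?q a" using q_le[of a] by simp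
    also have "\<dots> \<le> ?c a * ?r" by (rule rescaled_radius_lower[OF X e])
    also have "\<dots> \<le> 1 * ?r" using c1 r0 by (intro mult_right_mono) auto
    finally show "?S a - (norm (v - a))\<^sup>2 / 2 \<le> ?r" by simp
  qed
  moreover have "?r \<le> sup_convolution H ?S v + (\<eta> + 4 * B * (e * H)\<^sup>2)"
  proof -
    have "norm (e *\<^sub>R v) \<le> e * H" using v H(2) e by (simp add: mult_left_mono)
    then have "norm (e *\<^sub>R v) \<le> 1" using eH by linarith
    then have "(norm (e *\<^sub>R v))\<^sup>2 \<le> 1" by (simp add: power_le_one)
    then have "cos (norm (e *\<^sub>R v)) \<ge> 1 / 2" using one_minus_cos_le[of "norm (e *\<^sub>R v)"] by linarith
    from rescaled_radius_upper[OF X e corners v L this]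
    obtain a where a: "norm a \<le> G" "?c a * ?r \<le> ?S a - ?q a" by blast
    have aH: "norm a \<le> H" using a(1) H(1) by linarith
    have c: "?c a \<ge> 1 / 2" unfolding c_eq using eq[OF aH] eH2 by (simp add: power2_eq_square)
    have "1 / 2 * ?r \<le> ?c a * ?r" using c r0 by (intro mult_right_mono)
    also have "\<dots> \<le> B" using a(2) q0[of a] B[OF aH] by linarith
    finally have r: "?r \<le> 2 * B" by simp
    have "?r = ?c a * ?r + (e\<^sup>2 * ?q a) * ?r" unfolding c_eq by (simp add: algebra_simps)
    moreover have "(e\<^sup>2 * ?q a) * ?r \<le> (2 * (e * H)\<^sup>2) * (2 * B)"
      by (intro mult_mono eq[OF aH] r r0) simp
    moreover have "(2 * (e * H)\<^sup>2) * (2 * B) = 4 * B * (e * H)\<^sup>2" by simp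
    ultimately have "?r \<le> ?S a - ?q a + 4 * B * (e * H)\<^sup>2" using a(2) by linarith
    with \<eta>[OF aH] sup_convolution_ge[OF cont aH, of v] show ?thesis by linarith
  qed
  moreover have "0 \<le> \<eta> + 4 * B * (e * H)\<^sup>2"
  proof -
    have "0 \<le> \<eta>" using \<eta>[of 0] q_le[of 0] H0 by simp
    then show ?thesis using B0 by simp
  qed
  ultimately show ?thesis by (simp add: abs_le_iff)
qed

section \<open>Convergence in law of the radius functions\<close>

context poisson_polytopes
begin

definition radius_process :: "real \<Rightarrow> 'w \<Rightarrow> 'v \<Rightarrow> real" where
  "radius_process lam \<omega> = rescaled_radius (chart_scale lam) (P lam \<omega>)"

definition hull_process :: "'z \<Rightarrow> 'v \<Rightarrow> real" where
  "hull_process \<omega> = (if \<omega> \<in> full_event then hull_boundary (Q \<omega>) else (\<lambda>_. 0))"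

lemma radius_process_measurable:
  assumes lam: "lam > 0"
  shows "(\<lambda>\<omega>. radius_process lam \<omega> v) \<in> borel_measurable (M lam)"
proof (rule borel_measurable_iff_le[THEN iffD2], rule allI)
  fix c
  let ?e = "chart_scale lam" and ?u = "exp_map (chart_scale lam *\<^sub>R v)"
  note e = chart_scale_pos[OF lam]
  obtain D :: "('v \<times> real) set" where D: "countable D" "\<And>U. open U \<Longrightarrow> U \<noteq> {} \<Longrightarrow> \<exists>d\<in>D. d \<in> U"
    using countable_dense_exists[where 'a = "'v \<times> real"] by blast
  let ?t = "1 - c * ?e\<^sup>2"
  \<comment> \<open>For nonpositive \<open>?t\<close> the condition \<open>?t \<le> radial\<close>
    is automatic, as the radius is positive.\<close>
  define W where "W = (if ?t > 0 then space (M lam) - (\<Union>w\<in>D. {\<omega> \<in> space (M lam). P lam \<omega> \<inter> {x. ?t * (?u \<bullet> w) \<le> x \<bullet> w} = {}})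
    else space (M lam))"
  have 1: "radius_process lam \<omega> v \<le> c \<longleftrightarrow> \<omega> \<in> W" if w: "\<omega> \<in> interior_event lam" for \<omega>
  proof -
    have w': "\<omega> \<in> space (M lam)" "0 \<in> interior (convex hull P lam \<omega>)"
      using w by (auto simp: interior_event_def)
    note X = P_finite[OF lam w'(1)] P_subset[OF lam w'(1)] w'(2)
    have ne: "P lam \<omega> \<noteq> {}" using X(3) by auto
    have "(1 - x) / ?e\<^sup>2 \<le> c \<longleftrightarrow> ?t \<le> x" for x
    proof -
      have "(1 - x) / ?e\<^sup>2 \<le> c \<longleftrightarrow> 1 - x \<le> c * ?e\<^sup>2" using e by (simp add: divide_le_eq)
      also have "\<dots> \<longleftrightarrow> ?t \<le> x" by linarith
      finally show ?thesis .
    qed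
    then have "radius_process lam \<omega> v \<le> c \<longleftrightarrow> ?t \<le> radial (P lam \<omega>) ?u"
      unfolding radius_process_def rescaled_radius_interior[OF X(3)] .
    also have "\<dots> \<longleftrightarrow> \<omega> \<in> W"
    proof (cases "?t > 0")
      case True
      have "?t \<le> radial (P lam \<omega>) ?u \<longleftrightarrow> ?t *\<^sub>R ?u \<in> convex hull P lam \<omega>"
        using radial_iff[OF X norm_exp_map True, of "?e *\<^sub>R v"] by simp
      also have "\<dots> \<longleftrightarrow> (\<forall>w\<in>D. \<exists>x\<in>P lam \<omega>. (?t *\<^sub>R ?u) \<bullet> w \<le> x \<bullet> w)"
        by (rule mem_convex_hull_iff_countable[OF X(1) ne D(2)])
      also have "\<dots> \<longleftrightarrow> \<omega> \<in> W" using True w'(1) by (auto simp: W_def)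
      finally show ?thesis .
    next
      case False
      then show ?thesis using radial_pos[OF X norm_exp_map, of "?e *\<^sub>R v"] w'(1) by (auto simp: W_def)
    qed
    finally show ?thesis .
  qed
  have 2: "radius_process lam \<omega> v = 1 / ?e\<^sup>2" if "\<omega> \<in> space (M lam)" "\<omega> \<notin> interior_event lam" for \<omega>
    using that by (simp add: radius_process_def interior_event_def rescaled_radius_not_interior)
  have sub: "interior_event lam \<subseteq> space (M lam)" by (auto simp: interior_event_def)
  have "{\<omega> \<in> space (M lam). radius_process lam \<omega> v \<le> c} =
      (interior_event lam \<inter> W) \<union> (if 1 / ?e\<^sup>2 \<le> c then space (M lam) - interior_event lam else {})"
  proof (rule set_eqI)
    fix \<omega>
    show "\<omega> \<in> {\<omega> \<in> space (M lam). radius_process lam \<omega> v \<le> c} \<longleftrightarrow>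
      \<omega> \<in> (interior_event lam \<inter> W) \<union> (if 1 / ?e\<^sup>2 \<le> c then space (M lam) - interior_event lam else {})"
    proof (cases "\<omega> \<in> interior_event lam")
      case True
      then show ?thesis using 1[OF True] subsetD[OF sub True] by simp
    next
      case False
      then show ?thesis using 2[of \<omega>] by auto
    qed
  qed
  also have "\<dots> \<in> sets (M lam)"
  proof -
    have "{x :: 'v \<times> real. ?t * (?u \<bullet> w) \<le> x \<bullet> w} \<in> sets borel" for w
      by (intro borel_closed closed_Collect_le continuous_intros)
    from sets_P_void[OF lam this] have "W \<in> sets (M lam)"
      using D(1) by (auto simp: W_def intro!: sets.Diff sets.countable_UN'')
    then show ?thesis using sets_interior_event[OF lam] by auto
  qed
  finally show "{\<omega> \<in> space (M lam). radius_process lam \<omega> v \<le> c} \<in> sets (M lam)" .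
qed

lemma radius_process_mspace:
  assumes "lam > 0" "\<omega> \<in> space (M lam)"
  shows "restrict (radius_process lam \<omega>) (cball 0 R) \<in> mspace (continuous_functions_on (cball 0 R))"
  unfolding radius_process_def
  by (rule restrict_mspace[OF compact_cball
      continuous_rescaled_radius[OF P_finite[OF assms] P_subset[OF assms] chart_scale_pos[OF assms(1)]]])

text \<open>The threshold for the truncation depends on \<omega>, but every larger H works. This
  yields continuity of the hull boundary and, with H running through the integers, its
  measurability.\<close>

lemma hull_process_eq:
  assumes w: "\<omega> \<in> full_event" and R: "R \<ge> 0"
  shows "\<exists>G. \<forall>H\<ge>G. \<forall>v\<in>cball 0 R. hull_process \<omega> v = sup_convolution H (growth_process \<omega>) v"
proof -
  obtain L G where L: "L \<ge> real DIM('v) * (R + 2)" "parabola_corners L G (Q \<omega>)"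
    using full_event_corners[OF w] by blast
  have L0: "L \<ge> 0" using L(1) R by (smt (verit) mult_nonneg_nonneg of_nat_0_le_iff)
  have L': "L / real DIM('v) - 1 \<ge> R + 1" using L(1) by (simp add: le_divide_eq algebra_simps)
  have s: "\<omega> \<in> space N" using w full_event_subset by auto
  have "hull_process \<omega> v = sup_convolution H (growth_process \<omega>) v"
    if H: "H \<ge> max 0 (G + 1)" and v: "v \<in> cball 0 R" for H v
  proof -
    have "continuous_on (cball 0 H) (growth (Q \<omega>))"
      using continuous_growth_process[OF s, of H] w H by (simp add: growth_process_def)
    then show ?thesis
      using hull_boundary_eq_sup_convolution[OF Q_subset[OF s] Q_finite[OF s] L(2) L0 _ L', of v H] w H v
      by (simp add: hull_process_def growth_process_def)
  qed
  then show ?thesis by blast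
qed

lemma hull_process_mspace:
  assumes "\<omega> \<in> space N" "R \<ge> 0"
  shows "restrict (hull_process \<omega>) (cball 0 R) \<in> mspace (continuous_functions_on (cball 0 R))"
proof (cases "\<omega> \<in> full_event")
  case True
  obtain G where G: "\<forall>H\<ge>G. \<forall>v\<in>cball 0 R. hull_process \<omega> v = sup_convolution H (growth_process \<omega>) v"
    using hull_process_eq[OF True assms(2)] by blast
  define H where "H = max 0 G"
  have "restrict (hull_process \<omega>) (cball 0 R) = restrict (sup_convolution H (growth_process \<omega>)) (cball 0 R)"
    using G by (intro restrict_ext) (auto simp: H_def)
  moreover have "H \<ge> 0" by (simp add: H_def)
  ultimately show ?thesis
    using sup_convolution_mspace[OF _ assms(2) continuous_growth_process[OF assms(1)]] by simp
next
  case False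
  then show ?thesis by (intro restrict_mspace compact_cball) (simp add: hull_process_def)
qed

text \<open>Evaluation at v after a truncated \<open>sup_convolution\<close> is a continuous
  functional of the growth function, and the sequence over integer truncations is eventually
  constant.\<close>

lemma hull_process_measurable: "(\<lambda>\<omega>. hull_process \<omega> v) \<in> borel_measurable N"
proof (rule borel_measurable_LIMSEQ_real)
  let ?f = "\<lambda>i \<omega>. restrict (sup_convolution (real i) (growth_process \<omega>)) (cball 0 (norm v)) v"
  fix i :: nat
  let ?m = "continuous_functions_on (cball (0 :: 'v) (real i))" and ?m' = "continuous_functions_on (cball (0 :: 'v) (norm v))"
  let ?\<Gamma> = "\<lambda>\<phi>. restrict (sup_convolution (real i) \<phi>) (cball (0 :: 'v) (norm v))"
  have "(\<lambda>\<omega>. restrict (growth_process \<omega>) (cball 0 (real i))) \<in> measurable N (mborel ?m)"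
    using growth_process_measurable
    by (intro measurable_random_function compact_cball growth_process_mspace) auto
  moreover have "lipschitz_functional ?m' 1 (\<lambda>f. f v)"
    unfolding lipschitz_functional_def using abs_le_mdist_continuous_functions_on[where B = "cball (0 :: 'v) (norm v)"] by auto
  then have "continuous_map (mtopology_of ?m') euclideanreal (\<lambda>f. f v)"
    by (rule lipschitz_functional_continuous)
  then have "continuous_map (mtopology_of ?m) euclideanreal (\<lambda>\<phi>. ?\<Gamma> \<phi> v)"
    using continuous_map_compose[OF sup_convolution_continuous_map[OF of_nat_0_le_iff[of i] norm_ge_zero[of v]]]
    unfolding o_def by blast
  ultimately have "(\<lambda>\<omega>. ?\<Gamma> (restrict (growth_process \<omega>) (cball 0 (real i))) v) \<in> borel_measurable N"
    using measurable_compose[OF _ measurable_continuous_map_mborel] by blast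
  moreover have "?\<Gamma> (restrict (growth_process \<omega>) (cball 0 (real i))) = ?\<Gamma> (growth_process \<omega>)" for \<omega>
    by (intro restrict_ext sup_convolution_cong) simp
  ultimately have "(\<lambda>\<omega>. ?f i \<omega>) \<in> borel_measurable N" by simp
  then show "(\<lambda>\<omega>. if \<omega> \<in> full_event then ?f i \<omega> else 0) \<in> borel_measurable N"
    using sets_full_event full_event_subset
    by (intro measurable_If_set) (auto simp: Int_absorb2)
next
  fix \<omega> assume "\<omega> \<in> space N"
  show "(\<lambda>i. if \<omega> \<in> full_event then restrict (sup_convolution (real i) (growth_process \<omega>)) (cball 0 (norm v)) v else 0)
      \<longlonglongrightarrow> hull_process \<omega> v"
  proof (cases "\<omega> \<in> full_event")
    case True
    obtain G where G: "\<forall>H\<ge>G. \<forall>a\<in>cball 0 (norm v). hull_process \<omega> a = sup_convolution H (growth_process \<omega>) a"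
      using hull_process_eq[OF True norm_ge_zero] by blast
    have "\<forall>\<^sub>F i in sequentially. G \<le> real i"
      using filterlim_real_sequentially by (simp add: filterlim_at_top)
    then have "\<forall>\<^sub>F i in sequentially. hull_process \<omega> v = restrict (sup_convolution (real i) (growth_process \<omega>)) (cball 0 (norm v)) v"
      by eventually_elim (use G in auto)
    then show ?thesis using True by (simp add: tendsto_eventually eventually_mono)
  qed (simp add: hull_process_def)
qed

lemma radius_law_limit:
  assumes R: "R > 0"
  shows "law_limit (continuous_functions_on (cball 0 R))
    M (\<lambda>lam \<omega>. restrict (radius_process lam \<omega>) (cball 0 R))
    N (\<lambda>\<omega>. restrict (hull_process \<omega>) (cball 0 R))"
proof (rule law_limit_approx[OF prob_M _ prob_N])
  let ?m = "continuous_functions_on (cball (0 :: 'v) R)"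
  show "(\<lambda>\<omega>. restrict (radius_process lam \<omega>) (cball 0 R)) \<in> measurable (M lam) (mborel ?m)" if "lam > 0" for lam
    using radius_process_measurable[OF that]
    by (intro measurable_random_function compact_cball radius_process_mspace that) auto
  show "(\<lambda>\<omega>. restrict (hull_process \<omega>) (cball 0 R)) \<in> measurable N (mborel ?m)"
    using hull_process_measurable R
    by (intro measurable_random_function compact_cball hull_process_mspace) auto
  fix \<epsilon> :: real assume \<epsilon>: "\<epsilon> > 0"
  \<comment> \<open>Fixed by the window alone, before G is chosen; it meets the demands 3R + 1 of
    the radius and R + 1 of the hull.\<close>
  define L where "L = real DIM('v) * (3 * R + 2)"
  have L: "L \<ge> 0" "L / real DIM('v) - 1 \<ge> 3 * R + 1" "L / real DIM('v) - 1 \<ge> R + 1"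
    using R by (simp_all add: L_def)
  obtain G where G: "\<forall>\<^sub>F lam in at_top. measure (M lam) (good_event L G lam) \<ge> 1 - \<epsilon>"
    "measure N (parabola_corner_event L G) \<ge> 1 - \<epsilon>"
    using good_events[OF \<epsilon>] by blast
  \<comment> \<open>Must contain all parameters a of the dual formulas, of norm at most G or G + 1,
    and the window. It depends on \<epsilon> through G.\<close>
  define H where "H = max (G + 1) R"
  have H: "H > 0" "G \<le> H" "R \<le> H" "H \<ge> G + 1" using R by (auto simp: H_def)
  define B where "B = H\<^sup>2 / 2 + (L + 1) * H + G"
  let ?m' = "continuous_functions_on (cball (0 :: 'v) H)"
  let ?X' = "\<lambda>lam \<omega>. restrict (support_process lam \<omega>) (cball 0 H)"
  let ?Y' = "\<lambda>\<omega>. restrict (growth_process \<omega>) (cball 0 H)"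
  let ?\<Gamma> = "\<lambda>\<phi>. restrict (sup_convolution H \<phi>) (cball (0 :: 'v) R)"
  have \<Gamma>: "?\<Gamma> (restrict \<phi> (cball 0 H)) = ?\<Gamma> \<phi>" for \<phi>
    by (intro restrict_ext sup_convolution_cong) simp
  have "law_limit ?m' M ?X' N ?Y'" by (rule support_law_limit[OF H(1)])
  moreover have "continuous_map (mtopology_of ?m') (mtopology_of ?m) ?\<Gamma>"
    using H R by (intro sup_convolution_continuous_map) auto
  moreover have "\<forall>\<^sub>F lam in at_top. \<exists>A\<in>sets (M lam). measure (M lam) A \<ge> 1 - \<epsilon> \<and>
      (\<forall>\<omega>\<in>A. mdist ?m (restrict (radius_process lam \<omega>) (cball 0 R)) (?\<Gamma> (?X' lam \<omega>)) \<le> \<epsilon>)"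
  proof -
    have "((\<lambda>e. 4 * B * (e * H)\<^sup>2) \<longlongrightarrow> 4 * B * (0 * H)\<^sup>2) (at_right 0)" by (intro tendsto_intros)
    then have "\<forall>\<^sub>F e in at_right 0. 4 * B * (e * H)\<^sup>2 < \<epsilon> / 2"
      using \<epsilon> by (intro order_tendstoD(2)) auto
    note ev1 = eventually_chart_scale[OF this]
    have "((\<lambda>e. e * H) \<longlongrightarrow> 0 * H) (at_right 0)" by (intro tendsto_intros)
    then have "\<forall>\<^sub>F e in at_right 0. e * H < 1 / 2" by (intro order_tendstoD(2)) auto
    note ev2 = eventually_chart_scale[OF this]
    note ev3 = eventually_chart_scale[OF cap_defect_exp_map_ge[where 'v = 'v, OF half_gt_zero[OF \<epsilon>] less_imp_le[OF H(1)]]]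
    from G(1) ev1 ev2 ev3 eventually_gt_at_top[of 0] show ?thesis
    proof eventually_elim
      case (elim lam)
      have "mdist ?m (restrict (radius_process lam \<omega>) (cball 0 R)) (?\<Gamma> (?X' lam \<omega>)) \<le> \<epsilon>"
        if w: "\<omega> \<in> good_event L G lam" for \<omega>
        unfolding \<Gamma>
      proof (rule mdist_continuous_functions_on_le)
        fix v :: 'v assume v: "v \<in> cball 0 R"
        note wD = good_event_D[OF w]
        have "\<bar>radius_process lam \<omega> v - sup_convolution H (support_process lam \<omega>) v\<bar> \<le> \<epsilon> / 2 + 4 * B * (chart_scale lam * H)\<^sup>2"
          unfolding radius_process_def support_process_def
        proof (rule rescaled_radius_approx[OF P_finite[OF elim(5) wD(1)] P_subset[OF elim(5) wD(1)] wD(2)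
              chart_scale_pos[OF elim(5)] wD(3) L(1) _ L(2) H(2,3)])
          show "norm v \<le> R" using v by simp
          show "chart_scale lam * H \<le> 1 / 2" using elim(3) by simp
          show "rescaled_support (chart_scale lam) (P lam \<omega>) a \<le> B" if "norm a \<le> H" for a
            using support_process_bounds(2)[OF elim(5) w L(1) that] by (simp add: support_process_def B_def)
          show "(norm (v - a))\<^sup>2 / 2 - \<epsilon> / 2 \<le> cap_defect (chart_scale lam) v (exp_map (chart_scale lam *\<^sub>R a))"
            if "norm a \<le> H" for a
          proof -
            have "norm v \<le> H" using v H(3) by simp
            then show ?thesis using elim(4) that by blast
          qed
        qed
        then show "\<bar>restrict (radius_process lam \<omega>) (cball 0 R) v - ?\<Gamma> (support_process lam \<omega>) v\<bar> \<le> \<epsilon>"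
          using v elim(2) by simp
      qed (use \<epsilon> in simp)
      then show ?case using elim(1) sets_good_event[OF elim(5)] by blast
    qed
  qed
  \<comment> \<open>On this event the dual formula is exact, so \<epsilon> matters only for the
    probability.\<close>
  moreover have "\<exists>A\<in>sets N. measure N A \<ge> 1 - \<epsilon> \<and>
      (\<forall>\<omega>\<in>A. mdist ?m (restrict (hull_process \<omega>) (cball 0 R)) (?\<Gamma> (?Y' \<omega>)) \<le> \<epsilon>)"
  proof (intro bexI[of _ "parabola_corner_event L G \<inter> full_event"] conjI ballI)
    show "parabola_corner_event L G \<inter> full_event \<in> sets N"
      using sets_parabola_corner_event sets_full_event by auto
    have "measure N (parabola_corner_event L G \<inter> full_event) = measure N (parabola_corner_event L G)"
      using AE_full_event sets_parabola_corner_event sets_full_event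
      by (intro measure_eq_AE) auto
    then show "measure N (parabola_corner_event L G \<inter> full_event) \<ge> 1 - \<epsilon>" using G(2) by simp
    fix \<omega> assume "\<omega> \<in> parabola_corner_event L G \<inter> full_event"
    then have w: "\<omega> \<in> space N" "parabola_corners L G (Q \<omega>)" "\<omega> \<in> full_event"
      by (auto simp: parabola_corner_event_def)
    show "mdist ?m (restrict (hull_process \<omega>) (cball 0 R)) (?\<Gamma> (?Y' \<omega>)) \<le> \<epsilon>"
      unfolding \<Gamma>
    proof (rule mdist_continuous_functions_on_le)
      fix v :: 'v assume v: "v \<in> cball 0 R"
      have "continuous_on (cball 0 H) (growth (Q \<omega>))"
        using continuous_growth_process[OF w(1), of H] w(3) H by (simp add: growth_process_def)
      then have "hull_boundary (Q \<omega>) v = sup_convolution H (growth (Q \<omega>)) v"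
        using hull_boundary_eq_sup_convolution[OF Q_subset[OF w(1)] Q_finite[OF w(1)] w(2) L(1) _ L(3), of v H] H v
        by simp
      then show "\<bar>restrict (hull_process \<omega>) (cball 0 R) v - ?\<Gamma> (growth_process \<omega>) v\<bar> \<le> \<epsilon>"
        using v w(3) \<epsilon> by (simp add: hull_process_def growth_process_def)
    qed (use \<epsilon> in simp)
  qed
  ultimately show "\<exists>(m' :: ('v \<Rightarrow> real) metric) X' Y' \<Gamma>. law_limit m' M X' N Y' \<and>
       continuous_map (mtopology_of m') (mtopology_of ?m) \<Gamma> \<and>
       (\<forall>\<^sub>F lam in at_top. \<exists>A\<in>sets (M lam). measure (M lam) A \<ge> 1 - \<epsilon> \<and>
          (\<forall>\<omega>\<in>A. mdist ?m (restrict (radius_process lam \<omega>) (cball 0 R)) (\<Gamma> (X' lam \<omega>)) \<le> \<epsilon>)) \<and>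
       (\<exists>A\<in>sets N. measure N A \<ge> 1 - \<epsilon> \<and> (\<forall>\<omega>\<in>A. mdist ?m (restrict (hull_process \<omega>) (cball 0 R)) (\<Gamma> (Y' \<omega>)) \<le> \<epsilon>))"
    by blast
qed

end

text \<open>The primed processes become the versions. For Y equality is only almost sure, because
  the limit processes are altered off \<open>full_event\<close>.\<close>

lemma converges_in_law_of_law_limit:
  assumes lim: "law_limit m M X' N Y'"
    and X: "\<And>lam \<omega>. lam > 0 \<Longrightarrow> \<omega> \<in> space (M lam) \<Longrightarrow> X lam \<omega> = X' lam \<omega>"
    and Y: "AE \<omega> in N. Y \<omega> = Y' \<omega>"
  shows "converges_in_law m M X N Y"
  unfolding converges_in_law_def
proof (intro exI conjI allI impI)
  show "random_element_version m (M lam) (X lam) (X' lam)" if "lam > 0" for lam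
    using lim X that by (auto simp: random_element_version_def law_limit_def intro!: AE_I2)
  show "random_element_version m N Y Y'"
    using lim Y by (auto simp: random_element_version_def law_limit_def)
  show "((\<lambda>lam. \<integral>\<omega>. F (X' lam \<omega>) \<partial>M lam) \<longlongrightarrow> (\<integral>\<omega>. F (Y' \<omega>) \<partial>N)) at_top"
    if "continuous_map (mtopology_of m) euclideanreal F \<and> bounded (F ` mspace m)" for F
    using lim that by (auto simp: law_limit_def)
qed

theorem theorem4p1:
  fixes d :: nat and \<delta> R :: real
    and M :: "real \<Rightarrow> 'w measure" and P :: "real \<Rightarrow> 'w \<Rightarrow> ((real ^ 'n) \<times> real) set"
    and N :: "'z measure" and Q :: "'z \<Rightarrow> ((real ^ 'n) \<times> real) set"
  assumes "d \<ge> 2" and "d = CARD('n) + 1" and "\<delta> > 0" and "R > 0"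
    and "\<And>lam. lam > 0 \<Longrightarrow>
           poisson_point_process (M lam) (cball 0 1) (ball_intensity \<delta> lam) (P lam)"
    and "poisson_point_process N (UNIV \<times> {0..}) (halfspace_intensity \<delta>) Q"
  shows "converges_in_law (continuous_functions_on (cball 0 R))
           M (\<lambda>lam \<omega>. restrict (rescale d \<delta> lam (support_defect (P lam \<omega>))) (cball 0 R))
           N (\<lambda>\<omega>. restrict (lower_boundary (paraboloid_growth (Q \<omega>))) (cball 0 R))
         \<and> converges_in_law (continuous_functions_on (cball 0 R))
           M (\<lambda>lam \<omega>. restrict (rescale d \<delta> lam (radius_defect (P lam \<omega>))) (cball 0 R))
           N (\<lambda>\<omega>. restrict (lower_boundary (paraboloid_hull (Q \<omega>))) (cball 0 R))"
proof -
  interpret poisson_polytopes d \<delta> M P N Q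
    using assms by unfold_locales auto
  show ?thesis
  proof
    show "converges_in_law (continuous_functions_on (cball 0 R))
           M (\<lambda>lam \<omega>. restrict (rescale d \<delta> lam (support_defect (P lam \<omega>))) (cball 0 R))
           N (\<lambda>\<omega>. restrict (lower_boundary (paraboloid_growth (Q \<omega>))) (cball 0 R))"
    proof (rule converges_in_law_of_law_limit[OF support_law_limit[OF \<open>R > 0\<close>]])
      show "restrict (rescale d \<delta> lam (support_defect (P lam \<omega>))) (cball 0 R) =
          restrict (support_process lam \<omega>) (cball 0 R)" if "lam > 0" for lam \<omega>
        by (intro restrict_ext) (simp add: rescale_eq[OF that] support_process_def rescaled_support_def)
      show "AE \<omega> in N. restrict (lower_boundary (paraboloid_growth (Q \<omega>))) (cball 0 R) =
          restrict (growth_process \<omega>) (cball 0 R)"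
        using AE_full_event by eventually_elim (simp add: growth_process_def growth_def)
    qed
    show "converges_in_law (continuous_functions_on (cball 0 R))
           M (\<lambda>lam \<omega>. restrict (rescale d \<delta> lam (radius_defect (P lam \<omega>))) (cball 0 R))
           N (\<lambda>\<omega>. restrict (lower_boundary (paraboloid_hull (Q \<omega>))) (cball 0 R))"
    proof (rule converges_in_law_of_law_limit[OF radius_law_limit[OF \<open>R > 0\<close>]])
      show "restrict (rescale d \<delta> lam (radius_defect (P lam \<omega>))) (cball 0 R) =
          restrict (radius_process lam \<omega>) (cball 0 R)" if "lam > 0" for lam \<omega>
        by (intro restrict_ext) (simp add: rescale_eq[OF that] radius_process_def rescaled_radius_def)
      show "AE \<omega> in N. restrict (lower_boundary (paraboloid_hull (Q \<omega>))) (cball 0 R) =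
          restrict (hull_process \<omega>) (cball 0 R)"
        using AE_full_event by eventually_elim (simp add: hull_process_def hull_boundary_def)
    qed
  qed
qed

end
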